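(* Let $\mathcal{H}$ be a separable complex Hilbert space, let $N\geq 2$ be an integer, let $p\geq 2$ be a real number with conjugate exponent $p'=\frac{p}{p-1}$, and let $T_1,\dots,T_N\in S_p(\mathcal{H})$. Let $(\alpha_{ij})_{1\leq i,j\leq N}$ be a symmetric matrix with entries $\alpha_{ij}\in[0,1]$ such that for all $i,j\in\{1,\dots,N\}$ $$\|T_i T_j^{*}\|_{S_{p/2}}\leq \alpha_{ij}^{2}\,\|T_i\|_{S_p}\|T_j\|_{S_p}\quad\text{and}\quad \|T_i^{*}T_j\|_{S_{p/2}}\leq \alpha_{ij}^{2}\,\|T_i\|_{S_p}\|T_j\|_{S_p}.$$ Then $$\Bigl\|\sum_{j=1}^N T_j\Bigr\|_{S_p}\leq \bigl\|(\alpha_{ij}^{p'})\bigr\|_{2}^{1/p'}\Bigl(\sum_{j=1}^N\|T_j\|_{S_p}^p\Bigr)^{1/p},$$ where $\|(\alpha_{ij}^{p'})\|_{2}$ is the operator norm on $\ell_2^N\to\ell_2^N$ of the $N\times N$ matrix with entries $\alpha_{ij}^{p'}$ (entrywise powers).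
   Context: For $1\leq q<\infty$, $S_q=S_q(\mathcal{H})$ denotes the Schatten--von Neumann class of compact operators $T$ on $\mathcal{H}$ with $\|T\|_{S_q}=\bigl(\sum_k\lambda_k^q\bigr)^{1/q}<\infty$, where $(\lambda_k)$ are the singular values of $T$, i.e. the eigenvalues (with multiplicity) of $|T|=\sqrt{T^*T}$. *)

theory Defs
  imports "HOL-Analysis.Analysis" "HOL-Library.Nonpos_Ints"
begin

(* A complex Hilbert space is built on top of a real one: the norm and topology come from
   real_inner and banach, the real inner product is the real part of the complex one
   (which is conjugate-linear in its first argument). Positive definiteness of cinner follows,
   since cinner x x is real by cinner_commute and has real part inner x x. *)
class chilbert_space = real_inner + banach +
  fixes scaleC :: "complex \<Rightarrow> 'a \<Rightarrow> 'a"  (infixr \<open>*\<^sub>C\<close> 75)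
    and cinner :: "'a \<Rightarrow> 'a \<Rightarrow> complex"
  assumes scaleC_add_right: "c *\<^sub>C (x + y) = c *\<^sub>C x + c *\<^sub>C y"
    and scaleC_add_left: "(c + d) *\<^sub>C x = c *\<^sub>C x + d *\<^sub>C x"
    and scaleC_scaleC: "c *\<^sub>C (d *\<^sub>C x) = (c * d) *\<^sub>C x"
    and scaleR_scaleC: "scaleR r x = complex_of_real r *\<^sub>C x"
    and cinner_commute: "cinner x y = cnj (cinner y x)"
    and cinner_add_left: "cinner (x + y) z = cinner x z + cinner y z"
    and cinner_scaleC_left: "cinner (c *\<^sub>C x) y = cnj c * cinner x y"
    and inner_eq_Re_cinner: "inner x y = Re (cinner x y)"

global_interpretation complex_vector:
  vector_space "scaleC :: complex \<Rightarrow> 'a \<Rightarrow> 'a::chilbert_space"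
  defines cdim = complex_vector.dim
proof
  fix c d :: complex and x y :: 'a
  show "c *\<^sub>C (x + y) = c *\<^sub>C x + c *\<^sub>C y" by (rule scaleC_add_right)
  show "(c + d) *\<^sub>C x = c *\<^sub>C x + d *\<^sub>C x" by (rule scaleC_add_left)
  show "c *\<^sub>C (d *\<^sub>C x) = (c * d) *\<^sub>C x" by (rule scaleC_scaleC)
  show "1 *\<^sub>C x = x" using scaleR_scaleC[of 1 x] by simp
qed

definition bounded_clinear :: "('a::chilbert_space \<Rightarrow> 'a) \<Rightarrow> bool" where
  "bounded_clinear T \<longleftrightarrow> bounded_linear T \<and> (\<forall>c x. T (c *\<^sub>C x) = c *\<^sub>C T x)"

definition compact_operator :: "('a::chilbert_space \<Rightarrow> 'a) \<Rightarrow> bool" where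
  "compact_operator T \<longleftrightarrow> bounded_clinear T \<and> compact (closure (T ` cball 0 1))"

(* For bounded T the function described exists (Riesz) and is unique; likewise for the
   positive square root in op_abs. *)
definition cadjoint :: "('a::chilbert_space \<Rightarrow> 'a) \<Rightarrow> 'a \<Rightarrow> 'a" where
  "cadjoint T = (THE S. \<forall>x y. cinner (T x) y = cinner x (S y))"

definition positive_operator :: "('a::chilbert_space \<Rightarrow> 'a) \<Rightarrow> bool" where
  "positive_operator T \<longleftrightarrow> bounded_clinear T \<and> (\<forall>x. cinner x (T x) \<in> \<real>\<^sub>\<ge>\<^sub>0)"

definition op_abs :: "('a::chilbert_space \<Rightarrow> 'a) \<Rightarrow> 'a \<Rightarrow> 'a" where
  "op_abs T = (THE S. positive_operator S \<and> S \<circ> S = cadjoint T \<circ> T)"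

definition eigenspace :: "('a::chilbert_space \<Rightarrow> 'a) \<Rightarrow> complex \<Rightarrow> 'a set" where
  "eigenspace T c = {x. T x = c *\<^sub>C x}"

(* The eigenvalue 0 of the modulus is left out: it contributes 0 to every sum of powers,
   and it is the only one whose multiplicity can be infinite when T is compact
   (cdim is 0 on infinite-dimensional subspaces). *)
definition singular_values :: "('a::chilbert_space \<Rightarrow> 'a) \<Rightarrow> real set" where
  "singular_values T = {s. 0 < s \<and> eigenspace (op_abs T) (complex_of_real s) \<noteq> {0}}"

definition singular_mult :: "('a::chilbert_space \<Rightarrow> 'a) \<Rightarrow> real \<Rightarrow> nat" where
  "singular_mult T s = cdim (eigenspace (op_abs T) (complex_of_real s))"

definition schatten_class :: "real \<Rightarrow> ('a::chilbert_space \<Rightarrow> 'a) set" where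
  "schatten_class q = {T. compact_operator T \<and>
     (\<lambda>s. real (singular_mult T s) * s powr q) summable_on singular_values T}"

(* Only meaningful on schatten_class q: infsum is 0 when the sum diverges. *)
definition schatten_norm :: "real \<Rightarrow> ('a::chilbert_space \<Rightarrow> 'a) \<Rightarrow> real" where
  "schatten_norm q T =
     (\<Sum>\<^sub>\<infinity>s\<in>singular_values T. real (singular_mult T s) * s powr q) powr (1 / q)"

(* Operator norm of the matrix (a i j) on the complex space l2 indexed by 'n;
   the norm of complex ^ 'n is the Euclidean one. *)
definition matrix_l2_norm :: "('n::finite \<Rightarrow> 'n \<Rightarrow> real) \<Rightarrow> real" where
  "matrix_l2_norm a =
     onorm (\<lambda>v :: complex ^ 'n. (\<chi> i j. complex_of_real (a i j)) *v v)"

end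

(* Write T j = U j P j (polar decomposition). Expanding <f, T b> as a sum of
   <P j^(1/2) U j* f, P j^(1/2) b> and applying Cauchy-Schwarz reduces the theorem to a bound on
   the sum of the P j and, symmetrically, of the U j P j U j*. Let R j = P j^(1/2). The singular
   values of R i R j are controlled by the hypotheses through Weyl's inequality, which after a Schur
   triangularisation is a direct test of P j P i on an orthonormal family. The nonzero eigenvalues of
   the sum of the P j are those of the block matrix (R i R j); its S_p norm is estimated by complex
   interpolation between p = infinity, where the matrix with entries \<alpha> i j powr p' acts on the block
   norms, and p = 2, where the square of the Hilbert-Schmidt norm is additive over blocks. Applying
   interpolation to blocks, which are free of constraints other than their norms, keeps the almost
   orthogonality intact along the analytic family. *)
theory Submission
  imports Defs "HOL-Complex_Analysis.Complex_Analysis"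
begin

section \<open>Complex inner product spaces\<close>

text \<open>Square roots turn the S_(p/2) bounds with \<alpha>^2 on P j P i into S_p bounds with
  \<alpha> on the blocks R i R j. The exponent p' is forced by the demand that one matrix,
  \<alpha>^a, govern both ends of the strip: blocks are weighted by \<alpha>^a at the operator norm
  end and by \<alpha>^(a/2) at the Hilbert-Schmidt end, and at the point 2/p these combine to
  \<alpha>^(a(1 - 2/p) + a/p), which is \<alpha> exactly for a = p'. Let X be the sum of s^p over
  the eigenvalues s of the sum of the P j, C the matrix norm and D the sum of the p-th powers of the
  norms of the T j. Pairing with s^(p-1) gives X <= (C X)^(1 - 2/p) (X C D)^(1/p), so X can be
  divided out to X <= C^(p-1) D, whose p-th root is the claimed bound. Two obstacles shape the
  details. The partial isometries U j destroy orthonormality, so Schatten norms are tested on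
  families that only satisfy Bessel's inequality. And \<open>schatten_norm\<close> is 0 outside the
  class, so the hypotheses on products carry no information until T i T j* and T i* T j are known to
  lie in S_(p/2).\<close>

lemma cinner_add_right: "cinner x (y + z) = cinner x y + cinner x (z::'a::chilbert_space)"
  by (metis cinner_add_left cinner_commute complex_cnj_add)

lemma cinner_scaleC_right: "cinner x (c *\<^sub>C y) = c * cinner x (y::'a::chilbert_space)"
  by (metis cinner_commute cinner_scaleC_left complex_cnj_cnj complex_cnj_mult)

lemma cinner_self: "cinner x x = complex_of_real ((norm (x::'a::chilbert_space))\<^sup>2)"
proof -
  have "Im (cinner x x) = - Im (cinner x x)"
    by (metis cinner_commute cnj.sel(2))
  then show ?thesis
    using inner_eq_Re_cinner[of x x] by (simp add: complex_eq_iff power2_norm_eq_inner)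
qed

lemma norm_scaleC: "norm (c *\<^sub>C (x::'a::chilbert_space)) = cmod c * norm x"
proof -
  have "complex_of_real ((norm (c *\<^sub>C x))\<^sup>2) = complex_of_real ((cmod c * norm x)\<^sup>2)"
    unfolding cinner_self[symmetric] cinner_scaleC_left cinner_scaleC_right
    by (simp add: cinner_self power_mult_distrib mult.assoc[symmetric] mult.commute[of "cnj c"] flip: complex_norm_square)
  then have "(norm (c *\<^sub>C x))\<^sup>2 = (cmod c * norm x)\<^sup>2"
    using of_real_eq_iff by blast
  then show ?thesis by simp
qed

lemma cinner_scaleR_left: "cinner (r *\<^sub>R x) (y::'a::chilbert_space) = r *\<^sub>R cinner x y"
  by (simp add: scaleR_scaleC cinner_scaleC_left scaleR_conv_of_real)

lemma cinner_scaleR_right: "cinner x (r *\<^sub>R (y::'a::chilbert_space)) = r *\<^sub>R cinner x y"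
  by (simp add: scaleR_scaleC cinner_scaleC_right scaleR_conv_of_real)

text \<open>Multiplying \<open>x\<close> by the phase of \<open>cinner x y\<close> makes the product
  real, which reduces the claim to the real Cauchy-Schwarz inequality.\<close>

lemma norm_cinner_le: "cmod (cinner x y) \<le> norm x * norm (y::'a::chilbert_space)"
proof (cases "cinner x y = 0")
  case False
  define u where "u = cinner x y / cmod (cinner x y)"
  have u: "cmod u = 1" using False by (simp add: u_def norm_divide)
  have "cnj (cinner x y) * cinner x y = complex_of_real (cmod (cinner x y)) * complex_of_real (cmod (cinner x y))"
    by (metis complex_norm_square mult.commute of_real_mult of_real_power power2_eq_square)
  then have "cnj u * cinner x y = cmod (cinner x y)"
    using False by (simp add: u_def)
  then have "cmod (cinner x y) = inner (u *\<^sub>C x) y"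
    by (simp add: inner_eq_Re_cinner cinner_scaleC_left)
  also have "\<dots> \<le> norm (u *\<^sub>C x) * norm y" by (rule norm_cauchy_schwarz)
  finally show ?thesis by (simp add: norm_scaleC u)
qed auto

lemma bounded_bilinear_cinner: "bounded_bilinear (cinner :: 'a::chilbert_space \<Rightarrow> 'a \<Rightarrow> complex)"
proof
  show "\<exists>K. \<forall>a b::'a. norm (cinner a b) \<le> norm a * norm b * K"
    by (rule exI[of _ 1]) (simp add: norm_cinner_le)
qed (simp_all add: cinner_add_left cinner_add_right cinner_scaleR_left cinner_scaleR_right)

interpretation cinner: bounded_bilinear "cinner :: 'a::chilbert_space \<Rightarrow> 'a \<Rightarrow> complex"
  by (rule bounded_bilinear_cinner)

lemmas [simp] = cinner.zero_left cinner.zero_right cinner_scaleC_left cinner_scaleC_right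
  cinner_scaleR_left cinner_scaleR_right

lemma bounded_linear_scaleC: "bounded_linear (\<lambda>x::'a::chilbert_space. c *\<^sub>C x)"
  by (rule bounded_linear_intro[where K = "cmod c"])
    (simp_all add: scaleC_add_right scaleR_scaleC scaleC_scaleC mult.commute norm_scaleC)

lemma cinner_eq_zeroI: "(\<And>y. cinner y x = 0) \<Longrightarrow> x = (0::'a::chilbert_space)"
  using cinner_self[of x] by simp

lemma cinner_eqI: "(\<And>z. cinner z x = cinner z y) \<Longrightarrow> x = (y::'a::chilbert_space)"
  using cinner_eq_zeroI[of "x - y"] by (simp add: cinner.diff_right)

lemma cinner_eq_zero_commute: "cinner x y = 0 \<longleftrightarrow> cinner y (x::'a::chilbert_space) = 0"
  by (metis cinner_commute complex_cnj_zero)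

lemma norm_cinner_commute: "cmod (cinner x y) = cmod (cinner y (x::'a::chilbert_space))"
  by (metis cinner_commute complex_mod_cnj)

lemma cinner_square: "cinner x y * cinner y x = complex_of_real ((cmod (cinner x (y::'a::chilbert_space)))\<^sup>2)"
  by (metis cinner_commute complex_norm_square)

lemma cinner_square': "cnj (cinner x y) * cinner x y = complex_of_real ((cmod (cinner x (y::'a::chilbert_space)))\<^sup>2)"
  by (metis complex_norm_square mult.commute)

lemma norm_eq_ReI: "cinner x x = complex_of_real r \<Longrightarrow> (norm (x::'a::chilbert_space))\<^sup>2 = r"
  by (simp add: cinner_self flip: of_real_power)

section \<open>Bounded operators and adjoints\<close>

lemma bounded_clinear_linear: "bounded_clinear T \<Longrightarrow> bounded_linear T"
  by (simp add: bounded_clinear_def)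

lemma bounded_clinear_simps:
  assumes "bounded_clinear T"
  shows "T (x + y) = T x + T y" "T (x - y) = T x - T y" "T (c *\<^sub>C x) = c *\<^sub>C T x" "T 0 = 0"
    "T (sum f A) = (\<Sum>i\<in>A. T (f i))" "T (- x) = - T x"
  using assms by (auto simp: bounded_clinear_def linear_simps linear_sum bounded_linear.linear)

lemma bounded_clinear_compose:
  "bounded_clinear S \<Longrightarrow> bounded_clinear T \<Longrightarrow> bounded_clinear (S \<circ> T)"
  by (auto simp: bounded_clinear_def comp_def intro: bounded_linear_compose)

lemma csubspace_imp_subspace:
  assumes "complex_vector.subspace M" shows "subspace (M :: 'a::chilbert_space set)"
  using assms unfolding subspace_def complex_vector.subspace_def
  by (simp add: scaleR_scaleC)

text \<open>The minimiser of the Dirichlet functional \<open>\<parallel>x\<parallel>\<^sup>2 - 2 f x\<close> on \<open>M\<close> represents \<open>f\<close>.\<close>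

lemma riesz_real:
  fixes M :: "'a::{real_inner, banach} set"
  assumes M: "subspace M" "closed M" and f: "bounded_linear f"
  shows "\<exists>z\<in>M. \<forall>x\<in>M. f x = inner z x"
proof -
  obtain K where K: "\<And>x. \<bar>f x\<bar> \<le> norm x * K"
    using bounded_linear.bounded[OF f] by auto
  define \<phi> where "\<phi> x = (norm x)\<^sup>2 - 2 * f x" for x
  note flin = linear_simps[OF f]
  have low: "\<phi> x \<ge> - K\<^sup>2" for x
  proof -
    have "0 \<le> (norm x - K)\<^sup>2" by simp
    then show ?thesis using K[of x] unfolding \<phi>_def by (simp add: power2_eq_square algebra_simps)
  qed
  define m where "m = (INF x\<in>M. \<phi> x)"
  have ne: "M \<noteq> {}" using M subspace_0 by blast
  have bdd: "bdd_below (\<phi> ` M)" using low by (auto intro!: bdd_belowI)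
  have mle: "m \<le> \<phi> x" if "x \<in> M" for x
    unfolding m_def by (rule cINF_lower[OF bdd that])
  \<comment> \<open>Parallelogram law together with minimality of \<open>m\<close> at the midpoint:
    approximate minimisers lie close together, which makes a minimising sequence Cauchy.\<close>
  have par: "(norm (x - y))\<^sup>2 \<le> 2 * (\<phi> x - m) + 2 * (\<phi> y - m)" if "x \<in> M" "y \<in> M" for x y
  proof -
    have "m \<le> \<phi> ((1/2) *\<^sub>R (x + y))"
      by (intro mle subspace_scale subspace_add M that)
    also have "\<phi> ((1/2) *\<^sub>R (x + y)) = (norm (x + y))\<^sup>2 / 4 - f x - f y"
      unfolding \<phi>_def by (simp add: flin power_divide add_divide_distrib)
    finally have "4 * m \<le> (norm (x + y))\<^sup>2 - 4 * f x - 4 * f y" by simp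
    moreover have "(norm (x - y))\<^sup>2 + (norm (x + y))\<^sup>2 = 2 * (norm x)\<^sup>2 + 2 * (norm y)\<^sup>2"
      by (simp add: power2_norm_eq_inner inner_simps inner_commute)
    ultimately show ?thesis unfolding \<phi>_def by (simp add: algebra_simps)
  qed
  have "\<exists>x\<in>M. \<phi> x < m + 1 / real (Suc n)" for n
  proof -
    have "m < m + 1 / real (Suc n)" by simp
    then show ?thesis
      unfolding m_def using cINF_less_iff[OF ne bdd] by (metis (no_types, lifting))
  qed
  then obtain x where xM: "\<And>n. x n \<in> M" and xm: "\<And>n. \<phi> (x n) < m + 1 / real (Suc n)"
    by metis
  have "Cauchy x"
  proof (rule metric_CauchyI)
    fix e :: real assume "e > 0"
    then obtain N where N: "1 / real (Suc N) < e\<^sup>2 / 4"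
      using nat_approx_posE[of "e\<^sup>2/4"] by auto
    show "\<exists>M. \<forall>m\<ge>M. \<forall>n\<ge>M. dist (x m) (x n) < e"
    proof (intro exI[of _ N] allI impI)
      fix i j assume ij: "N \<le> i" "N \<le> j"
      have "1 / real (Suc i) \<le> 1 / real (Suc N)" "1 / real (Suc j) \<le> 1 / real (Suc N)"
        using ij by (auto intro!: divide_left_mono)
      then have "\<phi> (x i) - m < e\<^sup>2 / 4" "\<phi> (x j) - m < e\<^sup>2 / 4"
        using xm[of i] xm[of j] N by linarith+
      then have "(norm (x i - x j))\<^sup>2 < e\<^sup>2"
        using par[OF xM[of i] xM[of j]] by simp
      then show "dist (x i) (x j) < e"
        using \<open>e > 0\<close> by (simp add: dist_norm power_less_imp_less_base)
    qed
  qed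
  then obtain z where z: "x \<longlonglongrightarrow> z" using Cauchy_convergent convergent_def by blast
  have zM: "z \<in> M" using closed_sequentially[OF M(2)] xM z by blast
  have "(\<lambda>n. \<phi> (x n)) \<longlonglongrightarrow> \<phi> z"
    unfolding \<phi>_def by (intro tendsto_intros z bounded_linear.tendsto[OF f])
  moreover have "(\<lambda>n. m + 1 / real (Suc n)) \<longlonglongrightarrow> m + 0"
    by (intro tendsto_intros LIMSEQ_Suc lim_1_over_n)
  ultimately have zm: "\<phi> z \<le> m"
    using xm by (metis (no_types, lifting) LIMSEQ_le add.right_neutral less_imp_le)
  have "f y = inner z y" if y: "y \<in> M" for y
  proof -
    \<comment> \<open>First variation at the minimiser in the direction \<open>y\<close>; the value
      t = -d/|y|^2 below minimises this quadratic and forces d = 0.\<close>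
    have *: "2 * t * (inner z y - f y) + t\<^sup>2 * (norm y)\<^sup>2 \<ge> 0" for t
    proof -
      have "\<phi> z \<le> \<phi> (z + t *\<^sub>R y)"
        using zm mle[of "z + t *\<^sub>R y"] zM y M by (meson order_trans subspace_add subspace_scale)
      moreover have "(norm (z + t *\<^sub>R y))\<^sup>2 = (norm z)\<^sup>2 + 2 * t * inner z y + t\<^sup>2 * (norm y)\<^sup>2"
        unfolding power2_norm_eq_inner by (simp add: inner_simps inner_commute power2_eq_square algebra_simps)
      ultimately show ?thesis unfolding \<phi>_def by (simp add: flin algebra_simps)
    qed
    define d where "d = inner z y - f y"
    have "d = 0"
    proof (cases "y = 0")
      case True then show ?thesis by (simp add: d_def flin)
    next
      case False
      then have n: "(norm y)\<^sup>2 > 0" by simp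
      have "0 \<le> 2 * (- d / (norm y)\<^sup>2) * d + (- d / (norm y)\<^sup>2)\<^sup>2 * (norm y)\<^sup>2"
        using *[of "- d / (norm y)\<^sup>2"] unfolding d_def .
      also have "\<dots> = - (d\<^sup>2 / (norm y)\<^sup>2)"
        using n by (simp add: power2_eq_square field_simps)
      finally have "d\<^sup>2 / (norm y)\<^sup>2 \<le> 0" by simp
      then show ?thesis using n by (simp add: divide_le_0_iff)
    qed
    then show ?thesis by (simp add: d_def)
  qed
  then show ?thesis using zM by blast
qed

text \<open>A complex functional is recovered from its real part through Im (f x) = - Re (f (i x)),
  so the real representation of Re f is tested at \<open>x\<close> and at i x.\<close>

lemma riesz:
  fixes M :: "'a::chilbert_space set"
  assumes M: "complex_vector.subspace M" "closed M"
    and f: "bounded_linear f" "\<And>c x. f (c *\<^sub>C x) = c * f x"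
  shows "\<exists>z\<in>M. \<forall>x\<in>M. f x = cinner z x"
proof -
  obtain z where z: "z \<in> M" "\<And>x. x \<in> M \<Longrightarrow> Re (f x) = inner z x"
    using riesz_real[OF csubspace_imp_subspace[OF M(1)] M(2)
        bounded_linear_compose[OF bounded_linear_Re f(1)]] by auto
  have "f x = cinner z x" if "x \<in> M" for x
  proof -
    have ix: "\<i> *\<^sub>C x \<in> M" using M(1) that by (simp add: complex_vector.subspace_scale)
    show ?thesis
      using z(2)[OF that] z(2)[OF ix] by (simp add: inner_eq_Re_cinner f complex_eq_iff)
  qed
  then show ?thesis using z(1) by blast
qed

text \<open>The projection of \<open>x\<close> is the representative in \<open>M\<close> of the
  functional \<open>cinner x\<close>, so the variational argument of \<open>riesz_real\<close>
  covers projections too.\<close>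

lemma orthogonal_projection_exists:
  fixes M :: "'a::chilbert_space set"
  assumes M: "complex_vector.subspace M" "closed M"
  shows "\<exists>z\<in>M. \<forall>y\<in>M. cinner y (x - z) = 0"
proof -
  obtain z where "z \<in> M" "\<And>y. y \<in> M \<Longrightarrow> cinner x y = cinner z y"
    using riesz[OF M cinner.bounded_linear_right[of x]] by auto
  then have "cinner y (x - z) = 0" if "y \<in> M" for y
    using that by (metis cinner.diff_left cinner_eq_zero_commute eq_iff_diff_eq_0)
  then show ?thesis using \<open>z \<in> M\<close> by blast
qed

text \<open>Testing with y = L x turns a bound on the sesquilinear form into an operator bound;
  adjoints are shown to be bounded in this way.\<close>

lemma bounded_linear_by_cinner_bound:
  fixes L :: "'a::chilbert_space \<Rightarrow> 'a"
  assumes lin: "\<And>x y. L (x + y) = L x + L y" "\<And>c x. L (c *\<^sub>C x) = c *\<^sub>C L x"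
    and K: "\<And>x y. cmod (cinner (L x) y) \<le> K * norm x * norm y"
  shows "bounded_clinear L" "norm (L x) \<le> K * norm x"
proof -
  have n: "norm (L x) \<le> K * norm x" for x
  proof (cases "L x = 0")
    case True
    have "0 \<le> K * norm x * norm x" using K[of x x] norm_ge_zero order_trans by blast
    then have "norm x = 0 \<or> 0 \<le> K * norm x"
      by (metis mult_less_0_iff norm_ge_zero not_le order_le_less)
    then show ?thesis using True by auto
  next
    case False
    have "norm (L x) * norm (L x) \<le> K * norm x * norm (L x)"
      using K[of x "L x"] by (simp add: cinner_self norm_mult power2_eq_square)
    then show ?thesis using False by simp
  qed
  show "norm (L x) \<le> K * norm x" by (rule n)
  show "bounded_clinear L"
    unfolding bounded_clinear_def
  proof (intro conjI allI bounded_linear_intro[where K = K])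
    show "norm (L x) \<le> norm x * K" for x using n[of x] by (simp add: mult.commute)
  qed (simp_all add: lin scaleR_scaleC)
qed

section \<open>Existence, uniqueness and bounds of adjoints\<close>

lemma cadjoint_exists:
  fixes T :: "'a::chilbert_space \<Rightarrow> 'a"
  assumes T: "bounded_clinear T"
  shows "\<exists>S. \<forall>x y. cinner (T x) y = cinner x (S y)"
proof -
  have "\<exists>z. \<forall>x. cinner y (T x) = cinner z x" for y
    using riesz[of UNIV "\<lambda>x. cinner y (T x)"] bounded_linear_compose[OF cinner.bounded_linear_right bounded_clinear_linear[OF T]]
    by (auto simp: bounded_clinear_simps[OF T])
  then obtain S where "\<And>x y. cinner y (T x) = cinner (S y) x" by metis
  then show ?thesis by (metis cinner_commute)
qed

lemma cadjoint_eqI: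
  assumes "\<And>x y. cinner (T x) y = cinner x (S y)"
  shows "cadjoint T = S"
  unfolding cadjoint_def
proof (rule the_equality)
  fix S' assume "\<forall>x y. cinner (T x) y = cinner x (S' y)"
  then show "S' = S" using assms by (metis cinner_eqI ext)
qed (use assms in auto)

lemma cinner_cadjoint_right: "bounded_clinear T \<Longrightarrow> cinner x (cadjoint T y) = cinner (T x) y"
  using cadjoint_exists[of T] cadjoint_eqI[of T] by metis

lemma cinner_cadjoint_left: "bounded_clinear T \<Longrightarrow> cinner (cadjoint T x) y = cinner x (T y)"
  by (metis cinner_cadjoint_right cinner_commute)

lemma bounded_clinear_norm_bound:
  assumes "bounded_clinear T"
  obtains K where "K > 0" "\<And>x. norm (T x) \<le> K * norm x"
  using bounded_linear.pos_bounded[OF bounded_clinear_linear[OF assms]] by (metis mult.commute)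

lemma cadjoint_bound:
  assumes T: "bounded_clinear T" and K: "\<And>x. norm (T x) \<le> K * norm x"
  shows "bounded_clinear (cadjoint T)" "norm (cadjoint T x) \<le> K * norm x"
proof -
  have 1: "cadjoint T (x + y) = cadjoint T x + cadjoint T y" for x y
    by (rule cinner_eqI) (simp add: cinner_cadjoint_right[OF T] cinner_add_right)
  have 2: "cadjoint T (c *\<^sub>C x) = c *\<^sub>C cadjoint T x" for c x
    by (rule cinner_eqI) (simp add: cinner_cadjoint_right[OF T])
  have 3: "cmod (cinner (cadjoint T x) y) \<le> K * norm x * norm y" for x y
  proof -
    have "cmod (cinner (cadjoint T x) y) \<le> norm x * norm (T y)"
      unfolding cinner_cadjoint_left[OF T] by (rule norm_cinner_le)
    also have "\<dots> \<le> norm x * (K * norm y)" by (intro mult_left_mono K) auto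
    finally show ?thesis by (simp add: mult_ac)
  qed
  show "bounded_clinear (cadjoint T)" "norm (cadjoint T x) \<le> K * norm x"
    using bounded_linear_by_cinner_bound[OF 1 2 3] by auto
qed

lemma bounded_clinear_cadjoint:
  assumes T: "bounded_clinear T" shows "bounded_clinear (cadjoint T)"
  using bounded_clinear_norm_bound[OF T] cadjoint_bound(1)[OF T] by metis

lemma cadjoint_cadjoint: "bounded_clinear T \<Longrightarrow> cadjoint (cadjoint T) = T"
  by (rule cadjoint_eqI) (rule cinner_cadjoint_left)

section \<open>Orthonormal families\<close>

text \<open>Indexed families, because normalised images of basis vectors and Gram-Schmidt outputs
  are functions of an index; an orthonormal set is the identity family on itself.\<close>

definition orthonormal_on :: "'i set \<Rightarrow> ('i \<Rightarrow> 'a::chilbert_space) \<Rightarrow> bool" where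
  "orthonormal_on I e \<longleftrightarrow> (\<forall>i\<in>I. \<forall>j\<in>I. cinner (e i) (e j) = (if i = j then 1 else 0))"

lemma orthonormal_onD:
  "orthonormal_on I e \<Longrightarrow> i \<in> I \<Longrightarrow> j \<in> I \<Longrightarrow> cinner (e i) (e j) = (if i = j then 1 else 0)"
  by (simp add: orthonormal_on_def)

lemma orthonormal_on_subset: "orthonormal_on I e \<Longrightarrow> J \<subseteq> I \<Longrightarrow> orthonormal_on J e"
  unfolding orthonormal_on_def by blast

lemma orthonormal_on_norm:
  assumes "orthonormal_on I e" "i \<in> I" shows "norm (e i) = 1"
proof -
  have "(norm (e i))\<^sup>2 = 1" by (rule norm_eq_ReI) (simp add: orthonormal_onD[OF assms(1) assms(2) assms(2)])
  then show ?thesis by (smt (verit) norm_ge_zero power2_eq_1_iff)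
qed

lemma norm_sum_orthogonal:
  assumes "finite I" "\<And>i j. i \<in> I \<Longrightarrow> j \<in> I \<Longrightarrow> i \<noteq> j \<Longrightarrow> cinner (v i) (v j) = 0"
  shows "(norm (\<Sum>i\<in>I. v i :: 'a::chilbert_space))\<^sup>2 = (\<Sum>i\<in>I. (norm (v i))\<^sup>2)"
proof (rule norm_eq_ReI)
  have "cinner (\<Sum>i\<in>I. v i) (\<Sum>i\<in>I. v i) = (\<Sum>i\<in>I. \<Sum>j\<in>I. cinner (v i) (v j))"
    unfolding cinner.sum_left cinner.sum_right by (rule sum.swap)
  also have "\<dots> = (\<Sum>i\<in>I. \<Sum>j\<in>I. if i = j then complex_of_real ((norm (v i))\<^sup>2) else 0)"
    using assms(2) by (intro sum.cong) (auto simp: cinner_self)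
  also have "\<dots> = complex_of_real (\<Sum>i\<in>I. (norm (v i))\<^sup>2)"
    using assms(1) by (simp add: sum.delta)
  finally show "cinner (\<Sum>i\<in>I. v i) (\<Sum>i\<in>I. v i) = complex_of_real (\<Sum>i\<in>I. (norm (v i))\<^sup>2)" .
qed

lemma cinner_orthonormal_sum:
  assumes "orthonormal_on I e" "finite I" "i \<in> I"
  shows "cinner (e i) (\<Sum>j\<in>I. c j *\<^sub>C e j) = c i"
proof -
  have "cinner (e i) (\<Sum>j\<in>I. c j *\<^sub>C e j) = (\<Sum>j\<in>I. if j = i then c j else 0)"
    unfolding cinner.sum_right using assms by (intro sum.cong) (auto simp: orthonormal_onD)
  then show ?thesis using assms by (simp add: sum.delta)
qed

lemma norm_orthonormal_sum:
  assumes "orthonormal_on I e" "finite I"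
  shows "(norm (\<Sum>j\<in>I. c j *\<^sub>C e j))\<^sup>2 = (\<Sum>j\<in>I. (cmod (c j))\<^sup>2)"
proof -
  have "(norm (\<Sum>j\<in>I. c j *\<^sub>C e j))\<^sup>2 = (\<Sum>j\<in>I. (norm (c j *\<^sub>C e j))\<^sup>2)"
    by (rule norm_sum_orthogonal) (use assms in \<open>auto simp: orthonormal_onD\<close>)
  then show ?thesis using orthonormal_on_norm[OF assms(1)] by (simp add: norm_scaleC power_mult_distrib)
qed

lemma orthonormal_residual:
  assumes "orthonormal_on I e" "finite I"
  shows "(norm (x - (\<Sum>j\<in>I. cinner (e j) x *\<^sub>C e j)))\<^sup>2 = (norm x)\<^sup>2 - (\<Sum>j\<in>I. (cmod (cinner (e j) x))\<^sup>2)"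
proof -
  define P where "P = (\<Sum>j\<in>I. cinner (e j) x *\<^sub>C e j)"
  have Px: "cinner P x = complex_of_real (\<Sum>j\<in>I. (cmod (cinner (e j) x))\<^sup>2)"
    unfolding P_def by (simp only: cinner.sum_left cinner_scaleC_left cinner_square' of_real_sum)
  have PP: "cinner P P = complex_of_real (\<Sum>j\<in>I. (cmod (cinner (e j) x))\<^sup>2)"
    using norm_orthonormal_sum[OF assms, of "\<lambda>j. cinner (e j) x"] unfolding P_def cinner_self by simp
  have xP: "cinner x P = complex_of_real (\<Sum>j\<in>I. (cmod (cinner (e j) x))\<^sup>2)"
    by (metis Px cinner_commute complex_cnj_complex_of_real)
  have "cinner (x - P) (x - P) = cinner x x - cinner x P - (cinner P x - cinner P P)"
    by (simp add: cinner.diff_left cinner.diff_right)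
  also have "\<dots> = complex_of_real ((norm x)\<^sup>2 - (\<Sum>j\<in>I. (cmod (cinner (e j) x))\<^sup>2))"
    unfolding Px PP xP by (simp add: cinner_self)
  finally show ?thesis
    unfolding P_def[symmetric] by (rule norm_eq_ReI)
qed

lemma bessel:
  assumes "orthonormal_on I e" "finite I"
  shows "(\<Sum>j\<in>I. (cmod (cinner (e j) x))\<^sup>2) \<le> (norm x)\<^sup>2"
  using orthonormal_residual[OF assms, of x] zero_le_power2[of "norm (x - (\<Sum>j\<in>I. cinner (e j) x *\<^sub>C e j))"]
  by linarith

lemma norm_projection_le:
  assumes "orthonormal_on I e" "finite I"
  shows "norm (\<Sum>j\<in>I. cinner (e j) x *\<^sub>C e j) \<le> norm x"
  using bessel[OF assms, of x] norm_orthonormal_sum[OF assms, of "\<lambda>j. cinner (e j) x"]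
  by (intro power2_le_imp_le[OF _ norm_ge_zero]) simp

text \<open>Completeness is encoded as a trivial orthogonal complement, the form in which Zorn's
  lemma delivers it; convergent expansions follow in \<open>onb_has_sum\<close>.\<close>

definition onb :: "'a::chilbert_space set \<Rightarrow> bool" where
  "onb B \<longleftrightarrow> orthonormal_on B (\<lambda>b. b) \<and> (\<forall>x. (\<forall>b\<in>B. cinner b x = 0) \<longrightarrow> x = 0)"

lemma onb_orthonormal: "onb B \<Longrightarrow> orthonormal_on B (\<lambda>b. b)"
  by (simp add: onb_def)

lemma onb_orthonormal_subset: "onb B \<Longrightarrow> F \<subseteq> B \<Longrightarrow> orthonormal_on F (\<lambda>b. b)"
  using onb_orthonormal orthonormal_on_subset by blast

lemma onb_eqI:
  assumes "onb B" "\<And>b. b \<in> B \<Longrightarrow> cinner b x = cinner b y" shows "x = y"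
proof -
  have "x - y = 0" using assms unfolding onb_def by (metis cinner.diff_right eq_iff_diff_eq_0)
  then show ?thesis by simp
qed

text \<open>The vectors that equal the sum of their expansion form a subspace that contains
  \<open>B\<close> and is closed, since finite partial sums are contractions. A vector orthogonal to
  that subspace is orthogonal to \<open>B\<close>, hence zero.\<close>

lemma onb_has_sum:
  assumes B: "onb B"
  shows "((\<lambda>b. cinner b x *\<^sub>C b) has_sum x) B"
proof -
  define M where "M = {x. ((\<lambda>b. cinner b x *\<^sub>C b) has_sum x) B}"
  have sub: "complex_vector.subspace M"
  proof (rule complex_vector.subspaceI)
    show "0 \<in> M" by (simp add: M_def)
    show "x + y \<in> M" if "x \<in> M" "y \<in> M" for x y
      using has_sum_add[OF that[unfolded M_def mem_Collect_eq]]
      by (simp add: M_def cinner_add_right scaleC_add_left)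
    show "c *\<^sub>C x \<in> M" if "x \<in> M" for c x
      using has_sum_bounded_linear[OF bounded_linear_scaleC that[unfolded M_def mem_Collect_eq], of c]
      by (simp add: M_def scaleC_scaleC)
  qed
  have "closure M \<subseteq> M"
  proof
    fix x assume x: "x \<in> closure M"
    show "x \<in> M" unfolding M_def mem_Collect_eq has_sum_def
    proof (rule tendstoI)
      fix \<epsilon> :: real assume "\<epsilon> > 0"
      then obtain y where y: "y \<in> M" "dist y x < \<epsilon> / 4"
        using x unfolding closure_approachable by (meson divide_pos_pos zero_less_numeral)
      have "eventually (\<lambda>F. dist (\<Sum>b\<in>F. cinner b y *\<^sub>C b) y < \<epsilon> / 4) (finite_subsets_at_top B)"
        using y(1) \<open>\<epsilon> > 0\<close> unfolding M_def mem_Collect_eq has_sum_def by (intro tendstoD) auto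
      moreover have "eventually (\<lambda>F. finite F \<and> F \<subseteq> B) (finite_subsets_at_top B)"
        by (rule eventually_finite_subsets_at_top_weakI) auto
      ultimately show "eventually (\<lambda>F. dist (\<Sum>b\<in>F. cinner b x *\<^sub>C b) x < \<epsilon>) (finite_subsets_at_top B)"
      proof eventually_elim
        case (elim F)
        have "(\<Sum>b\<in>F. cinner b x *\<^sub>C b) - x
            = (\<Sum>b\<in>F. cinner b (x - y) *\<^sub>C b) + ((\<Sum>b\<in>F. cinner b y *\<^sub>C b) - y) + (y - x)"
          by (simp add: cinner.diff_right complex_vector.scale_left_diff_distrib sum_subtractf)
        also have "norm \<dots> \<le> norm (\<Sum>b\<in>F. cinner b (x - y) *\<^sub>C b) + norm ((\<Sum>b\<in>F. cinner b y *\<^sub>C b) - y) + norm (y - x)"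
          by (rule order_trans[OF norm_triangle_ineq add_right_mono[OF norm_triangle_ineq]])
        also have "norm (\<Sum>b\<in>F. cinner b (x - y) *\<^sub>C b) \<le> norm (x - y)"
          using elim onb_orthonormal_subset[OF B] by (intro norm_projection_le[where e = "\<lambda>b. b"]) auto
        finally show ?case
          using elim y(2) \<open>\<epsilon> > 0\<close> by (simp add: dist_norm norm_minus_commute)
      qed
    qed
  qed
  then have cl: "closed M" using closure_subset_eq by blast
  have BM: "B \<subseteq> M"
  proof
    fix b assume b: "b \<in> B"
    have "((\<lambda>c. cinner c b *\<^sub>C c) has_sum (\<Sum>c\<in>{b}. cinner c b *\<^sub>C c)) B"
      using b orthonormal_onD[OF onb_orthonormal[OF B]] by (intro has_sum_finite_neutralI[where B = "{b}"]) auto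
    then show "b \<in> M" using orthonormal_onD[OF onb_orthonormal[OF B] b b] by (simp add: M_def)
  qed
  obtain z where z: "z \<in> M" "\<And>y. y \<in> M \<Longrightarrow> cinner y (x - z) = 0"
    using orthogonal_projection_exists[OF sub cl] by blast
  then have "x - z = 0" using BM B unfolding onb_def by blast
  then show ?thesis using z(1) by (simp add: M_def)
qed

section \<open>Operators prescribed on an orthonormal basis\<close>

lemma bounded_clinear_eq_on_onb:
  assumes B: "onb B" and S: "bounded_clinear S" and T: "bounded_clinear T"
    and eq: "\<And>b. b \<in> B \<Longrightarrow> S b = T b"
  shows "S = T"
proof
  fix x
  have "((\<lambda>b. S (cinner b x *\<^sub>C b)) has_sum S x) B"
    by (intro has_sum_bounded_linear[OF bounded_clinear_linear[OF S]] onb_has_sum B)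
  moreover have "((\<lambda>b. T (cinner b x *\<^sub>C b)) has_sum T x) B"
    by (intro has_sum_bounded_linear[OF bounded_clinear_linear[OF T]] onb_has_sum B)
  moreover have "S (cinner b x *\<^sub>C b) = T (cinner b x *\<^sub>C b)" if "b \<in> B" for b
    using eq[OF that] by (simp add: bounded_clinear_simps S T)
  ultimately show "S x = T x" by (simp add: has_sum_unique cong: has_sum_cong)
qed

text \<open>Pythagoras converts differences of finite partial sums into differences of partial sums
  of squared norms, so the net is Cauchy because the scalar series converges.\<close>

lemma orthogonal_summable_on:
  fixes u :: "'i \<Rightarrow> 'a::chilbert_space"
  assumes orth: "\<And>i j. i \<in> A \<Longrightarrow> j \<in> A \<Longrightarrow> i \<noteq> j \<Longrightarrow> cinner (u i) (u j) = 0"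
    and bd: "\<And>F. finite F \<Longrightarrow> F \<subseteq> A \<Longrightarrow> (\<Sum>i\<in>F. (norm (u i))\<^sup>2) \<le> D"
  shows "u summable_on A"
proof -
  define a where "a i = (norm (u i))\<^sup>2" for i
  have "a summable_on A"
    by (rule nonneg_bounded_partial_sums_imp_summable_on[where C = D])
      (auto simp: a_def bd intro!: eventually_finite_subsets_at_top_weakI)
  then obtain s where s: "(a has_sum s) A" by (auto simp: summable_on_def)
  have "\<exists>P. eventually P (finite_subsets_at_top A) \<and>
      (\<forall>F1 F2. P F1 \<and> P F2 \<longrightarrow> dist (sum u F1) (sum u F2) < e)" if "e > 0" for e
  proof -
    have "eventually (\<lambda>F. dist (sum a F) s < e\<^sup>2 / 4) (finite_subsets_at_top A)"
      using s that unfolding has_sum_def by (intro tendstoD) auto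
    then obtain F0 where F0: "finite F0" "F0 \<subseteq> A" "dist (sum a F0) s < e\<^sup>2 / 4"
      unfolding eventually_finite_subsets_at_top by blast
    define P where "P F \<longleftrightarrow> finite F \<and> F0 \<subseteq> F \<and> F \<subseteq> A" for F
    have "eventually P (finite_subsets_at_top A)"
      unfolding eventually_finite_subsets_at_top P_def by (intro exI[of _ F0]) (use F0 in simp)
    moreover have d: "dist (sum u F) (sum u F0) < e / 2" if "P F" for F
    proof -
      have F: "finite F" "F0 \<subseteq> F" "F \<subseteq> A" using that by (auto simp: P_def)
      have "(norm (sum u F - sum u F0))\<^sup>2 = (norm (sum u (F - F0)))\<^sup>2"
        using F F0 by (simp add: sum_diff)
      also have "\<dots> = sum a (F - F0)"
        unfolding a_def using F by (intro norm_sum_orthogonal orth) auto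
      also have "\<dots> = sum a F - sum a F0" using F F0 by (simp add: sum_diff)
      also have "\<dots> \<le> s - sum a F0"
        using finite_sum_le_has_sum[OF s F(1,3)] by (simp add: a_def)
      also have "\<dots> < (e / 2)\<^sup>2" using F0(3) abs_ge_minus_self[of "sum a F0 - s"] unfolding dist_real_def power_divide by simp
      finally have "norm (sum u F - sum u F0) < e / 2" using \<open>e > 0\<close> power_less_imp_less_base[of "norm (sum u F - sum u F0)" 2 "e / 2"] by simp
      then show ?thesis by (simp add: dist_norm)
    qed
    have "dist (sum u F1) (sum u F2) < e" if "P F1" "P F2" for F1 F2
      using d[OF that(1)] d[OF that(2)] dist_triangle2[of "sum u F1" "sum u F2" "sum u F0"] by linarith
    ultimately show ?thesis by blast
  qed
  then have "cauchy_filter (filtermap (sum u) (finite_subsets_at_top A))"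
    by (simp add: cauchy_filter_metric_filtermap)
  moreover have "complete (UNIV::'a set)"
    by (meson Cauchy_convergent UNIV_I complete_def convergent_def)
  moreover have "filtermap (sum u) (finite_subsets_at_top A) \<noteq> bot"
    by (simp add: filtermap_bot_iff)
  ultimately obtain L where "filtermap (sum u) (finite_subsets_at_top A) \<le> nhds L"
    using cauchy_filter_complete_converges[of "filtermap (sum u) (finite_subsets_at_top A)" UNIV] by auto
  then show ?thesis unfolding summable_on_def has_sum_def filterlim_def by blast
qed

text \<open>Bessel's inequality bounds the squared norms of the terms \<open>u x b\<close>, so their
  series converges. The square root and the partial isometry of the polar decomposition are built
  this way. The bound takes the absolute value of \<open>m\<close>, which may be negative when
  \<open>B\<close> is empty.\<close>

lemma orthogonal_extension:
  fixes v :: "'a::chilbert_space \<Rightarrow> 'a"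
  assumes B: "onb B"
    and orth: "\<And>b c. b \<in> B \<Longrightarrow> c \<in> B \<Longrightarrow> b \<noteq> c \<Longrightarrow> cinner (v b) (v c) = 0"
    and bd: "\<And>b. b \<in> B \<Longrightarrow> norm (v b) \<le> m"
  obtains L where "bounded_clinear L" "\<And>b. b \<in> B \<Longrightarrow> L b = v b" "\<And>x. norm (L x) \<le> \<bar>m\<bar> * norm x"
proof -
  define u where "u x b = cinner b x *\<^sub>C v b" for x b
  have fin: "(\<Sum>b\<in>F. (norm (u x b))\<^sup>2) \<le> m\<^sup>2 * (norm x)\<^sup>2" if "finite F" "F \<subseteq> B" for F x
  proof -
    have "(\<Sum>b\<in>F. (norm (u x b))\<^sup>2) \<le> (\<Sum>b\<in>F. m\<^sup>2 * (cmod (cinner b x))\<^sup>2)"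
    proof (rule sum_mono)
      fix b assume "b \<in> F"
      then have "(norm (v b))\<^sup>2 \<le> m\<^sup>2" using bd that by (auto intro!: power_mono)
      then show "(norm (u x b))\<^sup>2 \<le> m\<^sup>2 * (cmod (cinner b x))\<^sup>2"
        by (simp add: u_def norm_scaleC power_mult_distrib mult.commute[of _ "(norm (v b))\<^sup>2"] mult_right_mono)
    qed
    also have "\<dots> \<le> m\<^sup>2 * (norm x)\<^sup>2"
      unfolding sum_distrib_left[symmetric]
      using bessel[OF onb_orthonormal_subset[OF B that(2)] that(1), of x] by (intro mult_left_mono) auto
    finally show ?thesis .
  qed
  have uorth: "cinner (u x b) (u x c) = 0" if "b \<in> B" "c \<in> B" "b \<noteq> c" for x b c
    using orth[OF that] by (simp add: u_def)
  have summ: "u x summable_on B" for x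
    by (rule orthogonal_summable_on[OF uorth fin])
  define L where "L x = infsum (u x) B" for x
  have has: "(u x has_sum L x) B" for x
    unfolding L_def using summ by (rule has_sum_infsum)
  have nL: "norm (L x) \<le> \<bar>m\<bar> * norm x" for x
  proof (rule tendsto_upperbound[where F = "finite_subsets_at_top B"])
    show "((\<lambda>F. norm (sum (u x) F)) \<longlongrightarrow> norm (L x)) (finite_subsets_at_top B)"
      using has[of x] unfolding has_sum_def by (rule tendsto_norm)
    show "\<forall>\<^sub>F F in finite_subsets_at_top B. norm (sum (u x) F) \<le> \<bar>m\<bar> * norm x"
    proof (rule eventually_finite_subsets_at_top_weakI)
      fix F assume F: "finite F" "F \<subseteq> B"
      have "(norm (sum (u x) F))\<^sup>2 = (\<Sum>b\<in>F. (norm (u x b))\<^sup>2)"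
        using F by (intro norm_sum_orthogonal uorth) auto
      also have "\<dots> \<le> (\<bar>m\<bar> * norm x)\<^sup>2" using fin[OF F] by (simp add: power_mult_distrib)
      finally show "norm (sum (u x) F) \<le> \<bar>m\<bar> * norm x"
        by (rule power2_le_imp_le) simp
    qed
  qed simp
  have add: "L (x + y) = L x + L y" for x y
  proof -
    have "(u (x + y) has_sum L x + L y) B"
      using has_sum_add[OF has[of x] has[of y]] by (simp add: u_def cinner_add_right scaleC_add_left cong: has_sum_cong)
    then show ?thesis using has[of "x + y"] has_sum_unique by blast
  qed
  have sc: "L (c *\<^sub>C x) = c *\<^sub>C L x" for c x
  proof -
    have "(u (c *\<^sub>C x) has_sum c *\<^sub>C L x) B"
      using has_sum_bounded_linear[OF bounded_linear_scaleC has[of x], of c] by (simp add: u_def scaleC_scaleC cong: has_sum_cong)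
    then show ?thesis using has[of "c *\<^sub>C x"] has_sum_unique by blast
  qed
  have "bounded_clinear L"
    unfolding bounded_clinear_def
  proof (intro conjI allI bounded_linear_intro[where K = "\<bar>m\<bar>"])
    show "norm (L x) \<le> norm x * \<bar>m\<bar>" for x using nL[of x] by (simp add: mult.commute)
  qed (simp_all add: add sc scaleR_scaleC)
  moreover have "L b = v b" if b: "b \<in> B" for b
  proof -
    have "(u b has_sum (\<Sum>c\<in>{b}. u b c)) B"
      using b orthonormal_onD[OF onb_orthonormal[OF B]] by (intro has_sum_finite_neutralI[where B = "{b}"]) (auto simp: u_def)
    moreover have "(\<Sum>c\<in>{b}. u b c) = v b"
      using orthonormal_onD[OF onb_orthonormal[OF B] b b] by (simp add: u_def)
    ultimately show ?thesis using has[of b] has_sum_unique by fastforce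
  qed
  ultimately show ?thesis using nL that by blast
qed

section \<open>Compact operators\<close>

lemma compact_operator_bounded: "compact_operator T \<Longrightarrow> bounded_clinear T"
  by (simp add: compact_operator_def)

text \<open>Rescaling puts a bounded sequence into the unit ball, where compactness of the closure
  of the image applies; the scale |M| + 1 is positive for every \<open>M\<close>.\<close>

lemma compact_operator_seq:
  fixes T :: "'a::chilbert_space \<Rightarrow> 'a" and x :: "nat \<Rightarrow> 'a"
  assumes T: "compact_operator T" and x: "\<And>n. norm (x n) \<le> M"
  obtains r l where "strict_mono r" "(\<lambda>n. T (x (r n))) \<longlonglongrightarrow> l"
proof -
  define c where "c = \<bar>M\<bar> + 1"
  have c: "c > 0" by (simp add: c_def)
  note lin = linear_simps[OF bounded_clinear_linear[OF compact_operator_bounded[OF T]]]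
  have "T ((1/c) *\<^sub>R x n) \<in> closure (T ` cball 0 1)" for n
  proof -
    have "norm (x n) \<le> c" using x[of n] by (simp add: c_def)
    then have "norm ((1/c) *\<^sub>R x n) \<le> 1" using c by simp
    then show ?thesis using closure_subset by fastforce
  qed
  moreover have "seq_compact (closure (T ` cball 0 1))"
    using T unfolding compact_operator_def compact_eq_seq_compact_metric by blast
  ultimately obtain l r where r: "strict_mono r" and l: "((\<lambda>n. T ((1/c) *\<^sub>R x n)) \<circ> r) \<longlonglongrightarrow> l"
    using seq_compactE[of "closure (T ` cball 0 1)" "\<lambda>n. T ((1/c) *\<^sub>R x n)"] by metis
  have "(\<lambda>n. c *\<^sub>R ((\<lambda>n. T ((1/c) *\<^sub>R x n)) \<circ> r) n) \<longlonglongrightarrow> c *\<^sub>R l"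
    by (intro tendsto_intros l)
  moreover have "c *\<^sub>R ((\<lambda>n. T ((1/c) *\<^sub>R x n)) \<circ> r) n = T (x (r n))" for n
    using c by (simp add: lin)
  ultimately show ?thesis using r that by auto
qed

text \<open>A point of the closure is within 1/(n + 1) of some image \<open>T (x n)\<close>, so a
  sequence in the closure converges along the same subsequence as these images.\<close>

lemma compact_operatorI:
  fixes T :: "'a::chilbert_space \<Rightarrow> 'a"
  assumes T: "bounded_clinear T"
    and seq: "\<And>x::nat \<Rightarrow> 'a. (\<And>n. norm (x n) \<le> 1) \<Longrightarrow> \<exists>r l. strict_mono r \<and> (\<lambda>n::nat. T (x (r n))) \<longlonglongrightarrow> l"
  shows "compact_operator T"
proof -
  have "seq_compact (closure (T ` cball 0 1))"
    unfolding seq_compact_def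
  proof (intro allI impI)
    fix y :: "nat \<Rightarrow> 'a" assume y: "\<forall>n. y n \<in> closure (T ` cball 0 1)"
    have "\<exists>x\<in>cball 0 1. dist (T x) (y n) < 1 / real (Suc n)" for n
    proof -
      have "0 < 1 / real (Suc n)" by simp
      then show ?thesis using y[rule_format, of n] unfolding closure_approachable by blast
    qed
    then obtain x where x: "\<And>n. norm (x n) \<le> 1" "\<And>n. dist (T (x n)) (y n) < 1 / real (Suc n)"
      by (metis mem_cball_0)
    obtain r l where r: "strict_mono r" and l: "(\<lambda>n. T (x (r n))) \<longlonglongrightarrow> l"
      using seq[of x, OF x(1)] by blast
    have "(\<lambda>n. T (x n) - y n) \<longlonglongrightarrow> 0"
    proof (rule Lim_null_comparison)
      show "\<forall>\<^sub>F n in sequentially. norm (T (x n) - y n) \<le> 1 / real (Suc n)"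
        using x(2) by (auto simp: dist_norm intro!: always_eventually less_imp_le)
      show "(\<lambda>n. 1 / real (Suc n)) \<longlonglongrightarrow> 0" by (rule LIMSEQ_Suc[OF lim_1_over_n])
    qed
    from LIMSEQ_subseq_LIMSEQ[OF this r]
    have "(\<lambda>n. T (x (r n)) - y (r n)) \<longlonglongrightarrow> 0" by (simp add: comp_def)
    from tendsto_diff[OF l this] have yl: "(y \<circ> r) \<longlonglongrightarrow> l" by (simp add: comp_def)
    then have "l \<in> closure (T ` cball 0 1)"
      using y by (intro closed_sequentially[OF closed_closure _ yl]) auto
    then show "\<exists>l\<in>closure (T ` cball 0 1). \<exists>r. strict_mono r \<and> (y \<circ> r) \<longlonglongrightarrow> l"
      using r yl by blast
  qed
  then show ?thesis using T by (simp add: compact_operator_def compact_eq_seq_compact_metric)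
qed

lemma compact_operator_compose_left:
  assumes S: "bounded_clinear S" and T: "compact_operator T"
  shows "compact_operator (S \<circ> T)"
proof (rule compact_operatorI)
  show "bounded_clinear (S \<circ> T)" by (intro bounded_clinear_compose S compact_operator_bounded T)
  fix x :: "nat \<Rightarrow> 'a" assume x: "\<And>n. norm (x n) \<le> 1"
  obtain r l where "strict_mono r" "(\<lambda>n. T (x (r n))) \<longlonglongrightarrow> l"
    by (rule compact_operator_seq[OF T x])
  then show "\<exists>r l. strict_mono r \<and> (\<lambda>n. (S \<circ> T) (x (r n))) \<longlonglongrightarrow> l"
    using bounded_linear.tendsto[OF bounded_clinear_linear[OF S]] unfolding comp_def by blast
qed

lemma compact_operator_compose_right:
  assumes S: "compact_operator S" and T: "bounded_clinear T"
  shows "compact_operator (S \<circ> T)"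
proof (rule compact_operatorI)
  show "bounded_clinear (S \<circ> T)" by (intro bounded_clinear_compose T compact_operator_bounded S)
  fix x :: "nat \<Rightarrow> 'a" assume x: "\<And>n. norm (x n) \<le> 1"
  obtain K where K: "K > 0" "\<And>x. norm (T x) \<le> K * norm x"
    using bounded_clinear_norm_bound[OF T] by blast
  have Tx: "norm (T (x n)) \<le> K" for n
  proof -
    have "K * norm (x n) \<le> K" using x[of n] K(1) by (simp add: mult_left_le)
    then show ?thesis using K(2)[of "x n"] by linarith
  qed
  obtain r l where "strict_mono r" "(\<lambda>n. S (T (x (r n)))) \<longlonglongrightarrow> l"
    by (rule compact_operator_seq[OF S Tx])
  then show "\<exists>r l. strict_mono r \<and> (\<lambda>n. (S \<circ> T) (x (r n))) \<longlonglongrightarrow> l" by auto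
qed

lemma compact_operator_zero: "compact_operator (\<lambda>x::'a::chilbert_space. 0)"
  by (rule compact_operatorI) (auto simp: bounded_clinear_def intro: strict_mono_id)

lemma compact_operator_add:
  assumes S: "compact_operator S" and T: "compact_operator T"
  shows "compact_operator (\<lambda>x. S x + T x)"
proof (rule compact_operatorI)
  show "bounded_clinear (\<lambda>x. S x + T x)"
    using S T by (auto simp: compact_operator_def bounded_clinear_def scaleC_add_right intro: bounded_linear_add)
  fix x :: "nat \<Rightarrow> 'a" assume x: "\<And>n. norm (x n) \<le> 1"
  obtain r l where r: "strict_mono r" and l: "(\<lambda>n. S (x (r n))) \<longlonglongrightarrow> l"
    by (rule compact_operator_seq[OF S x])
  obtain r' l' where r': "strict_mono r'" and l': "(\<lambda>n. T (x (r (r' n)))) \<longlonglongrightarrow> l'"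
    by (rule compact_operator_seq[OF T, of "\<lambda>n. x (r n)", OF x])
  have "(\<lambda>n. S (x (r (r' n)))) \<longlonglongrightarrow> l"
    using LIMSEQ_subseq_LIMSEQ[OF l r'] by (simp add: comp_def)
  from tendsto_add[OF this l'] show "\<exists>r l. strict_mono r \<and> (\<lambda>n. S (x (r n)) + T (x (r n))) \<longlonglongrightarrow> l"
    using strict_mono_o[OF r r'] by (auto simp: comp_def)
qed

lemma compact_operator_sum:
  "finite A \<Longrightarrow> (\<And>i. i \<in> A \<Longrightarrow> compact_operator (T i)) \<Longrightarrow> compact_operator (\<lambda>x. \<Sum>i\<in>A. T i x)"
  by (induction A rule: finite_induct) (auto simp: compact_operator_zero compact_operator_add)

section \<open>Positive compact operators\<close>

lemma positive_operator_bounded: "positive_operator K \<Longrightarrow> bounded_clinear K"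
  by (simp add: positive_operator_def)

lemma positive_operator_cinner:
  assumes "positive_operator K" shows "cinner x (K x) = complex_of_real (inner x (K x))"
  using assms unfolding positive_operator_def
  by (auto simp: complex_nonneg_Reals_iff inner_eq_Re_cinner complex_eq_iff)

lemma positive_operator_inner: "positive_operator K \<Longrightarrow> 0 \<le> inner x (K x)"
  unfolding positive_operator_def by (auto simp: complex_nonneg_Reals_iff inner_eq_Re_cinner)

lemma positive_operatorI:
  assumes "bounded_clinear K" "\<And>x. \<exists>r\<ge>0. cinner x (K x) = complex_of_real r"
  shows "positive_operator K"
  using assms unfolding positive_operator_def by (metis nonneg_Reals_of_real_iff)

text \<open>Polarisation: the defect \<open>D\<close> is sesquilinear and vanishes on the diagonal
  because the quadratic form is real; evaluating it at x + y and at x + i y makes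
  \<open>D x y\<close> vanish.\<close>

lemma positive_operator_selfadjoint:
  assumes K: "positive_operator K"
  shows "cinner (K x) y = cinner x (K y)"
proof -
  note lin = bounded_clinear_simps[OF positive_operator_bounded[OF K]]
  define D where "D x y = cinner x (K y) - cinner (K x) y" for x y
  have D0: "D x x = 0" for x
  proof -
    have "cinner (K x) x = cnj (cinner x (K x))" by (rule cinner_commute)
    then show ?thesis unfolding D_def positive_operator_cinner[OF K] by simp
  qed
  have D1: "D (u + v) (u + v) = D u u + D v v + D u v + D v u" for u v
    unfolding D_def by (simp add: lin cinner_add_left cinner_add_right)
  have 1: "D x y + D y x = 0" using D1[of x y] by (simp add: D0)
  have 2: "D x (\<i> *\<^sub>C y) + D (\<i> *\<^sub>C y) x = 0" using D1[of x "\<i> *\<^sub>C y"] by (simp add: D0)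
  have "D x (\<i> *\<^sub>C y) = \<i> * D x y" "D (\<i> *\<^sub>C y) x = - \<i> * D y x"
    unfolding D_def by (simp_all add: lin algebra_simps)
  with 2 have "D x y = D y x" by (simp add: algebra_simps)
  with 1 have "D x y = 0" by simp
  then show ?thesis by (simp add: D_def)
qed

lemma positive_operator_inner_selfadjoint:
  "positive_operator K \<Longrightarrow> inner (K x) y = inner x (K y)"
  by (simp add: inner_eq_Re_cinner positive_operator_selfadjoint)

text \<open>Positivity of the quadratic form at x - (1/m) K x. The form bound is demanded only at
  the vector \<open>K x\<close>, so it can be supplied on an invariant subspace where
  \<open>m\<close> is the supremum.\<close>

lemma positive_operator_norm_le:
  assumes K: "positive_operator K" and m: "m > 0"
    and bd: "inner (K x) (K (K x)) \<le> m * (norm (K x))\<^sup>2"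
  shows "(norm (K x))\<^sup>2 \<le> m * inner x (K x)"
proof -
  note lin = linear_simps[OF bounded_clinear_linear[OF positive_operator_bounded[OF K]]]
  define y where "y = x - (1 / m) *\<^sub>R K x"
  have a: "inner x (K (K x)) = (norm (K x))\<^sup>2"
    by (simp add: positive_operator_inner_selfadjoint[OF K, symmetric] power2_norm_eq_inner)
  have "inner (x - t *\<^sub>R K x) (K (x - t *\<^sub>R K x)) = inner x (K x) - 2 * t * (norm (K x))\<^sup>2 + t\<^sup>2 * inner (K x) (K (K x))" for t
    by (simp add: lin inner_diff_left inner_diff_right a dot_square_norm power2_eq_square[of t] algebra_simps)
  from this[of "1 / m"]
  have "inner y (K y) = inner x (K x) - 2 / m * (norm (K x))\<^sup>2 + (1 / m)\<^sup>2 * inner (K x) (K (K x))"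
    unfolding y_def by simp
  also have "\<dots> \<le> inner x (K x) - 2 / m * (norm (K x))\<^sup>2 + (1 / m)\<^sup>2 * (m * (norm (K x))\<^sup>2)"
    using mult_left_mono[OF bd, of "(1/m)\<^sup>2"] by simp
  also have "\<dots> = inner x (K x) - (norm (K x))\<^sup>2 / m"
    using m by (simp add: power2_eq_square field_simps)
  finally have "(norm (K x))\<^sup>2 / m \<le> inner x (K x)"
    using positive_operator_inner[OF K, of y] by linarith
  then show ?thesis using m by (simp add: pos_divide_le_eq mult.commute)
qed

text \<open>Maximise the quadratic form over the unit ball of \<open>W\<close>. Maximising vectors
  are approximate eigenvectors for the supremum \<open>m\<close>, and compactness of
  \<open>K\<close> makes a subsequence of them converge.\<close>

lemma compact_positive_eigenvector:
  assumes K: "positive_operator K" and cK: "compact_operator K"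
    and W: "complex_vector.subspace W" "closed W" and inv: "\<And>x. x \<in> W \<Longrightarrow> K x \<in> W"
    and w0: "w \<in> W" "K w \<noteq> 0"
  obtains x c where "x \<in> W" "x \<noteq> 0" "c > 0" "K x = complex_of_real c *\<^sub>C x"
proof -
  note lin = linear_simps[OF bounded_clinear_linear[OF positive_operator_bounded[OF K]]]
  have W': "subspace W" by (rule csubspace_imp_subspace[OF W(1)])
  obtain M where M: "M > 0" "\<And>x. norm (K x) \<le> M * norm x"
    using bounded_clinear_norm_bound[OF positive_operator_bounded[OF K]] by blast
  have qb: "inner x (K x) \<le> M * (norm x)\<^sup>2" for x
  proof -
    have "inner x (K x) \<le> norm x * norm (K x)" by (rule norm_cauchy_schwarz)
    also have "\<dots> \<le> norm x * (M * norm x)" by (rule mult_left_mono[OF M(2)]) simp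
    finally show ?thesis by (simp add: power2_eq_square mult_ac)
  qed
  define S where "S = {x \<in> W. norm x \<le> 1}"
  define m where "m = (SUP x\<in>S. inner x (K x))"
  have bdd: "bdd_above ((\<lambda>x. inner x (K x)) ` S)"
  proof (rule bdd_aboveI)
    fix r assume "r \<in> (\<lambda>x. inner x (K x)) ` S"
    then obtain x where x: "x \<in> S" "r = inner x (K x)" by blast
    have "M * (norm x)\<^sup>2 \<le> M * 1"
      using x M(1) by (intro mult_left_mono) (auto simp: S_def power_le_one)
    then show "r \<le> M" using qb[of x] x by simp
  qed
  have Sne: "S \<noteq> {}" using subspace_0[OF W'] by (auto simp: S_def)
  have upper: "inner x (K x) \<le> m * (norm x)\<^sup>2" if "x \<in> W" for x
  proof (cases "x = 0")
    case False
    define y where "y = (1 / norm x) *\<^sub>R x"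
    have "y \<in> S" using that False by (simp add: S_def y_def subspace_scale[OF W'])
    then have "inner y (K y) \<le> m" unfolding m_def by (rule cSUP_upper[OF _ bdd])
    then show ?thesis using False by (simp add: y_def lin power2_eq_square field_simps)
  qed (simp add: lin)
  have "inner w (K w) > 0"
  proof -
    have "(norm (K w))\<^sup>2 \<le> M * inner w (K w)"
      by (rule positive_operator_norm_le[OF K M(1) qb])
    then have "0 < M * inner w (K w)" using w0 by (smt (verit) zero_less_norm_iff zero_less_power)
    then show ?thesis using M(1) by (simp add: zero_less_mult_iff)
  qed
  then have "0 < m * (norm w)\<^sup>2" using upper[OF w0(1)] by linarith
  then have m: "m > 0" by (simp add: zero_less_mult_iff)
  have "\<exists>x\<in>S. m - 1 / real (Suc n) < inner x (K x)" for n
  proof -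
    have "m - 1 / real (Suc n) < m" by simp
    then show ?thesis unfolding m_def less_cSUP_iff[OF Sne bdd] .
  qed
  then obtain x where xS: "\<And>n. x n \<in> S" and xm: "\<And>n. m - 1 / real (Suc n) < inner (x n) (K (x n))"
    by metis
  have xn: "norm (x n) \<le> 1" "x n \<in> W" for n using xS[of n] by (auto simp: S_def)
  \<comment> \<open>Expanding the square and using |K x|^2 <= m <x, K x> and |x| <= 1 leaves at most
    m (m - <x, K x>).\<close>
  have est: "(norm (K (x n) - m *\<^sub>R x n))\<^sup>2 \<le> m / real (Suc n)" for n
  proof -
    have "(norm (K (x n)))\<^sup>2 \<le> m * inner (x n) (K (x n))"
      by (rule positive_operator_norm_le[OF K m upper[OF inv[OF xn(2)]]])
    moreover have "m\<^sup>2 * (norm (x n))\<^sup>2 \<le> m\<^sup>2"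
      using xn(1) by (simp add: mult_left_le power_le_one)
    moreover have "(norm (K (x n) - m *\<^sub>R x n))\<^sup>2
        = (norm (K (x n)))\<^sup>2 - 2 * (m * inner (x n) (K (x n))) + m\<^sup>2 * (norm (x n))\<^sup>2"
      unfolding power2_norm_eq_inner
      by (simp add: inner_diff_left inner_diff_right inner_commute power2_eq_square algebra_simps)
    ultimately have "(norm (K (x n) - m *\<^sub>R x n))\<^sup>2 \<le> m\<^sup>2 - m * inner (x n) (K (x n))" by linarith
    also have "\<dots> \<le> m * (1 / real (Suc n))"
      using mult_left_mono[OF less_imp_le[OF xm[of n]] less_imp_le[OF m]]
      by (simp add: power2_eq_square algebra_simps)
    finally show ?thesis by simp
  qed
  obtain r l where r: "strict_mono r" and l: "(\<lambda>n. K (x (r n))) \<longlonglongrightarrow> l"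
    by (rule compact_operator_seq[OF cK xn(1)])
  have "(\<lambda>n. (norm (K (x n) - m *\<^sub>R x n))\<^sup>2) \<longlonglongrightarrow> 0"
  proof (rule Lim_null_comparison)
    show "\<forall>\<^sub>F n in sequentially. norm ((norm (K (x n) - m *\<^sub>R x n))\<^sup>2) \<le> m * (1 / real (Suc n))"
      using est by (intro always_eventually) simp
    show "(\<lambda>n. m * (1 / real (Suc n))) \<longlonglongrightarrow> 0"
      by (rule tendsto_mult_right_zero[OF LIMSEQ_Suc[OF lim_1_over_n]])
  qed
  from tendsto_real_sqrt[OF this] have "(\<lambda>n. norm (K (x n) - m *\<^sub>R x n)) \<longlonglongrightarrow> 0" by simp
  then have "(\<lambda>n. K (x n) - m *\<^sub>R x n) \<longlonglongrightarrow> 0" by (rule tendsto_norm_zero_cancel)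
  from LIMSEQ_subseq_LIMSEQ[OF this r]
  have "(\<lambda>n. K (x (r n)) - m *\<^sub>R x (r n)) \<longlonglongrightarrow> 0" by (simp add: comp_def)
  from tendsto_diff[OF l this] have mx: "(\<lambda>n. m *\<^sub>R x (r n)) \<longlonglongrightarrow> l" by simp
  have xl: "(\<lambda>n. x (r n)) \<longlonglongrightarrow> (1 / m) *\<^sub>R l"
    using tendsto_scaleR[OF tendsto_const[of "1/m"] mx] m by simp
  define y where "y = (1 / m) *\<^sub>R l"
  have yW: "y \<in> W"
    unfolding y_def by (rule closed_sequentially[OF W(2) _ xl]) (rule xn(2))
  have "(\<lambda>n. K (x (r n))) \<longlonglongrightarrow> K y"
    unfolding y_def by (rule bounded_linear.tendsto[OF bounded_clinear_linear[OF positive_operator_bounded[OF K]] xl])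
  then have "K y = l" using l LIMSEQ_unique by blast
  then have Ky: "K y = complex_of_real m *\<^sub>C y" using m by (simp add: y_def flip: scaleR_scaleC)
  have lim: "(\<lambda>n. inner (x (r n)) (K (x (r n)))) \<longlonglongrightarrow> inner y l"
    unfolding y_def by (intro tendsto_intros xl l)
  have "(\<lambda>n. m - 1 / real (Suc (r n))) \<longlonglongrightarrow> m - 0"
    using LIMSEQ_subseq_LIMSEQ[OF LIMSEQ_Suc[OF lim_1_over_n] r]
    by (intro tendsto_diff tendsto_const) (simp add: comp_def)
  then have "m \<le> inner y l"
    using LIMSEQ_le[OF _ lim] xm by (metis (no_types, lifting) diff_zero less_imp_le)
  \<comment> \<open>The limit is nonzero because the form is at least the positive number
    \<open>m\<close> there.\<close>
  then have "y \<noteq> 0" using m by auto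
  then show ?thesis using that yW m Ky by blast
qed

text \<open>Zorn's lemma on orthonormal sets of eigenvectors. The orthogonal complement
  \<open>W\<close> of a maximal set is closed and invariant; a nonzero vector in it would yield a
  further eigenvector, either from \<open>compact_positive_eigenvector\<close> or, if
  \<open>K\<close> vanishes on \<open>W\<close>, for the eigenvalue 0. As basis vectors are unit
  vectors, the eigenvalue equals \<open>norm (K b)\<close>.\<close>

lemma compact_positive_spectral:
  assumes K: "positive_operator (K :: 'a::chilbert_space \<Rightarrow> 'a)" and cK: "compact_operator K"
  obtains B where "onb B" "\<And>b. b \<in> B \<Longrightarrow> K b = complex_of_real (norm (K b)) *\<^sub>C b"
proof -
  note lin = bounded_clinear_simps[OF positive_operator_bounded[OF K]]
  define A where "A = {B. orthonormal_on B (\<lambda>b::'a. b) \<and> (\<forall>b\<in>B. \<exists>c\<ge>0. K b = complex_of_real c *\<^sub>C b)}"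
  have "\<exists>M\<in>A. \<forall>X\<in>A. M \<subseteq> X \<longrightarrow> X = M"
  proof (rule subset_Zorn')
    fix C assume C: "subset.chain A C"
    show "\<Union>C \<in> A"
      unfolding A_def mem_Collect_eq orthonormal_on_def
    proof (intro conjI ballI)
      fix b c assume "b \<in> \<Union>C" "c \<in> \<Union>C"
      then obtain X Y where XY: "X \<in> C" "Y \<in> C" "b \<in> X" "c \<in> Y" by blast
      then have "X \<subseteq> Y \<or> Y \<subseteq> X" using C unfolding subset.chain_def by blast
      then obtain Z where Z: "Z \<in> C" "b \<in> Z" "c \<in> Z" using XY by blast
      then have "orthonormal_on Z (\<lambda>b. b)" using C unfolding subset.chain_def A_def by blast
      then show "cinner b c = (if b = c then 1 else 0)" by (rule orthonormal_onD[OF _ Z(2,3)])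
    next
      fix b assume "b \<in> \<Union>C"
      then show "\<exists>c\<ge>0. K b = complex_of_real c *\<^sub>C b" using C unfolding subset.chain_def A_def by blast
    qed
  qed
  then obtain B where B: "B \<in> A" and max: "\<And>X. X \<in> A \<Longrightarrow> B \<subseteq> X \<Longrightarrow> X = B" by blast
  have on: "orthonormal_on B (\<lambda>b. b)" and eig: "\<And>b. b \<in> B \<Longrightarrow> \<exists>c\<ge>0. K b = complex_of_real c *\<^sub>C b"
    using B by (auto simp: A_def)
  define W where "W = {x. \<forall>b\<in>B. cinner b x = 0}"
  have no_eig: False if x: "x \<in> W" "x \<noteq> 0" "c \<ge> 0" "K x = complex_of_real c *\<^sub>C x" for x c
  proof -
    define y where "y = complex_of_real (1 / norm x) *\<^sub>C x"
    have n: "norm y = 1" using x(2) by (simp add: y_def norm_scaleC norm_divide)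
    have yy: "cinner y y = 1" using n by (simp add: cinner_self)
    have yb: "cinner b y = 0" "cinner y b = 0" if "b \<in> B" for b
      using x(1) that cinner_eq_zero_commute[of b x] by (auto simp: W_def y_def)
    have "K y = complex_of_real c *\<^sub>C y" by (simp add: y_def lin x(4) mult.commute)
    moreover have "orthonormal_on (insert y B) (\<lambda>b. b)"
      unfolding orthonormal_on_def
    proof (intro ballI)
      fix b d assume "b \<in> insert y B" "d \<in> insert y B"
      moreover have "y \<notin> B" using yb[of y] n by (auto simp: cinner_self)
      ultimately show "cinner b d = (if b = d then 1 else 0)"
        using yb yy orthonormal_onD[OF on] by auto
    qed
    ultimately have "insert y B \<in> A" using eig x(3) unfolding A_def by blast
    then have "y \<in> B" using max by blast
    then show False using yb(1)[of y] n by (simp add: cinner_self)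
  qed
  have sub: "complex_vector.subspace W"
    by (rule complex_vector.subspaceI) (simp_all add: W_def cinner_add_right)
  have cl: "closed W"
  proof -
    have "W = (\<Inter>b\<in>B. {x. cinner b x = 0})" by (auto simp: W_def)
    moreover have "closed {x. cinner b x = 0}" for b
      by (intro closed_Collect_eq cinner.continuous_on continuous_on_const continuous_on_id)
    ultimately show ?thesis by auto
  qed
  have inv: "K x \<in> W" if "x \<in> W" for x
    unfolding W_def mem_Collect_eq
  proof
    fix b assume b: "b \<in> B"
    then obtain c where c: "K b = complex_of_real c *\<^sub>C b" using eig by blast
    have "cinner b (K x) = cinner (K b) x" by (rule positive_operator_selfadjoint[OF K, symmetric])
    then show "cinner b (K x) = 0" using that b by (simp add: c W_def)
  qed
  have "x = 0" if "\<forall>b\<in>B. cinner b x = 0" for x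
  proof (rule ccontr)
    assume "x \<noteq> 0"
    have xW: "x \<in> W" using that by (simp add: W_def)
    show False
    proof (cases "\<exists>w\<in>W. K w \<noteq> 0")
      case True
      then obtain w where w: "w \<in> W" "K w \<noteq> 0" by blast
      obtain x c where "x \<in> W" "x \<noteq> 0" "c > 0" "K x = complex_of_real c *\<^sub>C x"
        by (rule compact_positive_eigenvector[OF K cK sub cl inv w])
      then show False using no_eig[of x c] by simp
    next
      case False
      then show False using no_eig[OF xW \<open>x \<noteq> 0\<close>, of 0] xW by simp
    qed
  qed
  then have "onb B" using on by (simp add: onb_def)
  moreover have "K b = complex_of_real (norm (K b)) *\<^sub>C b" if b: "b \<in> B" for b
  proof -
    obtain c where c: "c \<ge> 0" "K b = complex_of_real c *\<^sub>C b" using eig[OF b] by blast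
    have "norm b = 1" by (rule orthonormal_on_norm[OF on b])
    then have "norm (K b) = c" using c by (simp add: norm_scaleC)
    then show ?thesis using c(2) by simp
  qed
  ultimately show ?thesis using that by blast
qed

text \<open>The vector y = S x - c x satisfies S y = - c y, which positivity excludes for c > 0
  unless y = 0; for c = 0 the norm of \<open>S x\<close> is read off from <x, S (S x)>.\<close>

lemma positive_sqrt_eigen:
  assumes S: "positive_operator S" and c: "c \<ge> 0" and eq: "S (S x) = complex_of_real (c\<^sup>2) *\<^sub>C x"
  shows "S x = complex_of_real c *\<^sub>C x"
proof (cases "c = 0")
  case True
  have "cinner (S x) (S x) = 0"
    unfolding positive_operator_selfadjoint[OF S, of x "S x"] eq by (simp add: True)
  then show ?thesis by (simp add: cinner_self True)
next
  case False
  note lin = bounded_clinear_simps[OF positive_operator_bounded[OF S]]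
  define y where "y = S x - complex_of_real c *\<^sub>C x"
  have "S y = - complex_of_real c *\<^sub>C y"
    unfolding y_def by (simp add: lin eq complex_vector.scale_right_diff_distrib scaleC_scaleC power2_eq_square)
  then have "cinner y (S y) = - complex_of_real (c * (norm y)\<^sup>2)"
    by (simp add: cinner_self cinner.minus_right)
  then have "inner y (S y) = - (c * (norm y)\<^sup>2)" by (simp add: inner_eq_Re_cinner)
  then have "c * (norm y)\<^sup>2 \<le> 0" using positive_operator_inner[OF S, of y] by linarith
  then have "y = 0" using False c by (simp add: mult_le_0_iff)
  then show ?thesis by (simp add: y_def)
qed

text \<open>Existence takes square roots of the eigenvalues on a spectral basis; uniqueness holds
  since \<open>positive_sqrt_eigen\<close> prescribes every positive square root on that basis. This
  is what makes the description in \<open>op_abs\<close> definite.\<close>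

lemma compact_positive_sqrt:
  assumes K: "positive_operator (K :: 'a::chilbert_space \<Rightarrow> 'a)" and cK: "compact_operator K"
  shows "\<exists>!S. positive_operator S \<and> S \<circ> S = K"
proof -
  obtain B where B: "onb B" and Kb: "\<And>b. b \<in> B \<Longrightarrow> K b = complex_of_real (norm (K b)) *\<^sub>C b"
    using compact_positive_spectral[OF K cK] by blast
  have on: "orthonormal_on B (\<lambda>b. b)" by (rule onb_orthonormal[OF B])
  obtain M where M: "M > 0" "\<And>x. norm (K x) \<le> M * norm x"
    using bounded_clinear_norm_bound[OF positive_operator_bounded[OF K]] by blast
  define v where "v b = complex_of_real (sqrt (norm (K b))) *\<^sub>C b" for b
  have bd: "norm (v b) \<le> sqrt M" if "b \<in> B" for b
    using M(2)[of b] orthonormal_on_norm[OF on that] by (simp add: v_def norm_scaleC)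
  have orth: "cinner (v b) (v c) = 0" if "b \<in> B" "c \<in> B" "b \<noteq> c" for b c
    using orthonormal_onD[OF on that(1,2)] that(3) by (simp add: v_def)
  obtain S where S: "bounded_clinear S" "\<And>b. b \<in> B \<Longrightarrow> S b = v b"
    using orthogonal_extension[of B v "sqrt M"] B orth bd by metis
  have pos: "positive_operator S"
  proof (rule positive_operatorI[OF S(1)])
    fix x
    have "((\<lambda>b. cinner x (S (cinner b x *\<^sub>C b))) has_sum cinner x (S x)) B"
      by (rule has_sum_bounded_linear[OF cinner.bounded_linear_right
            has_sum_bounded_linear[OF bounded_clinear_linear[OF S(1)] onb_has_sum[OF B]]])
    moreover have "cinner x (S (cinner b x *\<^sub>C b)) = complex_of_real (sqrt (norm (K b)) * (cmod (cinner b x))\<^sup>2)"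
      if "b \<in> B" for b
      by (simp add: bounded_clinear_simps[OF S(1)] S(2)[OF that] v_def cinner_square flip: cinner_square mult.assoc)
         (simp add: cinner_square mult_ac)
    ultimately have hs: "((\<lambda>b. complex_of_real (sqrt (norm (K b)) * (cmod (cinner b x))\<^sup>2)) has_sum cinner x (S x)) B"
      by (simp cong: has_sum_cong)
    have hr: "((\<lambda>b. sqrt (norm (K b)) * (cmod (cinner b x))\<^sup>2) has_sum Re (cinner x (S x))) B"
      using has_sum_bounded_linear[OF bounded_linear_Re hs] by simp
    have hi: "((\<lambda>b. 0) has_sum Im (cinner x (S x))) B"
      using has_sum_bounded_linear[OF bounded_linear_Im hs] by simp
    have "Im (cinner x (S x)) = 0" by (rule has_sum_unique[OF hi has_sum_0]) simp
    moreover have "0 \<le> Re (cinner x (S x))" using hr by (rule has_sum_nonneg) simp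
    ultimately show "\<exists>r\<ge>0. cinner x (S x) = complex_of_real r"
      by (intro exI[of _ "Re (cinner x (S x))"]) (simp add: complex_eq_iff)
  qed
  have SS: "S' b = v b" if S': "positive_operator S'" "S' \<circ> S' = K" and b: "b \<in> B" for S' b
    unfolding v_def
  proof (rule positive_sqrt_eigen[OF S'(1)])
    show "S' (S' b) = complex_of_real ((sqrt (norm (K b)))\<^sup>2) *\<^sub>C b"
      using Kb[OF b] S'(2) by (simp add: fun_eq_iff)
  qed simp
  have "S \<circ> S = K"
  proof (rule bounded_clinear_eq_on_onb[OF B bounded_clinear_compose[OF S(1) S(1)] positive_operator_bounded[OF K]])
    fix b assume b: "b \<in> B"
    have "(S \<circ> S) b = complex_of_real (sqrt (norm (K b)) * sqrt (norm (K b))) *\<^sub>C b"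
      by (simp add: S(2)[OF b] v_def bounded_clinear_simps[OF S(1)] flip: of_real_mult)
    then show "(S \<circ> S) b = K b" using Kb[OF b] by simp
  qed
  moreover have "S' = S" if "positive_operator S'" "S' \<circ> S' = K" for S'
    by (rule bounded_clinear_eq_on_onb[OF B positive_operator_bounded[OF that(1)] S(1)])
      (simp add: SS[OF that] S(2))
  ultimately show ?thesis using pos by blast
qed

text \<open>By selfadjointness |S a - S b|^2 = <a - b, S (S (a - b))>, so on the unit ball a
  convergent sequence of values of \<open>S \<circ> S\<close> comes with a Cauchy sequence of values
  of \<open>S\<close>.\<close>

lemma compact_sqrt:
  assumes S: "positive_operator S" and c: "compact_operator (S \<circ> S)"
  shows "compact_operator S"
proof (rule compact_operatorI)
  show "bounded_clinear S" by (rule positive_operator_bounded[OF S])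
  note lin = bounded_clinear_simps[OF positive_operator_bounded[OF S]]
  fix x :: "nat \<Rightarrow> 'a" assume x: "\<And>n. norm (x n) \<le> 1"
  obtain r l where r: "strict_mono r" and l: "(\<lambda>n. (S \<circ> S) (x (r n))) \<longlonglongrightarrow> l"
    by (rule compact_operator_seq[OF c x])
  have est: "(norm (S a - S b))\<^sup>2 \<le> 2 * norm ((S \<circ> S) a - (S \<circ> S) b)" if "norm a \<le> 1" "norm b \<le> 1" for a b
  proof -
    have "(norm (S a - S b))\<^sup>2 = inner (S (a - b)) (S (a - b))" by (simp add: power2_norm_eq_inner lin)
    also have "\<dots> = inner (a - b) (S (S (a - b)))"
      by (rule positive_operator_inner_selfadjoint[OF S])
    also have "\<dots> \<le> norm (a - b) * norm (S (S (a - b)))" by (rule norm_cauchy_schwarz)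
    also have "\<dots> \<le> 2 * norm (S (S (a - b)))"
      using that norm_triangle_ineq4[of a b] by (intro mult_right_mono) auto
    finally show ?thesis by (simp add: lin)
  qed
  have "Cauchy (\<lambda>n. S (x (r n)))"
  proof (rule metric_CauchyI)
    fix e :: real assume e: "e > 0"
    then have "e\<^sup>2 / 2 > 0" by simp
    then obtain N where N: "\<And>m n. m \<ge> N \<Longrightarrow> n \<ge> N \<Longrightarrow> dist ((S \<circ> S) (x (r m))) ((S \<circ> S) (x (r n))) < e\<^sup>2 / 2"
      using LIMSEQ_imp_Cauchy[OF l] unfolding Cauchy_def by blast
    show "\<exists>N. \<forall>m\<ge>N. \<forall>n\<ge>N. dist (S (x (r m))) (S (x (r n))) < e"
    proof (intro exI[of _ N] allI impI)
      fix m n assume "N \<le> m" "N \<le> n"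
      then have "(norm (S (x (r m)) - S (x (r n))))\<^sup>2 < e\<^sup>2"
        using est[OF x x, of "r m" "r n"] N[of m n] by (simp add: dist_norm)
      then show "dist (S (x (r m))) (S (x (r n))) < e"
        using e power_less_imp_less_base[of "norm (S (x (r m)) - S (x (r n)))" 2 e] by (simp add: dist_norm)
    qed
  qed
  then show "\<exists>r l. strict_mono r \<and> (\<lambda>n. S (x (r n))) \<longlonglongrightarrow> l"
    using r Cauchy_convergent unfolding convergent_def by blast
qed

section \<open>The modulus of a compact operator\<close>

lemma positive_adjoint_comp:
  assumes T: "bounded_clinear T" shows "positive_operator (cadjoint T \<circ> T)"
proof (rule positive_operatorI[OF bounded_clinear_compose[OF bounded_clinear_cadjoint[OF T] T]])
  fix x
  have "cinner x ((cadjoint T \<circ> T) x) = complex_of_real ((norm (T x))\<^sup>2)"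
    by (simp add: cinner_cadjoint_right[OF T] cinner_self)
  then show "\<exists>r\<ge>0. cinner x ((cadjoint T \<circ> T) x) = complex_of_real r"
    by (intro exI[of _ "(norm (T x))\<^sup>2"]) simp
qed

lemma op_abs:
  assumes T: "compact_operator T"
  shows "positive_operator (op_abs T)" "op_abs T \<circ> op_abs T = cadjoint T \<circ> T" "compact_operator (op_abs T)"
proof -
  note bT = compact_operator_bounded[OF T]
  have c: "compact_operator (cadjoint T \<circ> T)"
    by (rule compact_operator_compose_left[OF bounded_clinear_cadjoint[OF bT] T])
  have "positive_operator (op_abs T) \<and> op_abs T \<circ> op_abs T = cadjoint T \<circ> T"
    unfolding op_abs_def by (rule theI'[OF compact_positive_sqrt[OF positive_adjoint_comp[OF bT] c]])
  then show 1: "positive_operator (op_abs T)" and 2: "op_abs T \<circ> op_abs T = cadjoint T \<circ> T" by auto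
  show "compact_operator (op_abs T)" using compact_sqrt[OF 1] c 2 by simp
qed

lemma cinner_op_abs:
  assumes T: "compact_operator T"
  shows "cinner (op_abs T x) (op_abs T y) = cinner (T x) (T y)"
  using positive_operator_selfadjoint[OF op_abs(1)[OF T], of x "op_abs T y"] fun_cong[OF op_abs(2)[OF T], of y]
  by (simp add: cinner_cadjoint_right[OF compact_operator_bounded[OF T]])

lemma norm_op_abs:
  assumes T: "compact_operator T"
  shows "norm (op_abs T x) = norm (T x)"
proof -
  have "(norm (op_abs T x))\<^sup>2 = (norm (T x))\<^sup>2"
    using cinner_op_abs[OF T, of x x] unfolding cinner_self of_real_eq_iff .
  then show ?thesis by simp
qed

section \<open>Singular values in an eigenbasis of the modulus\<close>

text \<open>A basis of right singular vectors. The eigenvalue of the modulus at \<open>b\<close> is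
  written \<open>norm (T b)\<close>, since \<open>T\<close> and its modulus have the same norm on
  every vector; singular values are thus read off from \<open>T\<close> itself.\<close>

definition modulus_basis :: "('a::chilbert_space \<Rightarrow> 'a) \<Rightarrow> 'a set \<Rightarrow> bool" where
  "modulus_basis T B \<longleftrightarrow> onb B \<and> (\<forall>b\<in>B. op_abs T b = complex_of_real (norm (T b)) *\<^sub>C b)"

lemma modulus_basis_exists:
  assumes T: "compact_operator T" shows "\<exists>B. modulus_basis T B"
proof -
  obtain B where "onb B" "\<And>b. b \<in> B \<Longrightarrow> op_abs T b = complex_of_real (norm (op_abs T b)) *\<^sub>C b"
    using compact_positive_spectral[OF op_abs(1,3)[OF T]] by blast
  then show ?thesis unfolding modulus_basis_def norm_op_abs[OF T] by blast
qed

lemma modulus_basisD: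
  assumes "modulus_basis T B"
  shows "onb B" "b \<in> B \<Longrightarrow> op_abs T b = complex_of_real (norm (T b)) *\<^sub>C b"
  using assms by (auto simp: modulus_basis_def)

lemma modulus_basis_cinner:
  assumes T: "compact_operator T" and B: "modulus_basis T B" and bc: "b \<in> B" "c \<in> B"
  shows "cinner (T b) (T c) = (if b = c then complex_of_real ((norm (T b))\<^sup>2) else 0)"
  unfolding cinner_op_abs[OF T, symmetric] modulus_basisD(2)[OF B bc(1)] modulus_basisD(2)[OF B bc(2)]
  by (simp add: orthonormal_onD[OF onb_orthonormal[OF modulus_basisD(1)[OF B]] bc] power2_eq_square)

text \<open>Images of distinct basis vectors are orthogonal, so infinitely many of norm at least
  \<epsilon> would form a sequence without Cauchy subsequence.\<close>

lemma modulus_basis_finite: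
  assumes T: "compact_operator T" and B: "modulus_basis T B" and e: "\<epsilon> > 0"
  shows "finite {b \<in> B. \<epsilon> \<le> norm (T b)}"
proof (rule ccontr)
  assume "infinite {b \<in> B. \<epsilon> \<le> norm (T b)}"
  then obtain f :: "nat \<Rightarrow> 'a" where f: "inj f" "range f \<subseteq> {b \<in> B. \<epsilon> \<le> norm (T b)}"
    using infinite_countable_subset by blast
  have fB: "f n \<in> B" "\<epsilon> \<le> norm (T (f n))" for n using f(2) by auto
  have "norm (f n) \<le> 1" for n
    using orthonormal_on_norm[OF onb_orthonormal[OF modulus_basisD(1)[OF B]] fB(1)] by simp
  then obtain r l where r: "strict_mono r" and l: "(\<lambda>n. T (f (r n))) \<longlonglongrightarrow> l"
    using compact_operator_seq[OF T, of f 1] by metis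
  obtain N where N: "\<And>m n. m \<ge> N \<Longrightarrow> n \<ge> N \<Longrightarrow> dist (T (f (r m))) (T (f (r n))) < \<epsilon>"
    using LIMSEQ_imp_Cauchy[OF l] e unfolding Cauchy_def by blast
  define b c where "b = f (r N)" and "c = f (r (Suc N))"
  have "r N \<noteq> r (Suc N)" using strict_monoD[OF r, of N "Suc N"] by simp
  then have ne: "b \<noteq> c" using f(1) by (simp add: b_def c_def inj_eq)
  have bc: "b \<in> B" "c \<in> B" by (simp_all add: b_def c_def fB)
  have "(norm (T b - T c))\<^sup>2 = (norm (T b))\<^sup>2 + (norm (T c))\<^sup>2"
  proof (rule norm_eq_ReI)
    show "cinner (T b - T c) (T b - T c) = complex_of_real ((norm (T b))\<^sup>2 + (norm (T c))\<^sup>2)"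
      using modulus_basis_cinner[OF T B bc] modulus_basis_cinner[OF T B bc(2,1)] ne
      unfolding cinner.diff_left cinner.diff_right by (simp add: cinner_self)
  qed
  moreover have "\<epsilon>\<^sup>2 \<le> (norm (T b))\<^sup>2" using fB(2)[of "r N"] e by (simp add: b_def power_mono)
  ultimately have "\<epsilon>\<^sup>2 \<le> (norm (T b - T c))\<^sup>2" using zero_le_power2[of "norm (T c)"] by linarith
  then have "\<epsilon> \<le> norm (T b - T c)" by (rule power2_le_imp_le) simp
  then show False using N[of N "Suc N"] by (simp add: b_def c_def dist_norm)
qed

lemma finite_modulus_level:
  assumes T: "compact_operator T" and B: "modulus_basis T B" and s: "s > 0"
  shows "finite {b \<in> B. norm (T b) = s}"
  by (rule finite_subset[OF _ modulus_basis_finite[OF T B s]]) auto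

lemma orthonormal_independent:
  assumes on: "orthonormal_on G (\<lambda>b. b)" and fin: "finite G"
  shows "\<not> complex_vector.dependent G"
proof
  assume "complex_vector.dependent G"
  then obtain u v where v: "v \<in> G" "u v \<noteq> 0" "(\<Sum>b\<in>G. u b *\<^sub>C b) = 0"
    using complex_vector.dependent_finite[OF fin] by auto
  have "u v = cinner v (\<Sum>b\<in>G. u b *\<^sub>C b)"
    by (rule cinner_orthonormal_sum[OF on fin v(1), symmetric])
  then show False using v by simp
qed

text \<open>Selfadjointness makes an eigenvector for \<open>s\<close> orthogonal to every basis
  vector with another eigenvalue, so its expansion is carried by the finite set
  \<open>G\<close>.\<close>

lemma eigenspace_op_abs:
  assumes T: "compact_operator T" and B: "modulus_basis T B" and s: "s > 0"
  shows "eigenspace (op_abs T) (complex_of_real s) = complex_vector.span {b \<in> B. norm (T b) = s}"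
proof
  let ?E = "eigenspace (op_abs T) (complex_of_real s)"
  let ?V = "complex_vector.span {b \<in> B. norm (T b) = s}"
  note P = op_abs(1)[OF T]
  note lin = bounded_clinear_simps[OF positive_operator_bounded[OF P]]
  note on = onb_orthonormal[OF modulus_basisD(1)[OF B]]
  define G where "G = {b \<in> B. norm (T b) = s}"
  have G: "finite G" "G \<subseteq> B" using finite_modulus_level[OF T B s] by (auto simp: G_def)
  have onG: "orthonormal_on G (\<lambda>b. b)" by (rule orthonormal_on_subset[OF on G(2)])
  show "?V \<subseteq> ?E"
  proof (rule complex_vector.span_minimal)
    show "{b \<in> B. norm (T b) = s} \<subseteq> ?E"
      using modulus_basisD(2)[OF B] by (auto simp: eigenspace_def)
    show "complex_vector.subspace (?E)"
      by (rule complex_vector.subspaceI)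
        (simp_all add: eigenspace_def lin complex_vector.scale_right_distrib mult.commute)
  qed
  show "?E \<subseteq> ?V"
  proof
    fix x assume "x \<in> ?E"
    then have x: "op_abs T x = complex_of_real s *\<^sub>C x" by (simp add: eigenspace_def)
    have "x = (\<Sum>b\<in>G. cinner b x *\<^sub>C b)"
    proof (rule onb_eqI[OF modulus_basisD(1)[OF B]])
      fix c assume c: "c \<in> B"
      show "cinner c x = cinner c (\<Sum>b\<in>G. cinner b x *\<^sub>C b)"
      proof (cases "c \<in> G")
        case True
        show ?thesis by (rule cinner_orthonormal_sum[OF onG G(1) True, symmetric])
      next
        case False
        then have ns: "norm (T c) \<noteq> s" using c by (simp add: G_def)
        have "complex_of_real (norm (T c)) * cinner c x = cinner (op_abs T c) x"
          by (simp add: modulus_basisD(2)[OF B c])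
        also have "\<dots> = complex_of_real s * cinner c x"
          unfolding positive_operator_selfadjoint[OF P] x by simp
        finally have "cinner c x = 0" using ns by simp
        moreover have "cinner c b = 0" if "b \<in> G" for b
          using orthonormal_onD[OF on c, of b] G(2) that False by auto
        then have "cinner c (\<Sum>b\<in>G. cinner b x *\<^sub>C b) = 0"
          unfolding cinner.sum_right by (intro sum.neutral) simp
        ultimately show ?thesis by simp
      qed
    qed
    also have "\<dots> \<in> complex_vector.span G"
      by (intro complex_vector.span_sum complex_vector.span_scale complex_vector.span_base)
    finally show "x \<in> ?V" by (simp add: G_def)
  qed
qed

lemma singular_mult_eq_card:
  assumes T: "compact_operator T" and B: "modulus_basis T B" and s: "s > 0"
  shows "singular_mult T s = card {b \<in> B. norm (T b) = s}"
  unfolding singular_mult_def eigenspace_op_abs[OF T B s]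
  by (intro complex_vector.dim_span_eq_card_independent orthonormal_independent finite_modulus_level[OF T B s]
      orthonormal_on_subset[OF onb_orthonormal[OF modulus_basisD(1)[OF B]]]) auto

lemma singular_values_eq:
  assumes T: "compact_operator T" and B: "modulus_basis T B"
  shows "singular_values T = {s. 0 < s \<and> (\<exists>b\<in>B. norm (T b) = s)}"
proof -
  have "eigenspace (op_abs T) (complex_of_real s) \<noteq> {0} \<longleftrightarrow> (\<exists>b\<in>B. norm (T b) = s)" if s: "s > 0" for s
  proof
    assume ne: "eigenspace (op_abs T) (complex_of_real s) \<noteq> {0}"
    show "\<exists>b\<in>B. norm (T b) = s"
    proof (rule ccontr)
      assume "\<not> (\<exists>b\<in>B. norm (T b) = s)"
      then have e: "{b \<in> B. norm (T b) = s} = {}" by blast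
      show False using ne unfolding eigenspace_op_abs[OF T B s] e complex_vector.span_empty by simp
    qed
  next
    assume "\<exists>b\<in>B. norm (T b) = s"
    then obtain b where b: "b \<in> B" "norm (T b) = s" by blast
    have "norm b = 1" by (rule orthonormal_on_norm[OF onb_orthonormal[OF modulus_basisD(1)[OF B]] b(1)])
    then have "b \<noteq> 0" by auto
    moreover have "b \<in> eigenspace (op_abs T) (complex_of_real s)"
      unfolding eigenspace_op_abs[OF T B s] using b by (intro complex_vector.span_base) simp
    ultimately show "eigenspace (op_abs T) (complex_of_real s) \<noteq> {0}" by blast
  qed
  then show ?thesis unfolding singular_values_def by (intro Collect_cong conj_cong) auto
qed

section \<open>Schatten norms as sums over an eigenbasis\<close>

lemma schatten_norm_powr:
  assumes "q > 0"
  shows "schatten_norm q T powr q = (\<Sum>\<^sub>\<infinity>s\<in>singular_values T. real (singular_mult T s) * s powr q)"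
proof -
  have "0 \<le> (\<Sum>\<^sub>\<infinity>s\<in>singular_values T. real (singular_mult T s) * s powr q)"
    by (intro infsum_nonneg) simp
  then show ?thesis using assms by (simp add: schatten_norm_def powr_powr)
qed

text \<open>Grouping \<open>F\<close> by the value of \<open>norm (T b)\<close> compares counts in
  \<open>F\<close> with multiplicities. Together with \<open>schatten_classI\<close> it replaces the
  infinite sum over distinct singular values by finite sums over a basis, the form used from here
  on.\<close>

lemma schatten_class_sum_le:
  assumes T: "T \<in> schatten_class q" and B: "modulus_basis T B" and q: "q > 0"
    and F: "finite F" "F \<subseteq> B"
  shows "(\<Sum>b\<in>F. norm (T b) powr q) \<le> schatten_norm q T powr q"
proof -
  have cT: "compact_operator T" and summ: "(\<lambda>s. real (singular_mult T s) * s powr q) summable_on singular_values T"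
    using T by (auto simp: schatten_class_def)
  define F' where "F' = {b \<in> F. T b \<noteq> 0}"
  have F': "finite F'" using F by (simp add: F'_def)
  have "(\<Sum>b\<in>F. norm (T b) powr q) = (\<Sum>b\<in>F'. norm (T b) powr q)"
    using F by (intro sum.mono_neutral_right) (auto simp: F'_def)
  also have "\<dots> = (\<Sum>s\<in>(\<lambda>b. norm (T b)) ` F'. \<Sum>b | b \<in> F' \<and> norm (T b) = s. norm (T b) powr q)"
    by (rule sum.image_gen[OF F'])
  also have "\<dots> \<le> (\<Sum>s\<in>(\<lambda>b. norm (T b)) ` F'. real (singular_mult T s) * s powr q)"
  proof (rule sum_mono)
    fix s assume "s \<in> (\<lambda>b. norm (T b)) ` F'"
    then have s: "s > 0" by (auto simp: F'_def)
    have "card {b \<in> F'. norm (T b) = s} \<le> card {b \<in> B. norm (T b) = s}"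
      using F(2) by (intro card_mono finite_modulus_level[OF cT B s]) (auto simp: F'_def)
    then have "real (card {b \<in> F'. norm (T b) = s}) * s powr q \<le> real (singular_mult T s) * s powr q"
      unfolding singular_mult_eq_card[OF cT B s] by (intro mult_right_mono) auto
    then show "(\<Sum>b | b \<in> F' \<and> norm (T b) = s. norm (T b) powr q) \<le> real (singular_mult T s) * s powr q"
      by simp
  qed
  also have "\<dots> \<le> (\<Sum>\<^sub>\<infinity>s\<in>singular_values T. real (singular_mult T s) * s powr q)"
    using F F' by (intro finite_sum_le_infsum summ) (auto simp: singular_values_eq[OF cT B] F'_def)
  finally show ?thesis by (simp add: schatten_norm_powr[OF q])
qed

text \<open>A finite set of singular values unfolds into the finite union of the level sets
  \<open>G s\<close>, so the assumed bound controls all partial sums of the defining series.\<close>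

lemma schatten_classI:
  assumes T: "compact_operator T" and B: "modulus_basis T B" and q: "q > 0"
    and D: "\<And>F. finite F \<Longrightarrow> F \<subseteq> B \<Longrightarrow> (\<Sum>b\<in>F. norm (T b) powr q) \<le> D"
  shows "T \<in> schatten_class q" "schatten_norm q T \<le> D powr (1 / q)"
proof -
  define f where "f s = real (singular_mult T s) * s powr q" for s
  have fin: "sum f S \<le> D" if S: "finite S" "S \<subseteq> singular_values T" for S
  proof -
    define G where "G s = {b \<in> B. norm (T b) = s}" for s
    have pos: "s > 0" if "s \<in> S" for s using S(2) that by (auto simp: singular_values_eq[OF T B])
    have finG: "finite (G s)" if "s \<in> S" for s
      unfolding G_def by (rule finite_modulus_level[OF T B pos[OF that]])
    have "sum f S = (\<Sum>s\<in>S. \<Sum>b\<in>G s. norm (T b) powr q)"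
    proof (rule sum.cong)
      fix s assume s: "s \<in> S"
      have "(\<Sum>b\<in>G s. norm (T b) powr q) = (\<Sum>b\<in>G s. s powr q)" by (intro sum.cong) (auto simp: G_def)
      then show "f s = (\<Sum>b\<in>G s. norm (T b) powr q)"
        by (simp add: f_def G_def singular_mult_eq_card[OF T B pos[OF s]])
    qed simp
    also have "\<dots> = (\<Sum>b\<in>(\<Union>s\<in>S. G s). norm (T b) powr q)"
      using S(1) finG by (intro sum.UNION_disjoint[symmetric]) (auto simp: G_def)
    also have "\<dots> \<le> D"
      using S(1) finG by (intro D) (auto simp: G_def)
    finally show ?thesis .
  qed
  have summ: "f summable_on singular_values T"
    by (rule nonneg_bounded_partial_sums_imp_summable_on[where C = D])
      (auto simp: f_def intro!: eventually_finite_subsets_at_top_weakI fin[unfolded f_def])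
  then show "T \<in> schatten_class q" using T unfolding schatten_class_def f_def by simp
  have "infsum f (singular_values T) \<le> D" by (rule infsum_le_finite_sums[OF summ fin])
  moreover have "0 \<le> infsum f (singular_values T)" by (intro infsum_nonneg) (simp add: f_def)
  ultimately show "schatten_norm q T \<le> D powr (1 / q)"
    unfolding schatten_norm_def f_def[symmetric] using q by (intro powr_mono2) auto
qed

text \<open>\<open>U\<close> sends a right singular vector b to T b / |T b| and the basis vectors in
  the kernel to 0. These images are orthonormal or zero, so \<open>U\<close> is a contraction and U*
  U is the identity on the range of the modulus.\<close>

lemma polar_decomposition:
  assumes T: "compact_operator T"
  obtains U where "bounded_clinear U" "\<And>x. norm (U x) \<le> norm x" "\<And>x. T x = U (op_abs T x)"
    "\<And>x. cadjoint U (U (op_abs T x)) = op_abs T x"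
proof -
  obtain B where B: "modulus_basis T B" using modulus_basis_exists[OF T] by blast
  note B1 = modulus_basisD(1)[OF B]
  note P = modulus_basisD(2)[OF B]
  note bT = compact_operator_bounded[OF T]
  note bP = positive_operator_bounded[OF op_abs(1)[OF T]]
  define v where "v b = complex_of_real (inverse (norm (T b))) *\<^sub>C T b" for b
  have Tv: "complex_of_real (norm (T b)) *\<^sub>C v b = T b" for b
    by (cases "T b = 0") (simp_all add: v_def)
  have bd: "norm (v b) \<le> 1" for b
    by (cases "T b = 0") (simp_all add: v_def norm_scaleC norm_inverse)
  have vc: "cinner (v b) (v c) = (if b = c \<and> T b \<noteq> 0 then 1 else 0)" if "b \<in> B" "c \<in> B" for b c
    using modulus_basis_cinner[OF T B that] by (auto simp: v_def power2_eq_square field_simps)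
  have orth: "cinner (v b) (v c) = 0" if "b \<in> B" "c \<in> B" "b \<noteq> c" for b c
    using vc[OF that(1,2)] that(3) by simp
  obtain U where U: "bounded_clinear U" "\<And>b. b \<in> B \<Longrightarrow> U b = v b" "\<And>x. norm (U x) \<le> \<bar>1\<bar> * norm x"
    using orthogonal_extension[of B v 1] B1 orth bd by metis
  note lU = bounded_clinear_simps[OF U(1)] and lU' = bounded_clinear_simps[OF bounded_clinear_cadjoint[OF U(1)]]
  have "T = U \<circ> op_abs T"
    by (rule bounded_clinear_eq_on_onb[OF B1 bT bounded_clinear_compose[OF U(1) bP]])
      (use P lU U(2) Tv in simp)
  moreover have "cadjoint U \<circ> (U \<circ> op_abs T) = op_abs T"
  proof (rule bounded_clinear_eq_on_onb[OF B1 bounded_clinear_compose[OF bounded_clinear_cadjoint[OF U(1)] bounded_clinear_compose[OF U(1) bP]] bP])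
    fix b assume b: "b \<in> B"
    show "(cadjoint U \<circ> (U \<circ> op_abs T)) b = op_abs T b"
    proof (rule onb_eqI[OF B1])
      fix c assume c: "c \<in> B"
      have "cinner c ((cadjoint U \<circ> (U \<circ> op_abs T)) b) = complex_of_real (norm (T b)) * cinner (v c) (v b)"
        by (simp add: P[OF b] lU lU' cinner_cadjoint_right[OF U(1)] U(2) b c)
      also have "\<dots> = cinner c (op_abs T b)"
        using orthonormal_onD[OF onb_orthonormal[OF B1] c b] vc[OF c b] by (auto simp: P[OF b])
      finally show "cinner c ((cadjoint U \<circ> (U \<circ> op_abs T)) b) = cinner c (op_abs T b)" .
    qed
  qed
  ultimately show ?thesis using that[of U] U(1,3) by (simp add: fun_eq_iff)
qed

section \<open>Testing Schatten norms against Bessel families\<close>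

text \<open>Bessel's inequality with constant 1: the property of orthonormal families that survives
  contractions. Partial isometries map orthonormal families to families that are in general only of
  this kind.\<close>

definition bessel_family :: "'i set \<Rightarrow> ('i \<Rightarrow> 'a::chilbert_space) \<Rightarrow> bool" where
  "bessel_family I x \<longleftrightarrow> finite I \<and> (\<forall>v. (\<Sum>i\<in>I. (cmod (cinner (x i) v))\<^sup>2) \<le> (norm v)\<^sup>2)"

lemma bessel_family_orthonormal: "orthonormal_on I x \<Longrightarrow> finite I \<Longrightarrow> bessel_family I x"
  by (simp add: bessel_family_def bessel)

lemma bessel_family_image:
  assumes x: "bessel_family I x" and L: "bounded_clinear L" "\<And>v. norm (L v) \<le> norm v"
  shows "bessel_family I (\<lambda>i. L (x i))"
  unfolding bessel_family_def
proof (intro conjI allI)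
  show "finite I" using x by (simp add: bessel_family_def)
  fix v
  have "(\<Sum>i\<in>I. (cmod (cinner (L (x i)) v))\<^sup>2) = (\<Sum>i\<in>I. (cmod (cinner (x i) (cadjoint L v)))\<^sup>2)"
    by (simp add: cinner_cadjoint_right[OF L(1)])
  also have "\<dots> \<le> (norm (cadjoint L v))\<^sup>2" using x by (simp add: bessel_family_def)
  also have "\<dots> \<le> (norm v)\<^sup>2" using cadjoint_bound(2)[OF L(1), of 1 v] L(2) by (intro power_mono) auto
  finally show "(\<Sum>i\<in>I. (cmod (cinner (L (x i)) v))\<^sup>2) \<le> (norm v)\<^sup>2" .
qed

lemma bessel_family_norm_le:
  assumes x: "bessel_family I x" and i: "i \<in> I" shows "norm (x i) \<le> 1"
proof -
  have "(cmod (cinner (x i) (x i)))\<^sup>2 \<le> (\<Sum>j\<in>I. (cmod (cinner (x j) (x i)))\<^sup>2)"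
    using x i unfolding bessel_family_def by (intro member_le_sum) auto
  also have "\<dots> \<le> (norm (x i))\<^sup>2" using x by (simp add: bessel_family_def)
  finally have "((norm (x i))\<^sup>2)\<^sup>2 \<le> (norm (x i))\<^sup>2" by (simp add: cinner_self norm_power)
  then have "(norm (x i))\<^sup>2 \<le> 1"
  proof (cases "x i = 0")
    case False
    then have "(norm (x i))\<^sup>2 > 0" by simp
    moreover have "(norm (x i))\<^sup>2 * (norm (x i))\<^sup>2 \<le> (norm (x i))\<^sup>2 * 1"
      using \<open>((norm (x i))\<^sup>2)\<^sup>2 \<le> (norm (x i))\<^sup>2\<close> unfolding power2_eq_square[of "(norm (x i))\<^sup>2"] by simp
    ultimately show ?thesis by (rule mult_left_le_imp_le[rotated])
  qed simp
  then show ?thesis by (simp add: power_le_one_iff)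
qed

text \<open>The convex function t^q lies above its tangent at \<open>a\<close>; this is Young's
  inequality with the exponents q and q/(q - 1).\<close>

lemma powr_tangent_le:
  fixes a t :: real
  assumes "q \<ge> 1" "a \<ge> 0" "t \<ge> 0"
  shows "q * t * a powr (q - 1) \<le> t powr q + (q - 1) * a powr q"
proof (cases "q = 1")
  case True
  \<comment> \<open>The exponent q - 1 is 0 here, and \<open>a powr 0\<close> is 0 for a = 0 but 1
    otherwise.\<close>
  then show ?thesis using assms by (cases "a = 0") auto
next
  case False
  then have q: "q > 1" using assms by simp
  have "t * a powr (q - 1) \<le> t powr q / q + (a powr (q - 1)) powr (q / (q - 1)) / (q / (q - 1))"
    using q assms by (intro Youngs_inequality) (auto simp: field_simps)
  also have "(a powr (q - 1)) powr (q / (q - 1)) = a powr q" using q by (simp add: powr_powr)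
  finally have "t * a powr (q - 1) \<le> (t powr q + (q - 1) * a powr q) / q"
    using q by (simp add: add_divide_distrib mult.commute)
  then show ?thesis using q by (simp add: pos_le_divide_eq mult_ac)
qed

text \<open>Jensen's inequality for weights of total mass at most 1, by summing the tangent
  inequalities at the mean \<open>A\<close>; missing mass only helps, as (q - 1) A^q is
  nonnegative.\<close>

lemma jensen_powr:
  fixes t w :: "'i \<Rightarrow> real"
  assumes q: "q \<ge> 1" and t: "\<And>i. i \<in> I \<Longrightarrow> t i \<ge> 0" and w: "\<And>i. i \<in> I \<Longrightarrow> w i \<ge> 0"
    and w1: "(\<Sum>i\<in>I. w i) \<le> 1"
  shows "(\<Sum>i\<in>I. t i * w i) powr q \<le> (\<Sum>i\<in>I. t i powr q * w i)"
proof -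
  define A where "A = (\<Sum>i\<in>I. t i * w i)"
  have A: "A \<ge> 0" unfolding A_def using t w by (intro sum_nonneg) auto
  have "q * A powr q = (\<Sum>i\<in>I. (q * t i * A powr (q - 1)) * w i)"
  proof -
    have "A * A powr (q - 1) = A powr q"
      using A q by (cases "A = 0") (auto simp: powr_mult_base)
    then have "q * A powr q = q * A powr (q - 1) * A" by (simp add: mult_ac)
    also have "\<dots> = (\<Sum>i\<in>I. (q * t i * A powr (q - 1)) * w i)"
      unfolding A_def sum_distrib_left by (simp add: mult_ac)
    finally show ?thesis .
  qed
  also have "\<dots> \<le> (\<Sum>i\<in>I. (t i powr q + (q - 1) * A powr q) * w i)"
    by (intro sum_mono mult_right_mono powr_tangent_le q A t w)
  also have "\<dots> = (\<Sum>i\<in>I. t i powr q * w i) + (q - 1) * A powr q * (\<Sum>i\<in>I. w i)"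
    by (simp add: distrib_right sum.distrib sum_distrib_left)
  also have "\<dots> \<le> (\<Sum>i\<in>I. t i powr q * w i) + (q - 1) * A powr q * 1"
    using q w1 by (intro add_left_mono mult_left_mono) auto
  finally show ?thesis by (simp add: A_def algebra_simps)
qed

lemma sum_powr_limit:
  fixes f :: "'i \<Rightarrow> 'f \<Rightarrow> complex"
  assumes lim: "\<And>i. i \<in> I \<Longrightarrow> (f i \<longlongrightarrow> l i) G" and q: "q > 0" and G: "G \<noteq> bot"
    and bd: "eventually (\<lambda>F. (\<Sum>i\<in>I. cmod (f i F) powr q) \<le> D) G"
  shows "(\<Sum>i\<in>I. cmod (l i) powr q) \<le> D"
proof (rule tendsto_upperbound[OF _ bd G])
  show "((\<lambda>F. \<Sum>i\<in>I. cmod (f i F) powr q) \<longlongrightarrow> (\<Sum>i\<in>I. cmod (l i) powr q)) G"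
  proof (rule tendsto_sum)
    fix i assume "i \<in> I"
    then show "((\<lambda>F. cmod (f i F) powr q) \<longlongrightarrow> cmod (l i) powr q) G"
      using q by (intro tendsto_powr' tendsto_norm lim tendsto_const) auto
  qed
qed

text \<open>Insert the singular value expansion of \<open>Z\<close>. By the arithmetic-geometric
  mean inequality its coefficients are dominated by weights \<open>w i b\<close> whose sums over
  \<open>b\<close> and over \<open>i\<close> are at most 1: the former allow Jensen's inequality,
  the latter are used after exchanging the summations.\<close>

lemma bessel_family_test:
  assumes Z: "compact_operator Z" and B: "modulus_basis Z B" and q: "q \<ge> 1"
    and D: "\<And>F. finite F \<Longrightarrow> F \<subseteq> B \<Longrightarrow> (\<Sum>b\<in>F. norm (Z b) powr q) \<le> D"
    and x: "bessel_family I x" and y: "bessel_family I y"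
  shows "(\<Sum>i\<in>I. cmod (cinner (x i) (Z (y i))) powr q) \<le> D"
proof (rule sum_powr_limit[where G = "finite_subsets_at_top B"])
  note lin = bounded_clinear_simps[OF compact_operator_bounded[OF Z]]
  define f where "f i F = (\<Sum>b\<in>F. cinner b (y i) * cinner (x i) (Z b))" for i F
  show "(f i \<longlongrightarrow> cinner (x i) (Z (y i))) (finite_subsets_at_top B)" for i
  proof -
    have "((\<lambda>b. cinner (x i) (Z (cinner b (y i) *\<^sub>C b))) has_sum cinner (x i) (Z (y i))) B"
      by (rule has_sum_bounded_linear[OF cinner.bounded_linear_right
            has_sum_bounded_linear[OF bounded_clinear_linear[OF compact_operator_bounded[OF Z]]
              onb_has_sum[OF modulus_basisD(1)[OF B]]]])
    then show ?thesis by (simp add: has_sum_def f_def[abs_def] lin)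
  qed
  show "\<forall>\<^sub>F F in finite_subsets_at_top B. (\<Sum>i\<in>I. cmod (f i F) powr q) \<le> D"
  proof (rule eventually_finite_subsets_at_top_weakI)
    fix F assume F: "finite F" "F \<subseteq> B"
    define u where "u b = complex_of_real (inverse (norm (Z b))) *\<^sub>C Z b" for b
    define w where "w i b = ((cmod (cinner (u b) (x i)))\<^sup>2 + (cmod (cinner b (y i)))\<^sup>2) / 2" for i b
    define F' where "F' = {b \<in> F. Z b \<noteq> 0}"
    have F': "finite F'" "F' \<subseteq> F" "F' \<subseteq> B" using F by (auto simp: F'_def)
    have onu: "orthonormal_on F' u"
      unfolding orthonormal_on_def
    proof (intro ballI)
      fix b c assume "b \<in> F'" "c \<in> F'"
      then have bc: "b \<in> B" "c \<in> B" "Z b \<noteq> 0" using F by (auto simp: F'_def)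
      show "cinner (u b) (u c) = (if b = c then 1 else 0)"
        using modulus_basis_cinner[OF Z B bc(1,2)] bc(3) by (auto simp: u_def power2_eq_square field_simps)
    qed
    have onF: "orthonormal_on F' (\<lambda>b. b)"
      by (rule orthonormal_on_subset[OF onb_orthonormal[OF modulus_basisD(1)[OF B]] F'(3)])
    have Zu: "Z b = complex_of_real (norm (Z b)) *\<^sub>C u b" for b
      by (cases "Z b = 0") (simp_all add: u_def)
    have w1: "(\<Sum>b\<in>F'. w i b) \<le> 1" if i: "i \<in> I" for i
    proof -
      have "(\<Sum>b\<in>F'. (cmod (cinner (u b) (x i)))\<^sup>2) \<le> 1"
        using bessel[OF onu F'(1), of "x i"] bessel_family_norm_le[OF x i]
        by (meson norm_ge_zero order_trans power_le_one)
      moreover have "(\<Sum>b\<in>F'. (cmod (cinner b (y i)))\<^sup>2) \<le> 1"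
        using bessel[OF onF F'(1), of "y i"] bessel_family_norm_le[OF y i]
        by (meson norm_ge_zero order_trans power_le_one)
      ultimately show ?thesis by (simp add: w_def sum.distrib flip: sum_divide_distrib)
    qed
    have w2: "(\<Sum>i\<in>I. w i b) \<le> 1" if b: "b \<in> F'" for b
    proof -
      have "(\<Sum>i\<in>I. (cmod (cinner (x i) (u b)))\<^sup>2) \<le> (norm (u b))\<^sup>2"
        using x by (simp add: bessel_family_def)
      moreover have "(\<Sum>i\<in>I. (cmod (cinner (y i) b))\<^sup>2) \<le> (norm b)\<^sup>2"
        using y by (simp add: bessel_family_def)
      moreover have "norm (u b) = 1" "norm b = 1"
        using orthonormal_on_norm[OF onu b] orthonormal_on_norm[OF onF b] by auto
      ultimately show ?thesis
        by (simp add: w_def sum.distrib norm_cinner_commute[of "u b"] norm_cinner_commute[of b] flip: sum_divide_distrib)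
    qed
    have "cmod (f i F) powr q \<le> (\<Sum>b\<in>F'. norm (Z b) powr q * w i b)" if i: "i \<in> I" for i
    proof -
      have "f i F = (\<Sum>b\<in>F'. cinner b (y i) * cinner (x i) (Z b))"
        unfolding f_def using F(1) by (intro sum.mono_neutral_right) (auto simp: F'_def)
      also have "cmod \<dots> \<le> (\<Sum>b\<in>F'. cmod (cinner b (y i) * cinner (x i) (Z b)))"
        by (rule norm_sum)
      also have "\<dots> \<le> (\<Sum>b\<in>F'. norm (Z b) * w i b)"
      proof (rule sum_mono)
        fix b
        have "cmod (cinner (x i) (Z b)) = norm (Z b) * cmod (cinner (u b) (x i))"
          by (subst Zu) (simp add: norm_mult norm_cinner_commute[of "x i"])
        moreover have "cmod (cinner b (y i)) * cmod (cinner (u b) (x i)) \<le> w i b"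
          using sum_squares_bound[of "cmod (cinner b (y i))" "cmod (cinner (u b) (x i))"] by (simp add: w_def)
        ultimately show "cmod (cinner b (y i) * cinner (x i) (Z b)) \<le> norm (Z b) * w i b"
          using mult_left_mono[of "cmod (cinner b (y i)) * cmod (cinner (u b) (x i))" "w i b" "norm (Z b)"]
          by (simp add: norm_mult mult_ac)
      qed
      finally have "cmod (f i F) powr q \<le> (\<Sum>b\<in>F'. norm (Z b) * w i b) powr q"
        using q by (intro powr_mono2) auto
      also have "\<dots> \<le> (\<Sum>b\<in>F'. norm (Z b) powr q * w i b)"
        by (rule jensen_powr[OF q _ _ w1[OF i]]) (auto simp: w_def)
      finally show ?thesis .
    qed
    then have "(\<Sum>i\<in>I. cmod (f i F) powr q) \<le> (\<Sum>i\<in>I. \<Sum>b\<in>F'. norm (Z b) powr q * w i b)"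
      by (rule sum_mono)
    also have "\<dots> = (\<Sum>b\<in>F'. norm (Z b) powr q * (\<Sum>i\<in>I. w i b))"
      by (subst sum.swap) (simp add: sum_distrib_left)
    also have "\<dots> \<le> (\<Sum>b\<in>F'. norm (Z b) powr q * 1)"
      by (intro sum_mono mult_left_mono w2) auto
    also have "\<dots> \<le> D" using D[OF F'(1,3)] by simp
    finally show "(\<Sum>i\<in>I. cmod (f i F) powr q) \<le> D" .
  qed
qed (use q in auto)

text \<open>Since the images \<open>T b\<close> are orthogonal, |T x|^2 averages the squared
  singular values with weights |<b, x>|^2. Jensen's inequality with exponent p/2, convex as p >= 2,
  and Bessel's inequality for the family finish as in \<open>bessel_family_test\<close>.\<close>

lemma bessel_family_norm_sum:
  assumes T: "compact_operator T" and B: "modulus_basis T B" and p: "p \<ge> 2"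
    and D: "\<And>F. finite F \<Longrightarrow> F \<subseteq> B \<Longrightarrow> (\<Sum>b\<in>F. norm (T b) powr p) \<le> D"
    and x: "bessel_family I x"
  shows "(\<Sum>i\<in>I. norm (T (x i)) powr p) \<le> D"
proof -
  note lin = bounded_clinear_simps[OF compact_operator_bounded[OF T]]
  define f where "f i F = complex_of_real (norm (T (\<Sum>b\<in>F. cinner b (x i) *\<^sub>C b)))" for i F
  have "(\<Sum>i\<in>I. cmod (complex_of_real (norm (T (x i)))) powr p) \<le> D"
  proof (rule sum_powr_limit[where G = "finite_subsets_at_top B"])
    show "(f i \<longlongrightarrow> complex_of_real (norm (T (x i)))) (finite_subsets_at_top B)" for i
      unfolding f_def using onb_has_sum[OF modulus_basisD(1)[OF B], of "x i"]
      by (intro tendsto_of_real tendsto_norm bounded_linear.tendsto[OF bounded_clinear_linear[OF compact_operator_bounded[OF T]]])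
        (simp add: has_sum_def)
    show "\<forall>\<^sub>F F in finite_subsets_at_top B. (\<Sum>i\<in>I. cmod (f i F) powr p) \<le> D"
    proof (rule eventually_finite_subsets_at_top_weakI)
      fix F assume F: "finite F" "F \<subseteq> B"
      have onF: "orthonormal_on F (\<lambda>b. b)"
        by (rule orthonormal_on_subset[OF onb_orthonormal[OF modulus_basisD(1)[OF B]] F(2)])
      have "cmod (f i F) powr p \<le> (\<Sum>b\<in>F. norm (T b) powr p * (cmod (cinner b (x i)))\<^sup>2)" if i: "i \<in> I" for i
      proof -
        have "(cmod (f i F))\<^sup>2 = (norm (\<Sum>b\<in>F. cinner b (x i) *\<^sub>C T b))\<^sup>2" by (simp add: f_def lin)
        also have "\<dots> = (\<Sum>b\<in>F. (norm (cinner b (x i) *\<^sub>C T b))\<^sup>2)"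
        proof (rule norm_sum_orthogonal[OF F(1)])
          fix b c assume "b \<in> F" "c \<in> F" "b \<noteq> c"
          then show "cinner (cinner b (x i) *\<^sub>C T b) (cinner c (x i) *\<^sub>C T c) = 0"
            using modulus_basis_cinner[OF T B, of b c] F(2) by auto
        qed
        also have "\<dots> = (\<Sum>b\<in>F. (norm (T b))\<^sup>2 * (cmod (cinner b (x i)))\<^sup>2)"
          by (simp add: norm_scaleC power_mult_distrib mult.commute)
        finally have eq: "(cmod (f i F))\<^sup>2 = (\<Sum>b\<in>F. (norm (T b))\<^sup>2 * (cmod (cinner b (x i)))\<^sup>2)" .
        have pw: "(r\<^sup>2) powr (p / 2) = r powr p" if "r \<ge> 0" for r :: real
          using that by (cases "r = 0") (simp_all add: powr_powr flip: powr_numeral)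
        have "cmod (f i F) powr p = (\<Sum>b\<in>F. (norm (T b))\<^sup>2 * (cmod (cinner b (x i)))\<^sup>2) powr (p / 2)"
          unfolding eq[symmetric] by (rule pw[symmetric]) simp
        also have "\<dots> \<le> (\<Sum>b\<in>F. ((norm (T b))\<^sup>2) powr (p / 2) * (cmod (cinner b (x i)))\<^sup>2)"
          using p bessel[OF onF F(1), of "x i"] bessel_family_norm_le[OF x i]
          by (intro jensen_powr) (auto intro: order_trans[OF _ power_le_one])
        finally show ?thesis by (simp add: pw)
      qed
      then have "(\<Sum>i\<in>I. cmod (f i F) powr p) \<le> (\<Sum>i\<in>I. \<Sum>b\<in>F. norm (T b) powr p * (cmod (cinner b (x i)))\<^sup>2)"
        by (rule sum_mono)
      also have "\<dots> = (\<Sum>b\<in>F. norm (T b) powr p * (\<Sum>i\<in>I. (cmod (cinner (x i) b))\<^sup>2))"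
        by (subst sum.swap) (simp add: sum_distrib_left norm_cinner_commute[of "x _"])
      also have "\<dots> \<le> (\<Sum>b\<in>F. norm (T b) powr p * 1)"
      proof (intro sum_mono mult_left_mono)
        fix b assume "b \<in> F"
        have "(\<Sum>i\<in>I. (cmod (cinner (x i) b))\<^sup>2) \<le> (norm b)\<^sup>2" using x by (simp add: bessel_family_def)
        then show "(\<Sum>i\<in>I. (cmod (cinner (x i) b))\<^sup>2) \<le> 1"
          using orthonormal_on_norm[OF onF \<open>b \<in> F\<close>] by simp
      qed simp
      also have "\<dots> \<le> D" using D[OF F] by simp
      finally show "(\<Sum>i\<in>I. cmod (f i F) powr p) \<le> D" .
    qed
  qed (use p in auto)
  then show ?thesis by simp
qed

section \<open>Gram-Schmidt orthogonalisation\<close>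

lemma cinner_span_zero:
  assumes "v \<in> complex_vector.span V" "\<And>w. w \<in> V \<Longrightarrow> cinner w z = 0"
  shows "cinner v (z::'a::chilbert_space) = 0"
proof -
  have "complex_vector.span V \<subseteq> {v. cinner v z = 0}"
    using assms(2) by (intro complex_vector.span_minimal complex_vector.subspaceI) (auto simp: cinner_add_left)
  then show ?thesis using assms(1) by blast
qed

text \<open>One Gram-Schmidt step per induction step: the new vector is replaced by its component
  \<open>a'\<close> orthogonal to the old span.\<close>

lemma finite_span_projection:
  assumes "finite V"
  shows "\<exists>w\<in>complex_vector.span V. \<forall>v\<in>V. cinner v (x - w :: 'a::chilbert_space) = 0"
  using assms
proof (induction V arbitrary: x rule: finite_induct)
  case empty
  then show ?case by auto
next
  case (insert a V)
  have mono: "complex_vector.span V \<subseteq> complex_vector.span (insert a V)"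
    by (intro complex_vector.span_mono) auto
  obtain w where w: "w \<in> complex_vector.span V" "\<And>v. v \<in> V \<Longrightarrow> cinner v (x - w) = 0"
    using insert.IH[of x] by blast
  obtain w' where w': "w' \<in> complex_vector.span V" "\<And>v. v \<in> V \<Longrightarrow> cinner v (a - w') = 0"
    using insert.IH[of a] by blast
  define a' where "a' = a - w'"
  \<comment> \<open>For a' = 0 the quotient is a division by 0 with value 0, so no correction is
    added.\<close>
  define y where "y = w + (cinner a' (x - w) / cinner a' a') *\<^sub>C a'"
  have a'V: "cinner v a' = 0" if "v \<in> V" for v using w'(2)[OF that] by (simp add: a'_def)
  have a'span: "a' \<in> complex_vector.span (insert a V)"
    unfolding a'_def using mono w'(1) complex_vector.span_base[of a "insert a V"]
    by (intro complex_vector.span_diff) auto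
  have yV: "cinner v (x - y) = 0" if "v \<in> V" for v
  proof -
    have "cinner v (x - y) = cinner v (x - w) - cinner v ((cinner a' (x - w) / cinner a' a') *\<^sub>C a')"
      by (simp add: y_def cinner.diff_right cinner_add_right)
    then show ?thesis using w(2)[OF that] a'V[OF that] by simp
  qed
  have ya': "cinner a' (x - y) = 0"
  proof -
    have "cinner a' (x - y) = cinner a' (x - w) - cinner a' (x - w) / cinner a' a' * cinner a' a'"
      by (simp add: y_def cinner.diff_right cinner_add_right)
    then show ?thesis by (cases "a' = 0") (simp_all add: cinner_self)
  qed
  have "cinner w' (x - y) = 0" by (rule cinner_span_zero[OF w'(1) yV])
  then have "cinner a (x - y) = 0" using ya' by (simp add: a'_def cinner.diff_left)
  moreover have "y \<in> complex_vector.span (insert a V)"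
    unfolding y_def using mono w(1) a'span
    by (intro complex_vector.span_add complex_vector.span_scale) auto
  ultimately show ?case using yV by (intro bexI[of _ y]) auto
qed

lemma normalize_cinner:
  assumes "x \<noteq> (0::'a::chilbert_space)"
  shows "norm (complex_of_real (inverse (norm x)) *\<^sub>C x) = 1"
  using assms by (simp add: norm_scaleC norm_inverse)

lemma finite_orthonormal_basis:
  assumes "finite V"
  shows "\<exists>E. finite E \<and> orthonormal_on E (\<lambda>e. e::'a::chilbert_space) \<and> V \<subseteq> complex_vector.span E"
  using assms
proof (induction V rule: finite_induct)
  case empty
  then show ?case by (intro exI[of _ "{}"]) (simp add: orthonormal_on_def)
next
  case (insert a V)
  then obtain E where E: "finite E" "orthonormal_on E (\<lambda>e. e)" "V \<subseteq> complex_vector.span E" by blast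
  obtain w where w: "w \<in> complex_vector.span E" "\<And>e. e \<in> E \<Longrightarrow> cinner e (a - w) = 0"
    using finite_span_projection[OF E(1)] by blast
  show ?case
  proof (cases "a = w")
    case True
    then show ?thesis using E w(1) by (intro exI[of _ E]) auto
  next
    case False
    define f where "f = complex_of_real (inverse (norm (a - w))) *\<^sub>C (a - w)"
    have nf: "norm f = 1" unfolding f_def using False by (intro normalize_cinner) simp
    have ff: "cinner f f = 1" using nf by (simp add: cinner_self)
    have fE: "cinner e f = 0" "cinner f e = 0" if "e \<in> E" for e
      using w(2)[OF that] cinner_eq_zero_commute[of "a - w" e] by (simp_all add: f_def)
    have fnE: "f \<notin> E" using fE(1)[of f] ff by auto
    have on: "orthonormal_on (insert f E) (\<lambda>e. e)"
      unfolding orthonormal_on_def using orthonormal_onD[OF E(2)] fE ff fnE by auto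
    have mono: "complex_vector.span E \<subseteq> complex_vector.span (insert f E)"
      by (intro complex_vector.span_mono) auto
    have "a = w + complex_of_real (norm (a - w)) *\<^sub>C f"
      using False by (simp add: f_def)
    also have "\<dots> \<in> complex_vector.span (insert f E)"
      using mono w(1) complex_vector.span_base[of f "insert f E"]
      by (intro complex_vector.span_add complex_vector.span_scale) auto
    finally show ?thesis
      using E mono on by (intro exI[of _ "insert f E"]) auto
  qed
qed

lemma orthonormal_span_expansion:
  assumes E: "finite E" "orthonormal_on E (\<lambda>e. e)" and v: "v \<in> complex_vector.span E"
  shows "v = (\<Sum>e\<in>E. cinner e v *\<^sub>C e)"
proof -
  let ?M = "{v. v = (\<Sum>e\<in>E. cinner e v *\<^sub>C e)}"
  have "complex_vector.span E \<subseteq> ?M"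
  proof (rule complex_vector.span_minimal)
    show "E \<subseteq> ?M"
    proof
      fix f assume f: "f \<in> E"
      have "(\<Sum>e\<in>E. cinner e f *\<^sub>C e) = (\<Sum>e\<in>E. if e = f then f else 0)"
        using orthonormal_onD[OF E(2) _ f] by (intro sum.cong) auto
      then show "f \<in> ?M" using f E(1) by simp
    qed
    show "complex_vector.subspace ?M"
    proof (rule complex_vector.subspaceI)
      show "0 \<in> ?M" by simp
      fix u v c assume u: "u \<in> ?M"
      have "(\<Sum>e\<in>E. cinner e (c *\<^sub>C u) *\<^sub>C e) = c *\<^sub>C (\<Sum>e\<in>E. cinner e u *\<^sub>C e)"
        by (simp add: complex_vector.scale_sum_right)
      then show "c *\<^sub>C u \<in> ?M" using u by simp
      assume v: "v \<in> ?M"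
      have "(\<Sum>e\<in>E. cinner e (u + v) *\<^sub>C e) = (\<Sum>e\<in>E. cinner e u *\<^sub>C e) + (\<Sum>e\<in>E. cinner e v *\<^sub>C e)"
        by (simp add: cinner_add_right scaleC_add_left sum.distrib)
      then show "u + v \<in> ?M" using u v by simp
    qed
  qed
  then show ?thesis using v by blast
qed

text \<open>Schur triangularisation: after Gram-Schmidt, eigenvalues become diagonal matrix entries.\<close>

lemma schur_diagonal:
  fixes h :: "nat \<Rightarrow> 'a::chilbert_space"
  assumes A: "bounded_clinear A" and eig: "\<And>k. k < n \<Longrightarrow> A (h k) = \<mu> k *\<^sub>C h k"
    and indep: "\<And>k. k < n \<Longrightarrow> h k \<notin> complex_vector.span (h ` {..<k})"
  shows "\<exists>e. orthonormal_on {..<n} e \<and> (\<forall>k<n. cinner (e k) (A (e k)) = \<mu> k)"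
proof -
  let ?V = "\<lambda>k. complex_vector.span (h ` {..<k})"
  note lin = bounded_clinear_simps[OF A]
  have "\<exists>w\<in>?V k. \<forall>v\<in>h ` {..<k}. cinner v (h k - w) = 0" for k
    by (rule finite_span_projection) simp
  then obtain w where w: "\<And>k. w k \<in> ?V k"
      "\<And>k l. l < k \<Longrightarrow> cinner (h l) (h k - w k) = 0"
    by (metis imageI lessThan_iff)
  define e where "e k = complex_of_real (inverse (norm (h k - w k))) *\<^sub>C (h k - w k)" for k
  have mono: "?V k \<subseteq> ?V l" if "k \<le> l" for k l
    using that by (intro complex_vector.span_mono image_mono) auto
  have ne: "h k - w k \<noteq> 0" if "k < n" for k
    using indep[OF that] w(1)[of k] by auto
  have ne1: "norm (e k) = 1" if "k < n" for k
    unfolding e_def by (rule normalize_cinner[OF ne[OF that]])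
  have orth: "cinner v (e k) = 0" if "v \<in> ?V k" for v k
    by (rule cinner_span_zero[OF that]) (auto simp: e_def w(2))
  have espan: "e k \<in> ?V l" if "k < l" for k l
  proof -
    have "w k \<in> ?V l" using w(1) mono[of k l] that by auto
    moreover have "h k \<in> ?V l"
      using that by (intro complex_vector.span_base) auto
    ultimately show ?thesis
      unfolding e_def by (intro complex_vector.span_scale complex_vector.span_diff)
  qed
  have "orthonormal_on {..<n} e"
    unfolding orthonormal_on_def
  proof (intro ballI)
    fix k l assume kl: "k \<in> {..<n}" "l \<in> {..<n}"
    consider "k = l" | "k < l" | "l < k" by linarith
    then show "cinner (e k) (e l) = (if k = l then 1 else 0)"
    proof cases
      case 1
      then show ?thesis using ne1[of l] kl by (simp add: cinner_self)
    next
      case 2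
      then show ?thesis using orth[OF espan[OF 2]] by simp
    next
      case 3
      then show ?thesis using orth[OF espan[OF 3]] cinner_eq_zero_commute[of "e l" "e k"] by simp
    qed
  qed
  moreover have "cinner (e k) (A (e k)) = \<mu> k" if k: "k < n" for k
  proof -
    \<comment> \<open>\<open>?V k\<close> is spanned by eigenvectors, hence invariant. So A (e k)
      differs from the multiple of \<open>e k\<close> by \<mu> k only by a vector \<open>z\<close>
      of \<open>?V k\<close>, to which \<open>e k\<close> is orthogonal.\<close>
    have "?V k \<subseteq> {v. A v \<in> ?V k}"
    proof (rule complex_vector.span_minimal)
      show "h ` {..<k} \<subseteq> {v. A v \<in> ?V k}"
        using eig k by (auto simp: complex_vector.span_base complex_vector.span_scale)
      show "complex_vector.subspace {v. A v \<in> ?V k}"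
        by (rule complex_vector.subspaceI)
          (auto simp: lin intro: complex_vector.span_zero complex_vector.span_add complex_vector.span_scale)
    qed
    then have Aw: "A (w k) \<in> ?V k" using w(1) by blast
    define z where "z = complex_of_real (inverse (norm (h k - w k))) *\<^sub>C (\<mu> k *\<^sub>C w k - A (w k))"
    have "z \<in> ?V k"
      unfolding z_def using Aw w(1) by (intro complex_vector.span_scale complex_vector.span_diff) auto
    then have "cinner z (e k) = 0" by (rule orth)
    then have z0: "cinner (e k) z = 0" using cinner_eq_zero_commute[of z "e k"] by simp
    have "A (e k) = \<mu> k *\<^sub>C e k + z"
      unfolding e_def z_def lin eig[OF k]
      by (simp add: complex_vector.scale_right_diff_distrib mult.commute)
    then show ?thesis using z0 ne1[OF k] by (simp add: cinner_add_right cinner_self)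
  qed
  ultimately show ?thesis by blast
qed

section \<open>Hilbert-Schmidt estimates\<close>

text \<open>For the finite rank operator M = sum of c k u k <v k, .> the left side sums |<y w, M (x
  w)>|^2, and the right side is its squared Hilbert-Schmidt norm, written with Gram matrices so that
  blocks can be summed later.\<close>

lemma hilbert_schmidt_bessel:
  fixes u v :: "'k \<Rightarrow> 'a::chilbert_space"
  assumes K: "finite K" and W: "finite W" and x: "orthonormal_on W x" and y: "orthonormal_on W y"
  shows "(\<Sum>w\<in>W. (cmod (\<Sum>k\<in>K. c k * cinner (y w) (u k) * cinner (v k) (x w)))\<^sup>2)
    \<le> Re (\<Sum>k\<in>K. \<Sum>l\<in>K. c k * cnj (c l) * cinner (v k) (v l) * cinner (u l) (u k))"
proof -
  let ?d = "\<lambda>e. \<Sum>k\<in>K. \<Sum>l\<in>K. c k * cnj (c l) * cinner (v k) (v l) * (cinner (u l) e * cinner e (u k))"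
  let ?q = "\<lambda>w. \<Sum>k\<in>K. c k * cinner (y w) (u k) * cinner (v k) (x w)"
  obtain E where E: "finite E" "orthonormal_on E (\<lambda>e. e)" "u ` K \<subseteq> complex_vector.span E"
    using finite_orthonormal_basis[of "u ` K"] K by blast
  \<comment> \<open>\<open>z w\<close> is the operator applied to \<open>x w\<close>, and
    \<open>m e\<close> is its adjoint applied to \<open>e\<close>.\<close>
  define z where "z w = (\<Sum>k\<in>K. (c k * cinner (v k) (x w)) *\<^sub>C u k)" for w
  define m where "m e = (\<Sum>k\<in>K. cnj (c k * cinner e (u k)) *\<^sub>C v k)" for e
  have "(\<Sum>w\<in>W. (cmod (?q w))\<^sup>2) \<le> (\<Sum>w\<in>W. (norm (z w))\<^sup>2)"
  proof (rule sum_mono)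
    fix w assume w: "w \<in> W"
    have "?q w = cinner (y w) (z w)"
      by (simp add: z_def cinner.sum_right mult_ac)
    then have "cmod (?q w) \<le> norm (z w)"
      using norm_cinner_le[of "y w" "z w"] orthonormal_on_norm[OF y w] by simp
    then show "(cmod (?q w))\<^sup>2 \<le> (norm (z w))\<^sup>2"
      by (intro power_mono) auto
  qed
  also have "\<dots> = (\<Sum>w\<in>W. \<Sum>e\<in>E. (cmod (cinner (m e) (x w)))\<^sup>2)"
  proof (rule sum.cong)
    fix w
    have "z w \<in> complex_vector.span E"
      unfolding z_def using E(3) by (intro complex_vector.span_sum complex_vector.span_scale) auto
    then have zw: "z w = (\<Sum>e\<in>E. cinner e (z w) *\<^sub>C e)" by (rule orthonormal_span_expansion[OF E(1,2)])
    have "(norm (z w))\<^sup>2 = (norm (\<Sum>e\<in>E. cinner e (z w) *\<^sub>C e))\<^sup>2" using zw by simp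
    also have "\<dots> = (\<Sum>e\<in>E. (cmod (cinner e (z w)))\<^sup>2)"
      by (rule norm_orthonormal_sum[OF E(2,1)])
    also have "\<dots> = (\<Sum>e\<in>E. (cmod (cinner (m e) (x w)))\<^sup>2)"
    proof (rule sum.cong)
      fix e
      have "cinner e (z w) = cinner (m e) (x w)"
        by (simp add: z_def m_def cinner.sum_right cinner.sum_left mult_ac)
      then show "(cmod (cinner e (z w)))\<^sup>2 = (cmod (cinner (m e) (x w)))\<^sup>2" by simp
    qed simp
    finally show "(norm (z w))\<^sup>2 = (\<Sum>e\<in>E. (cmod (cinner (m e) (x w)))\<^sup>2)" .
  qed simp
  also have "\<dots> = (\<Sum>e\<in>E. \<Sum>w\<in>W. (cmod (cinner (x w) (m e)))\<^sup>2)"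
    by (subst sum.swap) (simp add: norm_cinner_commute[of "m _"])
  also have "\<dots> \<le> (\<Sum>e\<in>E. (norm (m e))\<^sup>2)"
    by (intro sum_mono bessel[OF x W])
  also have "\<dots> = Re (\<Sum>e\<in>E. cinner (m e) (m e))" by (simp add: cinner_self flip: of_real_power)
  also have "(\<Sum>e\<in>E. cinner (m e) (m e))
      = (\<Sum>e\<in>E. ?d e)"
  proof (rule sum.cong)
    fix e
    have "cinner (m e) (m e) = (\<Sum>k\<in>K. cinner (cnj (c k * cinner e (u k)) *\<^sub>C v k) (m e))"
      by (subst m_def) (rule cinner.sum_left)
    also have "\<dots> = ?d e"
      by (simp add: m_def cinner.sum_right sum_distrib_left mult_ac flip: cinner_commute)
    finally show "cinner (m e) (m e)
      = ?d e" .
  qed simp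
  also have "\<dots> = (\<Sum>k\<in>K. \<Sum>l\<in>K. c k * cnj (c l) * cinner (v k) (v l) * (\<Sum>e\<in>E. cinner (u l) e * cinner e (u k)))"
    unfolding sum_distrib_left by (subst sum.swap, rule sum.cong[OF refl], subst sum.swap, rule refl)
  also have "\<dots> = (\<Sum>k\<in>K. \<Sum>l\<in>K. c k * cnj (c l) * cinner (v k) (v l) * cinner (u l) (u k))"
  proof (intro sum.cong refl arg_cong2[where f = times])
    fix k l assume k: "k \<in> K"
    have "u k = (\<Sum>e\<in>E. cinner e (u k) *\<^sub>C e)" using E k by (intro orthonormal_span_expansion) auto
    then have "cinner (u l) (u k) = cinner (u l) (\<Sum>e\<in>E. cinner e (u k) *\<^sub>C e)" by simp
    then show "(\<Sum>e\<in>E. cinner (u l) e * cinner e (u k)) = cinner (u l) (u k)"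
      by (simp add: cinner.sum_right mult.commute)
  qed
  finally show ?thesis .
qed

lemma sum_matrix_positions:
  fixes f :: "'e \<Rightarrow> 'b::comm_monoid_add" and \<sigma> :: "'e \<Rightarrow> 'n::finite \<times> 'm::finite"
  assumes E: "finite E"
  shows "(\<Sum>e\<in>E. f e) = (\<Sum>i\<in>UNIV. \<Sum>j\<in>UNIV. \<Sum>e | e \<in> E \<and> \<sigma> e = (i, j). f e)"
proof -
  have "(\<Sum>e\<in>E. f e) = (\<Sum>y\<in>UNIV. \<Sum>e | e \<in> E \<and> \<sigma> e = y. f e)"
    using sum.group[OF E, of UNIV \<sigma> f] by simp
  also have "\<dots> = (\<Sum>i\<in>UNIV. \<Sum>j\<in>UNIV. \<Sum>e | e \<in> E \<and> \<sigma> e = (i, j). f e)"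
    unfolding sum.cartesian_product UNIV_Times_UNIV by (intro sum.cong) auto
  finally show ?thesis .
qed

text \<open>The family \<open>g\<close> is orthonormal in the direct sum of copies of the space indexed by \<open>'n\<close>;
  \<open>\<sigma> e\<close> is the matrix position of the rank-one block \<open>e\<close>.\<close>

lemma hilbert_schmidt_block_bound:
  fixes g :: "'k \<Rightarrow> 'n::finite \<Rightarrow> 'a::chilbert_space" and \<sigma> :: "'e \<Rightarrow> 'n \<times> 'n"
  assumes K: "finite K" and E: "finite E"
    and g: "\<And>k l. k \<in> K \<Longrightarrow> l \<in> K \<Longrightarrow> (\<Sum>i\<in>UNIV. cinner (g k i) (g l i)) = (if k = l then 1 else 0)"
    and x: "\<And>i j. orthonormal_on {e \<in> E. \<sigma> e = (i, j)} x"
    and y: "\<And>i j. orthonormal_on {e \<in> E. \<sigma> e = (i, j)} y"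
  shows "(\<Sum>k\<in>K. (cmod (\<Sum>e\<in>E. r e * (cinner (g k (fst (\<sigma> e))) (x e) * cinner (y e) (g k (snd (\<sigma> e))))))\<^sup>2)
    \<le> (\<Sum>e\<in>E. (cmod (r e))\<^sup>2)"
proof -
  let ?q = "\<lambda>A i j. Re (\<Sum>k\<in>K. \<Sum>l\<in>K. cnj (A k) * cnj (cnj (A l)) * cinner (g k i) (g l i) * cinner (g l j) (g k j))"
  define A where "A k = (\<Sum>e\<in>E. r e * (cinner (g k (fst (\<sigma> e))) (x e) * cinner (y e) (g k (snd (\<sigma> e)))))" for k
  \<comment> \<open>Duality: \<open>A k\<close> is the value <g k, M (g k)> of the block matrix M
    with coefficients \<open>r\<close>, and \<open>Q\<close> is the transposed map applied to the
    conjugate of \<open>A\<close>. Hence \<open>S\<close> is the sum of the products of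
    \<open>r e\<close> and \<open>Q e\<close>, while orthonormality of \<open>g\<close> bounds the
    sum of |Q e|^2 by \<open>S\<close> again.\<close>
  define Q where "Q e = (\<Sum>k\<in>K. cnj (A k) * cinner (y e) (g k (snd (\<sigma> e))) * cinner (g k (fst (\<sigma> e))) (x e))" for e
  define S where "S = (\<Sum>k\<in>K. (cmod (A k))\<^sup>2)"
  define R where "R = (\<Sum>e\<in>E. (cmod (r e))\<^sup>2)"
  have S0: "S \<ge> 0" and R0: "R \<ge> 0" by (auto simp: S_def R_def intro: sum_nonneg)
  note grp = sum_matrix_positions[OF E, of _ \<sigma>]
  have "(\<Sum>e\<in>E. (cmod (Q e))\<^sup>2) = (\<Sum>i\<in>UNIV. \<Sum>j\<in>UNIV. \<Sum>e | e \<in> E \<and> \<sigma> e = (i, j). (cmod (Q e))\<^sup>2)"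
    by (rule grp)
  also have "\<dots> \<le> (\<Sum>i\<in>UNIV. \<Sum>j\<in>UNIV. ?q A i j)"
  proof (intro sum_mono)
    fix i j :: 'n
    have "(\<Sum>e | e \<in> E \<and> \<sigma> e = (i, j). (cmod (Q e))\<^sup>2)
        = (\<Sum>e | e \<in> E \<and> \<sigma> e = (i, j). (cmod (\<Sum>k\<in>K. cnj (A k) * cinner (y e) (g k j) * cinner (g k i) (x e)))\<^sup>2)"
      by (intro sum.cong) (auto simp: Q_def)
    also have "\<dots> \<le> ?q A i j"
      using E by (intro hilbert_schmidt_bessel K x y) auto
    finally show "(\<Sum>e | e \<in> E \<and> \<sigma> e = (i, j). (cmod (Q e))\<^sup>2)
        \<le> ?q A i j" .
  qed
  also have "\<dots> = Re (\<Sum>i\<in>UNIV. \<Sum>j\<in>UNIV. \<Sum>k\<in>K. \<Sum>l\<in>K. cnj (A k) * A l * (cinner (g k i) (g l i) * cinner (g l j) (g k j)))"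
    by (simp add: mult.assoc)
  also have "(\<Sum>i\<in>UNIV. \<Sum>j\<in>UNIV. \<Sum>k\<in>K. \<Sum>l\<in>K. cnj (A k) * A l * (cinner (g k i) (g l i) * cinner (g l j) (g k j)))
      = (\<Sum>k\<in>K. \<Sum>l\<in>K. \<Sum>i\<in>UNIV. \<Sum>j\<in>UNIV. cnj (A k) * A l * (cinner (g k i) (g l i) * cinner (g l j) (g k j)))"
    unfolding sum.cartesian_product
    by (rule sum.reindex_bij_witness[of _ "\<lambda>(k, l, i, j). (i, j, k, l)" "\<lambda>(i, j, k, l). (k, l, i, j)"]) auto
  also have "\<dots> = (\<Sum>k\<in>K. \<Sum>l\<in>K. cnj (A k) * A l * ((\<Sum>i\<in>UNIV. cinner (g k i) (g l i)) * (\<Sum>j\<in>UNIV. cinner (g l j) (g k j))))"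
    by (intro sum.cong refl, subst sum_product, simp only: sum_distrib_left)
  also have "\<dots> = (\<Sum>k\<in>K. \<Sum>l\<in>K. if k = l then cnj (A k) * A k else 0)"
    by (intro sum.cong refl) (simp add: g)
  also have "\<dots> = complex_of_real S"
    using K by (simp add: S_def complex_norm_square mult.commute del: of_real_power)
  finally have QS: "(\<Sum>e\<in>E. (cmod (Q e))\<^sup>2) \<le> S" by simp
  have "complex_of_real S = (\<Sum>k\<in>K. cnj (A k) * A k)"
    by (simp add: S_def complex_norm_square mult.commute del: of_real_power)
  also have "\<dots> = (\<Sum>k\<in>K. \<Sum>e\<in>E. r e * (cnj (A k) * cinner (y e) (g k (snd (\<sigma> e))) * cinner (g k (fst (\<sigma> e))) (x e)))"
    by (subst (2) A_def) (simp add: sum_distrib_left mult_ac)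
  also have "\<dots> = (\<Sum>e\<in>E. r e * Q e)"
    by (subst sum.swap) (simp add: Q_def sum_distrib_left)
  finally have "S = cmod (\<Sum>e\<in>E. r e * Q e)" using S0 by (metis abs_of_nonneg norm_of_real)
  also have "\<dots> \<le> (\<Sum>e\<in>E. cmod (r e) * cmod (Q e))" by (rule order_trans[OF norm_sum]) (simp add: norm_mult)
  finally have "S\<^sup>2 \<le> (\<Sum>e\<in>E. cmod (r e) * cmod (Q e))\<^sup>2" using S0 by (intro power_mono)
  also have "\<dots> \<le> R * (\<Sum>e\<in>E. (cmod (Q e))\<^sup>2)" unfolding R_def by (rule Cauchy_Schwarz_ineq_sum)
  also have "\<dots> \<le> R * S" using QS R0 by (rule mult_left_mono)
  finally have "S * S \<le> R * S" by (simp add: power2_eq_square)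
  then have "S \<le> R" using S0 R0 by (cases "S = 0") auto
  then show ?thesis by (simp add: S_def R_def A_def)
qed

section \<open>Complex interpolation\<close>

text \<open>A crude bound: the three lines theorem only asks for some bound on the whole
  strip.\<close>

lemma cmod_exp_sum_bound:
  assumes "finite A" "\<bar>Re z\<bar> \<le> 1"
  shows "cmod (\<Sum>a\<in>A. c a * exp (complex_of_real (l a) * z)) \<le> (\<Sum>a\<in>A. cmod (c a) * exp \<bar>l a\<bar>)"
proof (rule order_trans[OF norm_sum], rule sum_mono)
  fix a
  have "l a * Re z \<le> \<bar>l a\<bar>"
  proof -
    have "l a * Re z \<le> \<bar>l a * Re z\<bar>" by simp
    also have "\<dots> \<le> \<bar>l a\<bar> * 1" unfolding abs_mult using assms(2) by (intro mult_left_mono) auto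
    finally show ?thesis by simp
  qed
  then show "cmod (c a * exp (complex_of_real (l a) * z)) \<le> cmod (c a) * exp \<bar>l a\<bar>"
    by (simp add: norm_mult mult_left_mono)
qed

text \<open>Hadamard's three lines theorem; the factor \<open>exp (\<epsilon> (z\<^sup>2 - 1))\<close> forces decay at the ends of
  the strip.\<close>

lemma three_lines:
  fixes G :: "complex \<Rightarrow> complex"
  assumes hol: "G holomorphic_on UNIV"
    and bd: "\<And>z. 0 \<le> Re z \<Longrightarrow> Re z \<le> 1 \<Longrightarrow> cmod (G z) \<le> L"
    and b0: "\<And>z. Re z = 0 \<Longrightarrow> cmod (G z) \<le> 1" and b1: "\<And>z. Re z = 1 \<Longrightarrow> cmod (G z) \<le> 1"
    and \<theta>: "0 \<le> \<theta>" "\<theta> \<le> 1"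
  shows "cmod (G (complex_of_real \<theta>)) \<le> 1"
proof -
  have le: "cmod (G (complex_of_real \<theta>)) \<le> exp \<epsilon>" if \<epsilon>: "\<epsilon> > 0" for \<epsilon>
  proof -
    define H where "H z = G z * exp (complex_of_real \<epsilon> * (z\<^sup>2 - 1))" for z
    \<comment> \<open>Chosen so that \<epsilon> Y^2 >= |L|: on the horizontal sides the factor is at
      most exp (- |L|), which beats the bound \<open>L\<close> because |L| exp (- |L|) <= 1.\<close>
    define Y where "Y = \<bar>L\<bar> / \<epsilon> + 1"
    have Y: "Y \<ge> 1" "\<epsilon> * Y\<^sup>2 \<ge> \<bar>L\<bar>"
    proof -
      show 1: "Y \<ge> 1" using \<epsilon> by (simp add: Y_def)
      have "\<bar>L\<bar> \<le> \<epsilon> * Y" using \<epsilon> by (simp add: Y_def field_simps)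
      also have "\<dots> \<le> \<epsilon> * (Y * Y)" using \<epsilon> 1 mult_left_mono[of 1 Y Y] by (intro mult_left_mono) auto
      finally show "\<epsilon> * Y\<^sup>2 \<ge> \<bar>L\<bar>" by (simp add: power2_eq_square)
    qed
    have nexp: "cmod (exp (complex_of_real \<epsilon> * (z\<^sup>2 - 1))) = exp (\<epsilon> * ((Re z)\<^sup>2 - (Im z)\<^sup>2 - 1))" for z
      by (simp add: Re_power2)
    define S where "S = cbox (Complex 0 (- Y)) (Complex 1 Y)"
    have Siff: "z \<in> S \<longleftrightarrow> 0 \<le> Re z \<and> Re z \<le> 1 \<and> - Y \<le> Im z \<and> Im z \<le> Y" for z
      by (auto simp: S_def in_cbox_complex_iff)
    have "cmod (H (complex_of_real \<theta>)) \<le> 1"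
    proof (rule maximum_modulus_frontier[of H S])
      have "H holomorphic_on UNIV"
        unfolding H_def by (intro holomorphic_intros hol)
      then show "H holomorphic_on interior S" by (rule holomorphic_on_subset) auto
      show "continuous_on (closure S) H"
        using \<open>H holomorphic_on UNIV\<close> holomorphic_on_imp_continuous_on continuous_on_subset by blast
      show "bounded S" by (simp add: S_def)
      show "complex_of_real \<theta> \<in> S" using \<theta> Y by (simp add: Siff)
      fix z assume z: "z \<in> frontier S"
      then have zS: "z \<in> S" unfolding S_def frontier_cbox by simp
      have "z \<notin> box (Complex 0 (- Y)) (Complex 1 Y)" using z unfolding S_def frontier_cbox by simp
      then have cases: "Re z = 0 \<or> Re z = 1 \<or> \<bar>Im z\<bar> = Y"
        using zS by (auto simp: Siff in_box_complex_iff)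
      have x2: "(Re z)\<^sup>2 \<le> 1" using zS by (simp add: Siff power_le_one)
      show "cmod (H z) \<le> 1"
      proof (cases "\<bar>Im z\<bar> = Y")
        case True
        then have "(Im z)\<^sup>2 = Y\<^sup>2" by (metis power2_abs)
        then have "\<epsilon> * ((Re z)\<^sup>2 - (Im z)\<^sup>2 - 1) \<le> \<epsilon> * (- Y\<^sup>2)" using x2 \<epsilon> by (intro mult_left_mono) auto
        then have e: "\<epsilon> * ((Re z)\<^sup>2 - (Im z)\<^sup>2 - 1) \<le> - \<bar>L\<bar>" using Y(2) by simp
        have "cmod (H z) \<le> \<bar>L\<bar> * exp (- \<bar>L\<bar>)"
          unfolding H_def norm_mult nexp using bd[of z] zS e
          by (intro mult_mono) (auto simp: Siff)
        also have "\<dots> \<le> exp \<bar>L\<bar> * exp (- \<bar>L\<bar>)"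
        proof (rule mult_right_mono)
          show "\<bar>L\<bar> \<le> exp \<bar>L\<bar>" using exp_ge_add_one_self[of "\<bar>L\<bar>"] by linarith
        qed simp
        finally show ?thesis by (simp add: exp_minus_inverse)
      next
        case False
        then have "cmod (G z) \<le> 1" using cases b0 b1 by blast
        moreover have "\<epsilon> * ((Re z)\<^sup>2 - (Im z)\<^sup>2 - 1) \<le> 0"
        proof (rule mult_nonneg_nonpos)
          show "(Re z)\<^sup>2 - (Im z)\<^sup>2 - 1 \<le> 0" using x2 zero_le_power2[of "Im z"] by linarith
        qed (use \<epsilon> in simp)
        ultimately show ?thesis
          unfolding H_def norm_mult nexp by (intro mult_le_one) auto
      qed
    qed
    then have "cmod (G (complex_of_real \<theta>)) * exp (\<epsilon> * (\<theta>\<^sup>2 - 1)) \<le> 1"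
      unfolding H_def norm_mult nexp by simp
    then have "cmod (G (complex_of_real \<theta>)) \<le> exp (\<epsilon> * (1 - \<theta>\<^sup>2))"
    proof -
      have "cmod (G (complex_of_real \<theta>)) = cmod (G (complex_of_real \<theta>)) * exp (\<epsilon> * (\<theta>\<^sup>2 - 1)) * exp (\<epsilon> * (1 - \<theta>\<^sup>2))"
        by (simp add: mult.assoc flip: exp_add) (simp add: algebra_simps)
      also have "\<dots> \<le> 1 * exp (\<epsilon> * (1 - \<theta>\<^sup>2))"
        using \<open>cmod (G (complex_of_real \<theta>)) * exp (\<epsilon> * (\<theta>\<^sup>2 - 1)) \<le> 1\<close> by (intro mult_right_mono) auto
      finally show ?thesis by simp
    qed
    also have "\<dots> \<le> exp \<epsilon>" using \<epsilon> by (simp add: mult_le_cancel_left1)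
    finally show ?thesis .
  qed
  have "((\<lambda>\<epsilon>. exp \<epsilon>) \<longlongrightarrow> exp (0::real)) (at_right 0)" by (intro tendsto_intros)
  then have "cmod (G (complex_of_real \<theta>)) \<le> exp 0"
    by (rule tendsto_lowerbound) (auto simp: eventually_at_right_field le intro!: exI[of _ 1])
  then show ?thesis by simp
qed

text \<open>Finite exponential sums are entire and bounded on the strip, so
  \<open>three_lines\<close> applies at once; this is why singular value expansions are truncated
  before interpolating.\<close>

lemma exp_sum_interpolation:
  fixes c :: "'b \<Rightarrow> complex" and l :: "'b \<Rightarrow> real"
  assumes A: "finite A" and M: "M0 > 0" "M1 > 0" and \<theta>: "0 \<le> \<theta>" "\<theta> \<le> 1"
    and b0: "\<And>y. cmod (\<Sum>a\<in>A. c a * exp (complex_of_real (l a) * Complex 0 y)) \<le> M0"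
    and b1: "\<And>y. cmod (\<Sum>a\<in>A. c a * exp (complex_of_real (l a) * Complex 1 y)) \<le> M1"
  shows "cmod (\<Sum>a\<in>A. c a * complex_of_real (exp (l a * \<theta>))) \<le> M0 powr (1 - \<theta>) * M1 powr \<theta>"
proof -
  define F where "F z = (\<Sum>a\<in>A. c a * exp (complex_of_real (l a) * z))" for z
  \<comment> \<open>E z = M0^(z - 1) M1^(-z), which normalises the bounds on both boundary lines to
    1.\<close>
  define E where "E z = exp ((z - 1) * complex_of_real (ln M0) - z * complex_of_real (ln M1))" for z
  have nE: "cmod (E z) = exp ((Re z - 1) * ln M0 - Re z * ln M1)" for z by (simp add: E_def)
  define N where "N = (\<Sum>a\<in>A. cmod (c a) * exp \<bar>l a\<bar>)"
  have "cmod (F (complex_of_real \<theta>) * E (complex_of_real \<theta>)) \<le> 1"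
  proof (rule three_lines[where L = "N * exp (\<bar>ln M0\<bar> + \<bar>ln M1\<bar>)", OF _ _ _ _ \<theta>])
    show "(\<lambda>z. F z * E z) holomorphic_on UNIV"
      unfolding F_def E_def by (intro holomorphic_intros)
    fix z :: complex
    show "cmod (F z * E z) \<le> N * exp (\<bar>ln M0\<bar> + \<bar>ln M1\<bar>)" if z: "0 \<le> Re z" "Re z \<le> 1"
    proof -
      have "cmod (F z) \<le> N" unfolding F_def N_def using A z by (intro cmod_exp_sum_bound) auto
      moreover have "(Re z - 1) * ln M0 \<le> \<bar>ln M0\<bar>"
      proof -
        have "(Re z - 1) * ln M0 \<le> \<bar>Re z - 1\<bar> * \<bar>ln M0\<bar>" by (metis abs_ge_self abs_mult)
        also have "\<dots> \<le> 1 * \<bar>ln M0\<bar>" using z by (intro mult_right_mono) auto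
        finally show ?thesis by simp
      qed
      moreover have "- (Re z * ln M1) \<le> \<bar>ln M1\<bar>"
      proof -
        have "- (Re z * ln M1) \<le> \<bar>Re z\<bar> * \<bar>ln M1\<bar>" by (metis abs_ge_minus_self abs_mult)
        also have "\<dots> \<le> 1 * \<bar>ln M1\<bar>" using z by (intro mult_right_mono) auto
        finally show ?thesis by simp
      qed
      ultimately show ?thesis
        unfolding norm_mult nE by (intro mult_mono) (auto simp: N_def intro!: sum_nonneg)
    qed
    show "cmod (F z * E z) \<le> 1" if z: "Re z = 0"
    proof -
      have "cmod (F z) \<le> M0" unfolding F_def using b0[of "Im z"] z by (metis complex_surj)
      then have "cmod (F z) * inverse M0 \<le> 1" using M by (simp add: field_simps)
      then show ?thesis unfolding norm_mult nE using z M by (simp add: exp_minus)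
    qed
    show "cmod (F z * E z) \<le> 1" if z: "Re z = 1"
    proof -
      have "cmod (F z) \<le> M1" unfolding F_def using b1[of "Im z"] z by (metis complex_surj)
      then have "cmod (F z) * inverse M1 \<le> 1" using M by (simp add: field_simps)
      then show ?thesis unfolding norm_mult nE using z M by (simp add: exp_minus)
    qed
  qed
  then have "cmod (F (complex_of_real \<theta>)) * exp ((\<theta> - 1) * ln M0 - \<theta> * ln M1) \<le> 1"
    unfolding norm_mult nE by simp
  moreover have "exp ((\<theta> - 1) * ln M0 - \<theta> * ln M1) = inverse (M0 powr (1 - \<theta>) * M1 powr \<theta>)"
    using M by (simp add: powr_def algebra_simps flip: exp_minus exp_add)
  moreover have "0 < M0 powr (1 - \<theta>) * M1 powr \<theta>" using M by simp
  ultimately have "cmod (F (complex_of_real \<theta>)) \<le> M0 powr (1 - \<theta>) * M1 powr \<theta>"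
    by (simp only: inverse_eq_divide times_divide_eq_right mult_1_right pos_divide_le_eq mult_1_left)
  then show ?thesis by (simp add: F_def exp_of_real flip: of_real_mult)
qed

text \<open>Interpolation between the operator norm (\<open>p = \<infinity>\<close>) and the Hilbert-Schmidt norm (\<open>p = 2\<close>) of a
  block matrix, tested on the orthonormal family \<open>g\<close>; the blocks are given by their singular value
  expansions with singular values \<open>t\<close>.\<close>

lemma block_interpolation:
  fixes g :: "'k \<Rightarrow> 'n::finite \<Rightarrow> 'a::chilbert_space" and \<sigma> :: "'e \<Rightarrow> 'n \<times> 'n"
    and \<alpha> :: "'n \<Rightarrow> 'n \<Rightarrow> real" and d :: "'n \<Rightarrow> real" and s :: "'k \<Rightarrow> real" and t :: "'e \<Rightarrow> real"
  assumes K: "finite K" "K \<noteq> {}" and E: "finite E"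
    and g: "\<And>k l. k \<in> K \<Longrightarrow> l \<in> K \<Longrightarrow> (\<Sum>i\<in>UNIV. cinner (g k i) (g l i)) = (if k = l then 1 else 0)"
    and x: "\<And>i j. orthonormal_on {e \<in> E. \<sigma> e = (i, j)} x"
    and y: "\<And>i j. orthonormal_on {e \<in> E. \<sigma> e = (i, j)} y"
    and s: "\<And>k. k \<in> K \<Longrightarrow> s k > 0" and t: "\<And>e. e \<in> E \<Longrightarrow> t e > 0"
    and p: "p \<ge> 2" and p': "p' = p / (p - 1)"
    and \<alpha>: "\<And>i j. \<alpha> i j \<ge> 0" and d: "\<And>i. d i \<ge> 0"
    and tsum: "\<And>i j. (\<Sum>e | e \<in> E \<and> \<sigma> e = (i, j). t e powr p) \<le> (\<alpha> i j * sqrt (d i * d j)) powr p"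
    and C: "C > 0" "\<And>u. (\<And>i. u i \<ge> 0) \<Longrightarrow> (\<Sum>i\<in>UNIV. \<Sum>j\<in>UNIV. \<alpha> i j powr p' * (u i * u j)) \<le> C * (\<Sum>i\<in>UNIV. (u i)\<^sup>2)"
    and D: "D > 0" "(\<Sum>i\<in>UNIV. d i powr p) \<le> D"
  shows "cmod (\<Sum>k\<in>K. \<Sum>e\<in>E. complex_of_real (s k powr (p - 1) * t e)
      * (cinner (g k (fst (\<sigma> e))) (x e) * cinner (y e) (g k (snd (\<sigma> e)))))
    \<le> (C * (\<Sum>k\<in>K. s k powr p)) powr (1 - 2 / p) * sqrt ((\<Sum>k\<in>K. s k powr p) * (C * D)) powr (2 / p)"
proof -
  let ?c = "\<lambda>k i j. \<Sum>e | e \<in> E \<and> \<sigma> e = (i, j). cmod (cinner (x e) (g k i)) * cmod (cinner (y e) (g k j))"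
  define G where "G k e = cinner (g k (fst (\<sigma> e))) (x e) * cinner (y e) (g k (snd (\<sigma> e)))" for k e
  define X where "X = (\<Sum>k\<in>K. s k powr p)"
  have X: "X > 0" unfolding X_def using K s by (intro sum_pos) fastforce+
  define a where "a e = \<alpha> (fst (\<sigma> e)) (snd (\<sigma> e))" for e
  have p1: "p > 1" using p by simp
  have pp': "p' / p = p' - 1" "p' > 0" using p1 by (simp_all add: p' field_simps)
  have finE: "finite {e \<in> E. \<sigma> e = (i, j)}" for i j using E by simp
  \<comment> \<open>A block with \<alpha> = 0 has no singular values, as \<open>tsum\<close> would
    force them to vanish; so \<open>ln (a e)\<close> is meaningful below.\<close>
  have a: "a e > 0" if e: "e \<in> E" for e
  proof -
    have "t e powr p \<le> (\<Sum>e' | e' \<in> E \<and> \<sigma> e' = (fst (\<sigma> e), snd (\<sigma> e)). t e' powr p)"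
      using e E by (intro member_le_sum) auto
    also note tsum
    finally have "0 < (\<alpha> (fst (\<sigma> e)) (snd (\<sigma> e)) * sqrt (d (fst (\<sigma> e)) * d (snd (\<sigma> e)))) powr p"
      using t[OF e] by (smt (verit) powr_gt_zero)
    then have "\<alpha> (fst (\<sigma> e)) (snd (\<sigma> e)) \<noteq> 0" by auto
    then show ?thesis using \<alpha>[of "fst (\<sigma> e)" "snd (\<sigma> e)"] by (simp add: a_def)
  qed
  \<comment> \<open>The slopes make the coefficient s^p a^p' at z = 0 become s^(p - 1) t at z = 2/p,
    by p'/p = p' - 1. On Re z = 1 its modulus is s^(p/2) times a^(p'/2) (t/a)^(p/2).\<close>
  define \<kappa> where "\<kappa> k = - (p / 2) * ln (s k)" for k
  define \<mu> where "\<mu> e = - (p' / 2) * ln (a e) + (p / 2) * (ln (t e) - ln (a e))" for e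
  define c where "c = (\<lambda>(k, e). complex_of_real (s k powr p * a e powr p') * G k e)"
  define l where "l = (\<lambda>(k, e). \<kappa> k + \<mu> e)"
  \<comment> \<open>Only moduli matter at the operator norm end: Cauchy-Schwarz and Bessel inside a
    block leave the product of the norms of \<open>g k i\<close> and \<open>g k j\<close>, and the
    form of \<alpha>^p' acts on the unit vector made of these norms.\<close>
  have b0: "cmod (\<Sum>b\<in>K \<times> E. c b * exp (complex_of_real (l b) * Complex 0 \<eta>)) \<le> C * X" for \<eta>
  proof -
    have "cmod (\<Sum>b\<in>K \<times> E. c b * exp (complex_of_real (l b) * Complex 0 \<eta>)) \<le> (\<Sum>b\<in>K \<times> E. cmod (c b))"
      by (rule order_trans[OF norm_sum]) (simp add: norm_mult)
    also have "\<dots> = (\<Sum>k\<in>K. s k powr p * (\<Sum>e\<in>E. a e powr p' * cmod (G k e)))"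
      unfolding sum_distrib_left sum.cartesian_product
      by (intro sum.cong) (auto simp: c_def norm_mult)
    also have "\<dots> \<le> (\<Sum>k\<in>K. s k powr p * C)"
    proof (intro sum_mono mult_left_mono)
      fix k assume k: "k \<in> K"
      have "(\<Sum>e\<in>E. a e powr p' * cmod (G k e))
          = (\<Sum>i\<in>UNIV. \<Sum>j\<in>UNIV. \<Sum>e | e \<in> E \<and> \<sigma> e = (i, j). a e powr p' * cmod (G k e))"
        by (rule sum_matrix_positions[OF E])
      also have "\<dots> \<le> (\<Sum>i\<in>UNIV. \<Sum>j\<in>UNIV. \<alpha> i j powr p' * (norm (g k i) * norm (g k j)))"
      proof (intro sum_mono)
        fix i j
        have "(\<Sum>e | e \<in> E \<and> \<sigma> e = (i, j). a e powr p' * cmod (G k e))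
            = \<alpha> i j powr p' * ?c k i j"
          unfolding sum_distrib_left
          by (intro sum.cong) (auto simp: a_def G_def norm_mult norm_cinner_commute[of "g k _"])
        also have "\<dots> \<le> \<alpha> i j powr p' * (norm (g k i) * norm (g k j))"
        proof (rule mult_left_mono)
          have "(?c k i j)\<^sup>2
              \<le> (\<Sum>e | e \<in> E \<and> \<sigma> e = (i, j). (cmod (cinner (x e) (g k i)))\<^sup>2)
                * (\<Sum>e | e \<in> E \<and> \<sigma> e = (i, j). (cmod (cinner (y e) (g k j)))\<^sup>2)"
            by (rule Cauchy_Schwarz_ineq_sum)
          also have "\<dots> \<le> (norm (g k i))\<^sup>2 * (norm (g k j))\<^sup>2"
            by (intro mult_mono bessel x y finE sum_nonneg) auto
          finally have "(?c k i j)\<^sup>2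
              \<le> (norm (g k i) * norm (g k j))\<^sup>2" by (simp add: power_mult_distrib)
          then show "?c k i j
              \<le> norm (g k i) * norm (g k j)" by (rule power2_le_imp_le) simp
        qed simp
        finally show "(\<Sum>e | e \<in> E \<and> \<sigma> e = (i, j). a e powr p' * cmod (G k e))
            \<le> \<alpha> i j powr p' * (norm (g k i) * norm (g k j))" .
      qed
      also have "\<dots> \<le> C * (\<Sum>i\<in>UNIV. (norm (g k i))\<^sup>2)" by (rule C(2)) simp
      also have "(\<Sum>i\<in>UNIV. (norm (g k i))\<^sup>2) = 1"
      proof -
        have "complex_of_real (\<Sum>i\<in>UNIV. (norm (g k i))\<^sup>2) = 1"
          using g[OF k k] by (simp add: cinner_self)
        then show ?thesis using of_real_eq_1_iff by blast
      qed
      finally show "(\<Sum>e\<in>E. a e powr p' * cmod (G k e)) \<le> C" by simp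
    qed simp
    also have "\<dots> = C * X" by (simp add: X_def sum_distrib_left mult.commute)
    finally show ?thesis .
  qed
  \<comment> \<open>At the Hilbert-Schmidt end Cauchy-Schwarz over \<open>k\<close> separates the
    weights. By \<open>tsum\<close> the squares in block (i, j) sum to at most \<alpha>^p' (d
    i)^(p/2) (d j)^(p/2), so the same quadratic form is evaluated at the vector d^(p/2).\<close>
  have b1: "cmod (\<Sum>b\<in>K \<times> E. c b * exp (complex_of_real (l b) * Complex 1 \<eta>)) \<le> sqrt (X * (C * D))" for \<eta>
  proof -
    define r where "r e = complex_of_real (a e powr p') * exp (complex_of_real (\<mu> e) * Complex 1 \<eta>)" for e
    define A where "A k = (\<Sum>e\<in>E. r e * G k e)" for k
    have ex: "exp (complex_of_real (\<kappa> k + \<mu> e) * Complex 1 \<eta>)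
        = exp (complex_of_real (\<kappa> k) * Complex 1 \<eta>) * exp (complex_of_real (\<mu> e) * Complex 1 \<eta>)" for k e
      by (simp only: of_real_add distrib_right exp_add)
    have "(\<Sum>b\<in>K \<times> E. c b * exp (complex_of_real (l b) * Complex 1 \<eta>))
        = (\<Sum>k\<in>K. complex_of_real (s k powr p) * exp (complex_of_real (\<kappa> k) * Complex 1 \<eta>) * A k)"
      unfolding A_def sum_distrib_left sum.cartesian_product
    proof (rule sum.cong)
      fix b assume "b \<in> K \<times> E"
      then obtain k e where b: "b = (k, e)" by auto
      show "c b * exp (complex_of_real (l b) * Complex 1 \<eta>)
          = (case b of (k, e) \<Rightarrow> complex_of_real (s k powr p) * exp (complex_of_real (\<kappa> k) * Complex 1 \<eta>) * (r e * G k e))"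
        unfolding b c_def l_def prod.case ex r_def of_real_mult by (simp only: mult_ac)
    qed simp
    also have "cmod \<dots> \<le> (\<Sum>k\<in>K. s k powr (p / 2) * cmod (A k))"
    proof (rule order_trans[OF norm_sum], rule sum_mono)
      fix k assume k: "k \<in> K"
      have "s k powr p * exp (\<kappa> k) = s k powr (p / 2)"
        using s[OF k] by (simp add: \<kappa>_def powr_def flip: exp_add)
      then show "cmod (complex_of_real (s k powr p) * exp (complex_of_real (\<kappa> k) * Complex 1 \<eta>) * A k)
          \<le> s k powr (p / 2) * cmod (A k)" by (simp add: norm_mult)
    qed
    finally have "(cmod (\<Sum>b\<in>K \<times> E. c b * exp (complex_of_real (l b) * Complex 1 \<eta>)))\<^sup>2
        \<le> (\<Sum>k\<in>K. s k powr (p / 2) * cmod (A k))\<^sup>2" by (intro power_mono) auto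
    also have "\<dots> \<le> (\<Sum>k\<in>K. (s k powr (p / 2))\<^sup>2) * (\<Sum>k\<in>K. (cmod (A k))\<^sup>2)"
      by (rule Cauchy_Schwarz_ineq_sum)
    also have "(\<Sum>k\<in>K. (s k powr (p / 2))\<^sup>2) = X"
      by (simp add: X_def power2_eq_square flip: powr_add)
    also have "X * (\<Sum>k\<in>K. (cmod (A k))\<^sup>2) \<le> X * (C * D)"
    proof (rule mult_left_mono)
      have "(\<Sum>k\<in>K. (cmod (A k))\<^sup>2) \<le> (\<Sum>e\<in>E. (cmod (r e))\<^sup>2)"
        unfolding A_def G_def by (rule hilbert_schmidt_block_bound[OF K(1) E g x y])
      also have "\<dots> = (\<Sum>i\<in>UNIV. \<Sum>j\<in>UNIV. \<Sum>e | e \<in> E \<and> \<sigma> e = (i, j). (cmod (r e))\<^sup>2)"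
        by (rule sum_matrix_positions[OF E])
      also have "\<dots> \<le> (\<Sum>i\<in>UNIV. \<Sum>j\<in>UNIV. \<alpha> i j powr p' * (d i powr (p / 2) * d j powr (p / 2)))"
      proof (intro sum_mono)
        fix i j
        show "(\<Sum>e | e \<in> E \<and> \<sigma> e = (i, j). (cmod (r e))\<^sup>2) \<le> \<alpha> i j powr p' * (d i powr (p / 2) * d j powr (p / 2))"
        proof (cases "\<alpha> i j > 0")
          case False
          then have em: "{e \<in> E. \<sigma> e = (i, j)} = {}" using a by (force simp: a_def)
          show ?thesis unfolding em using d by simp
        next
          case True
          have "(\<Sum>e | e \<in> E \<and> \<sigma> e = (i, j). (cmod (r e))\<^sup>2)
              = (\<Sum>e | e \<in> E \<and> \<sigma> e = (i, j). \<alpha> i j powr p' * \<alpha> i j powr (- p) * t e powr p)"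
          proof (rule sum.cong)
            fix e assume e: "e \<in> {e \<in> E. \<sigma> e = (i, j)}"
            then have ae: "a e = \<alpha> i j" and te: "t e > 0" using t by (auto simp: a_def)
            have "cmod (r e) = \<alpha> i j powr p' * exp (\<mu> e)" by (simp add: r_def norm_mult ae)
            also have "\<dots> = exp ((p' / 2) * ln (\<alpha> i j) + (p / 2) * (ln (t e) - ln (\<alpha> i j)))"
              using True by (simp add: \<mu>_def ae powr_def flip: exp_add)
            finally have "(cmod (r e))\<^sup>2 = exp (2 * ((p' / 2) * ln (\<alpha> i j) + (p / 2) * (ln (t e) - ln (\<alpha> i j))))"
              by (simp only: exp_double)
            also have "\<dots> = \<alpha> i j powr p' * \<alpha> i j powr (- p) * t e powr p"
              using True te by (simp add: powr_def algebra_simps flip: exp_add)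
            finally show "(cmod (r e))\<^sup>2 = \<alpha> i j powr p' * \<alpha> i j powr (- p) * t e powr p" .
          qed simp
          also have "\<dots> = \<alpha> i j powr p' * \<alpha> i j powr (- p) * (\<Sum>e | e \<in> E \<and> \<sigma> e = (i, j). t e powr p)"
            by (simp add: sum_distrib_left)
          also have "\<dots> \<le> \<alpha> i j powr p' * \<alpha> i j powr (- p) * (\<alpha> i j * sqrt (d i * d j)) powr p"
            by (intro mult_left_mono tsum) auto
          also have "\<dots> = \<alpha> i j powr p' * (sqrt (d i * d j)) powr p"
            using True d by (simp add: powr_mult powr_minus field_simps)
          also have "sqrt (d i * d j) powr p = d i powr (p / 2) * d j powr (p / 2)"
            using d by (simp add: powr_half_sqrt[symmetric] powr_powr powr_mult)
          finally show ?thesis .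
        qed
      qed
      also have "\<dots> \<le> C * (\<Sum>i\<in>UNIV. (d i powr (p / 2))\<^sup>2)" by (rule C(2)) simp
      also have "\<dots> = C * (\<Sum>i\<in>UNIV. d i powr p)" by (simp add: power2_eq_square flip: powr_add)
      also have "\<dots> \<le> C * D" using C(1) D(2) by (intro mult_left_mono) auto
      finally show "(\<Sum>k\<in>K. (cmod (A k))\<^sup>2) \<le> C * D" .
    qed (use X in simp)
    finally show ?thesis by (rule real_le_rsqrt)
  qed
  have "cmod (\<Sum>b\<in>K \<times> E. c b * complex_of_real (exp (l b * (2 / p))))
      \<le> (C * X) powr (1 - 2 / p) * sqrt (X * (C * D)) powr (2 / p)"
    using K(1) E C(1) D(1) X p by (intro exp_sum_interpolation b0 b1) auto
  also have "(\<Sum>b\<in>K \<times> E. c b * complex_of_real (exp (l b * (2 / p))))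
      = (\<Sum>k\<in>K. \<Sum>e\<in>E. complex_of_real (s k powr (p - 1) * t e) * G k e)"
    unfolding sum.cartesian_product
  proof (rule sum.cong)
    fix b assume "b \<in> K \<times> E"
    then obtain k e where b: "b = (k, e)" "k \<in> K" "e \<in> E" by auto
    have "l b * (2 / p) = - ln (s k) - (p' / p) * ln (a e) + ln (t e) - ln (a e)"
      using p1 by (simp add: b l_def \<kappa>_def \<mu>_def field_simps)
    also have "\<dots> = - ln (s k) - p' * ln (a e) + ln (t e)"
      unfolding pp'(1) by (simp add: algebra_simps)
    finally have lb: "l b * (2 / p) = - ln (s k) - p' * ln (a e) + ln (t e)" .
    have "s k powr p * a e powr p' * exp (l b * (2 / p))
        = exp (p * ln (s k) + p' * ln (a e) + (- ln (s k) - p' * ln (a e) + ln (t e)))"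
      unfolding lb using s[OF b(2)] a[OF b(3)] by (simp only: powr_def exp_add) auto
    also have "p * ln (s k) + p' * ln (a e) + (- ln (s k) - p' * ln (a e) + ln (t e)) = (p - 1) * ln (s k) + ln (t e)"
      by (simp add: algebra_simps)
    also have "exp ((p - 1) * ln (s k) + ln (t e)) = s k powr (p - 1) * t e"
      using s[OF b(2)] t[OF b(3)] by (simp add: powr_def exp_add)
    finally have "s k powr p * a e powr p' * exp (l b * (2 / p)) = s k powr (p - 1) * t e" .
    then have "complex_of_real (s k powr p * a e powr p') * complex_of_real (exp (l b * (2 / p)))
        = complex_of_real (s k powr (p - 1) * t e)" by (simp only: flip: of_real_mult)
    then show "c b * complex_of_real (exp (l b * (2 / p)))
        = (case b of (k, e) \<Rightarrow> complex_of_real (s k powr (p - 1) * t e) * G k e)"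
      unfolding b(1) c_def prod.case by (metis mult.assoc mult.commute)
  qed simp
  finally show ?thesis by (simp add: G_def X_def)
qed

section \<open>Sums of positive operators\<close>

lemma cadjoint_compose:
  assumes S: "bounded_clinear S" and T: "bounded_clinear T"
  shows "cadjoint (S \<circ> T) = cadjoint T \<circ> cadjoint S"
  by (rule cadjoint_eqI) (simp add: cinner_cadjoint_right[OF T] cinner_cadjoint_right[OF S])

lemma cadjoint_positive:
  "positive_operator P \<Longrightarrow> cadjoint P = P"
  by (rule cadjoint_eqI) (rule positive_operator_selfadjoint)

lemma modulus_basis_eigen:
  assumes T: "compact_operator T" and B: "modulus_basis T B" and b: "b \<in> B"
  shows "cadjoint T (T b) = complex_of_real ((norm (T b))\<^sup>2) *\<^sub>C b"
proof -
  have "cadjoint T (T b) = op_abs T (op_abs T b)" using fun_cong[OF op_abs(2)[OF T], of b] by simp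
  then show ?thesis
    by (simp add: modulus_basisD(2)[OF B b] bounded_clinear_simps[OF positive_operator_bounded[OF op_abs(1)[OF T]]]
        power2_eq_square)
qed

lemma square_powr_half: "r \<ge> 0 \<Longrightarrow> (r\<^sup>2) powr (p / 2) = r powr (p::real)"
  by (cases "r = 0") (simp_all add: powr_powr flip: powr_numeral)

text \<open>Weyl's inequality in disguise: the squared singular values of \<open>R S\<^sup>*\<close> are the eigenvalues of
  \<open>S\<^sup>* S R\<^sup>* R\<close>.\<close>

lemma product_singular_values_le:
  assumes R: "compact_operator R" and S: "compact_operator S" and B: "modulus_basis (R \<circ> cadjoint S) B"
    and test: "\<And>(n::nat) e. orthonormal_on {..<n} e \<Longrightarrow>
      (\<Sum>k<n. cmod (cinner (cadjoint S (S (e k))) (cadjoint R (R (e k)))) powr (p / 2)) \<le> D"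
    and F: "finite F" "F \<subseteq> B"
  shows "(\<Sum>b\<in>F. norm (R (cadjoint S b)) powr p) \<le> D"
proof -
  note bR = compact_operator_bounded[OF R] and bS = compact_operator_bounded[OF S]
  note bR' = bounded_clinear_cadjoint[OF bR] and bS' = bounded_clinear_cadjoint[OF bS]
  note lR = bounded_clinear_simps[OF bR] and lS' = bounded_clinear_simps[OF bS']
  define G where "G = R \<circ> cadjoint S"
  have G: "compact_operator G" unfolding G_def by (rule compact_operator_compose_right[OF R bS'])
  have BG: "modulus_basis G B" using B by (simp add: G_def)
  have aG: "cadjoint G = S \<circ> cadjoint R"
    unfolding G_def cadjoint_compose[OF bR bS'] cadjoint_cadjoint[OF bS] ..
  define F' where "F' = {b \<in> F. G b \<noteq> 0}"
  have F': "finite F'" "F' \<subseteq> B" using F by (auto simp: F'_def)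
  define n where "n = card F'"
  obtain \<beta> where \<beta>: "bij_betw \<beta> {..<n} F'"
    using ex_bij_betw_nat_finite[OF F'(1)] by (auto simp: n_def atLeast0LessThan)
  have \<beta>F: "\<beta> k \<in> F'" "\<beta> k \<in> B" "G (\<beta> k) \<noteq> 0" if "k < n" for k
    using bij_betwE[OF \<beta>] that F'(2) by (auto simp: F'_def)
  define h where "h k = cadjoint S (\<beta> k)" for k
  \<comment> \<open>If b is an eigenvector of G* G, then S* b is an eigenvector of \<open>A\<close>
    for the same eigenvalue. This regrouping puts S* S next to R* R, the product that the hypothesis
    tests.\<close>
  define A where "A = cadjoint S \<circ> (S \<circ> (cadjoint R \<circ> R))"
  have bA: "bounded_clinear A" unfolding A_def by (intro bounded_clinear_compose bR bS bR' bS')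
  have eig: "A (h k) = complex_of_real ((norm (G (\<beta> k)))\<^sup>2) *\<^sub>C h k" if "k < n" for k
  proof -
    have "S (cadjoint R (R (cadjoint S (\<beta> k)))) = complex_of_real ((norm (G (\<beta> k)))\<^sup>2) *\<^sub>C \<beta> k"
      using modulus_basis_eigen[OF G BG \<beta>F(2)[OF that]] unfolding aG by (simp add: G_def)
    then show ?thesis by (simp add: A_def h_def lS')
  qed
  \<comment> \<open>The functional w -> <G (\<beta> k), R w> kills every earlier \<open>h l\<close>,
    because the vectors R (h l) = G (\<beta> l) are orthogonal to G (\<beta> k), but it does not
    kill \<open>h k\<close>.\<close>
  have indep: "h k \<notin> complex_vector.span (h ` {..<k})" if k: "k < n" for k
  proof
    have "complex_vector.span (h ` {..<k}) \<subseteq> {w. cinner (G (\<beta> k)) (R w) = 0}"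
    proof (rule complex_vector.span_minimal)
      show "complex_vector.subspace {w. cinner (G (\<beta> k)) (R w) = 0}"
        by (rule complex_vector.subspaceI) (auto simp: lR cinner_add_right)
      show "h ` {..<k} \<subseteq> {w. cinner (G (\<beta> k)) (R w) = 0}"
      proof
        fix w assume "w \<in> h ` {..<k}"
        then obtain l where l: "l < k" "w = h l" by auto
        then have "l < n" using k by simp
        have "\<beta> k \<noteq> \<beta> l" using inj_onD[OF bij_betw_imp_inj_on[OF \<beta>], of k l] l(1) k by auto
        then have "cinner (G (\<beta> k)) (G (\<beta> l)) = 0"
          using modulus_basis_cinner[OF G BG \<beta>F(2)[OF k] \<beta>F(2)[OF \<open>l < n\<close>]] by simp
        then show "w \<in> {w. cinner (G (\<beta> k)) (R w) = 0}" by (simp add: l(2) h_def G_def)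
      qed
    qed
    moreover assume "h k \<in> complex_vector.span (h ` {..<k})"
    ultimately have "cinner (G (\<beta> k)) (R (h k)) = 0" by blast
    then have "cinner (G (\<beta> k)) (G (\<beta> k)) = 0" by (simp add: h_def G_def)
    then show False using \<beta>F(3)[OF k] by (simp add: cinner_self)
  qed
  obtain e where e: "orthonormal_on {..<n} e" "\<And>k. k < n \<Longrightarrow> cinner (e k) (A (e k)) = complex_of_real ((norm (G (\<beta> k)))\<^sup>2)"
    using schur_diagonal[of A n h "\<lambda>k. complex_of_real ((norm (G (\<beta> k)))\<^sup>2)", OF bA eig indep] by blast
  have "(\<Sum>b\<in>F. norm (R (cadjoint S b)) powr p) = (\<Sum>b\<in>F'. norm (G b) powr p)"
    unfolding G_def comp_apply using F(1)
    by (intro sum.mono_neutral_right) (auto simp: F'_def G_def)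
  also have "\<dots> = (\<Sum>k<n. norm (G (\<beta> k)) powr p)"
    by (rule sum.reindex_bij_betw[OF \<beta>, symmetric])
  also have "\<dots> = (\<Sum>k<n. cmod (cinner (cadjoint S (S (e k))) (cadjoint R (R (e k)))) powr (p / 2))"
  proof (rule sum.cong)
    fix k assume "k \<in> {..<n}"
    then have k: "k < n" by simp
    have "cinner (cadjoint S (S (e k))) (cadjoint R (R (e k))) = cinner (e k) (A (e k))"
      by (simp add: A_def cinner_cadjoint_right[OF bS] cinner_cadjoint_left[OF bS])
    then show "norm (G (\<beta> k)) powr p = cmod (cinner (cadjoint S (S (e k))) (cadjoint R (R (e k)))) powr (p / 2)"
      by (simp add: e(2)[OF k] norm_power square_powr_half)
  qed simp
  also have "\<dots> \<le> D" by (rule test[OF e(1)])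
  finally show ?thesis .
qed

text \<open>\<open>X\<close> has total exponent 1 - 1/p on the right, so it can be divided out:
  X^(1/p) <= C^(1 - 1/p) D^(1/p). Logarithms make this linear.\<close>

lemma powr_self_bound:
  fixes X C D p :: real
  assumes pos: "X > 0" "C > 0" "D > 0" and p: "p \<ge> 2"
    and le: "X \<le> (C * X) powr (1 - 2 / p) * sqrt (X * (C * D)) powr (2 / p)"
  shows "X \<le> C powr (p - 1) * D"
proof -
  have p0: "p > 0" using p by simp
  have "sqrt (X * (C * D)) powr (2 / p) = (X * (C * D)) powr (1 / p)"
    using pos by (simp add: powr_powr flip: powr_half_sqrt)
  then have "ln X \<le> ln ((C * X) powr (1 - 2 / p) * (X * (C * D)) powr (1 / p))"
    using le pos by (simp add: ln_le_cancel_iff)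
  also have "\<dots> = (1 - 2 / p) * (ln C + ln X) + (1 / p) * (ln X + (ln C + ln D))"
    using pos by (simp add: ln_mult ln_powr)
  finally have "p * ln X \<le> p * ((1 - 2 / p) * (ln C + ln X) + (1 / p) * (ln X + (ln C + ln D)))"
    using p0 by (intro mult_left_mono) auto
  also have "\<dots> = (p - 2) * (ln C + ln X) + (ln X + (ln C + ln D))"
    using p0 by (simp add: field_simps)
  finally have "ln X \<le> (p - 1) * ln C + ln D" by (simp add: algebra_simps)
  also have "\<dots> = ln (C powr (p - 1) * D)" using pos by (simp add: ln_mult ln_powr)
  finally show ?thesis using pos by (simp add: ln_le_cancel_iff)
qed

lemma onb_finite_approx:
  assumes "\<And>i. onb (B i)" "finite K" "\<epsilon> > 0"
  shows "\<exists>F. finite F \<and> F \<subseteq> B i \<and> (\<forall>k\<in>K. dist (\<Sum>b\<in>F. cinner b (x k) *\<^sub>C b) (x k) < \<epsilon>)"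
proof -
  have "\<forall>k\<in>K. eventually (\<lambda>F. dist (\<Sum>b\<in>F. cinner b (x k) *\<^sub>C b) (x k) < \<epsilon>) (finite_subsets_at_top (B i))"
    using onb_has_sum[OF assms(1)] assms(3) unfolding has_sum_def by (intro ballI tendstoD)
  then have "eventually (\<lambda>F. \<forall>k\<in>K. dist (\<Sum>b\<in>F. cinner b (x k) *\<^sub>C b) (x k) < \<epsilon>) (finite_subsets_at_top (B i))"
    using assms(2) by (simp add: eventually_ball_finite_distrib)
  then obtain F where F: "finite F" "F \<subseteq> B i"
    "\<And>Y. finite Y \<and> F \<subseteq> Y \<and> Y \<subseteq> B i \<Longrightarrow> \<forall>k\<in>K. dist (\<Sum>b\<in>Y. cinner b (x k) *\<^sub>C b) (x k) < \<epsilon>"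
    unfolding eventually_finite_subsets_at_top by metis
  show ?thesis using F(3)[of F] F(1,2) by (intro exI[of _ F]) auto
qed

text \<open>With \<open>P j = R j\<^sup>* R j\<close> this bounds \<open>\<Sum>j. P j\<close>. On an eigenvector \<open>b\<close> of the sum, with
  eigenvalue \<open>s\<close>, the vectors \<open>R i b / \<surd>s\<close> form an eigenvector of the Gram block matrix
  \<open>R i R j\<^sup>*\<close>, to which interpolation applies.\<close>

lemma positive_sum_eigenvalues_le:
  fixes R :: "'n::finite \<Rightarrow> 'a::chilbert_space \<Rightarrow> 'a" and \<alpha> :: "'n \<Rightarrow> 'n \<Rightarrow> real" and d :: "'n \<Rightarrow> real"
  assumes R: "\<And>j. compact_operator (R j)"
    and p: "p \<ge> 2" and p': "p' = p / (p - 1)"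
    and \<alpha>: "\<And>i j. \<alpha> i j \<ge> 0" and d: "\<And>i. d i \<ge> 0"
    and test: "\<And>i j (n::nat) e. orthonormal_on {..<n} e \<Longrightarrow>
      (\<Sum>k<n. cmod (cinner (cadjoint (R j) (R j (e k))) (cadjoint (R i) (R i (e k)))) powr (p / 2))
        \<le> ((\<alpha> i j)\<^sup>2 * d i * d j) powr (p / 2)"
    and C: "C > 0" "\<And>u. (\<And>i. u i \<ge> 0) \<Longrightarrow> (\<Sum>i\<in>UNIV. \<Sum>j\<in>UNIV. \<alpha> i j powr p' * (u i * u j)) \<le> C * (\<Sum>i\<in>UNIV. (u i)\<^sup>2)"
    and D: "D > 0" "(\<Sum>i\<in>UNIV. d i powr p) \<le> D"
    and K: "finite K" "orthonormal_on K (\<lambda>b. b)"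
    and s: "\<And>b. b \<in> K \<Longrightarrow> s b > 0"
      "\<And>b. b \<in> K \<Longrightarrow> (\<Sum>j\<in>UNIV. cadjoint (R j) (R j b)) = complex_of_real (s b) *\<^sub>C b"
  shows "(\<Sum>b\<in>K. s b powr p) \<le> C powr (p - 1) * D"
proof (cases "K = {}")
  case True
  then show ?thesis using D by simp
next
  case False
  note bR = compact_operator_bounded[OF R]
  note bR' = bounded_clinear_cadjoint[OF bR]
  define X where "X = (\<Sum>b\<in>K. s b powr p)"
  have X: "X > 0" unfolding X_def using K(1) False s(1) by (intro sum_pos) fastforce+
  \<comment> \<open>Normalised so that \<open>g b\<close>, over the index i, is a unit vector of the
    direct sum: the squares |R i b|^2 add up to \<open>s b\<close>.\<close>
  define g where "g b i = complex_of_real (1 / sqrt (s b)) *\<^sub>C R i b" for b i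
  have gram: "(\<Sum>i\<in>UNIV. cinner (g b i) (g c i)) = (if b = c then 1 else 0)" if bc: "b \<in> K" "c \<in> K" for b c
  proof -
    have "(\<Sum>i\<in>UNIV. cinner (g b i) (g c i))
        = complex_of_real (1 / sqrt (s b) * (1 / sqrt (s c))) * (\<Sum>i\<in>UNIV. cinner b (cadjoint (R i) (R i c)))"
      by (simp add: g_def sum_divide_distrib cinner_cadjoint_right[OF bR] mult_ac)
    also have "(\<Sum>i\<in>UNIV. cinner b (cadjoint (R i) (R i c))) = complex_of_real (s c) * cinner b c"
      by (simp add: s(2)[OF bc(2)] flip: cinner.sum_right)
    finally show ?thesis
      using orthonormal_onD[OF K(2) bc] s(1)[OF bc(1)] s(1)[OF bc(2)] by (auto simp flip: of_real_mult)
  qed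
  define G where "G i j = R i \<circ> cadjoint (R j)" for i j
  have G: "compact_operator (G i j)" for i j
    unfolding G_def by (rule compact_operator_compose_right[OF R bR'])
  note lG = bounded_clinear_simps[OF compact_operator_bounded[OF G]]
  have "\<exists>B. modulus_basis (G i j) B" for i j by (rule modulus_basis_exists[OF G])
  then obtain B where B: "\<And>i j. modulus_basis (G i j) (B i j)" by metis
  define Bd where "Bd = (C * X) powr (1 - 2 / p) * sqrt (X * (C * D)) powr (2 / p)"
  \<comment> \<open>The bound for singular value expansions truncated to finite sets
    \<open>F i j\<close>. The weights s^(p - 1) turn the pairing into the sum of s^p once the
    truncation is removed.\<close>
  have main: "cmod (\<Sum>k\<in>K. complex_of_real (s k powr (p - 1)) * (\<Sum>i\<in>UNIV. \<Sum>j\<in>UNIV.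
      cinner (g k i) (G i j (\<Sum>b\<in>F i j. cinner b (g k j) *\<^sub>C b)))) \<le> Bd"
    if F: "\<And>i j. finite (F i j)" "\<And>i j. F i j \<subseteq> B i j" for F
  proof -
    \<comment> \<open>One index per block position and right singular vector with nonzero singular
      value; \<open>x\<close> holds the left singular vectors and \<open>snd\<close> the right
      ones.\<close>
    define E where "E = {((i, j), b). b \<in> F i j \<and> G i j b \<noteq> 0}"
    define t where "t = (\<lambda>((i, j), b). norm (G i j b))"
    define x where "x = (\<lambda>((i, j), b). complex_of_real (inverse (norm (G i j b))) *\<^sub>C G i j b)"
    define H where "H k e = cinner (g k (fst (fst e))) (x e) * cinner (snd e) (g k (snd (fst e)))" for k e
    have "E \<subseteq> (SIGMA ij:UNIV. F (fst ij) (snd ij))" by (auto simp: E_def)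
    then have E: "finite E" by (rule finite_subset) (auto intro: F(1))
    have Eij: "{e \<in> E. fst e = (i, j)} = Pair (i, j) ` {b \<in> F i j. G i j b \<noteq> 0}" for i j
      by (auto simp: E_def)
    have x: "orthonormal_on {e \<in> E. fst e = (i, j)} x" for i j
      unfolding orthonormal_on_def
    proof (intro ballI)
      fix e f assume "e \<in> {e \<in> E. fst e = (i, j)}" "f \<in> {e \<in> E. fst e = (i, j)}"
      then obtain b c where bc: "e = ((i, j), b)" "f = ((i, j), c)" "b \<in> B i j" "c \<in> B i j" "G i j b \<noteq> 0"
        unfolding Eij using F(2) by blast
      show "cinner (x e) (x f) = (if e = f then 1 else 0)"
        using modulus_basis_cinner[OF G B bc(3,4)] bc(5) by (auto simp: bc(1,2) x_def power2_eq_square field_simps)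
    qed
    have y: "orthonormal_on {e \<in> E. fst e = (i, j)} snd" for i j
      unfolding orthonormal_on_def
    proof (intro ballI)
      fix e f assume "e \<in> {e \<in> E. fst e = (i, j)}" "f \<in> {e \<in> E. fst e = (i, j)}"
      then obtain b c where bc: "e = ((i, j), b)" "f = ((i, j), c)" "b \<in> B i j" "c \<in> B i j"
        unfolding Eij using F(2) by blast
      show "cinner (snd e) (snd f) = (if e = f then 1 else 0)"
        using orthonormal_onD[OF onb_orthonormal[OF modulus_basisD(1)[OF B]] bc(3,4)] by (auto simp: bc(1,2))
    qed
    have t: "t e > 0" if "e \<in> E" for e using that by (auto simp: E_def t_def)
    have tsum: "(\<Sum>e | e \<in> E \<and> fst e = (i, j). t e powr p) \<le> (\<alpha> i j * sqrt (d i * d j)) powr p" for i j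
    proof -
      have "(\<Sum>e | e \<in> E \<and> fst e = (i, j). t e powr p) = (\<Sum>b | b \<in> F i j \<and> G i j b \<noteq> 0. norm (G i j b) powr p)"
        unfolding Eij by (subst sum.reindex) (auto simp: inj_on_def t_def)
      also have "\<dots> \<le> ((\<alpha> i j)\<^sup>2 * d i * d j) powr (p / 2)"
        unfolding G_def comp_apply
      proof (rule product_singular_values_le[OF R R])
        show "modulus_basis (R i \<circ> cadjoint (R j)) (B i j)" using B[of i j] by (simp add: G_def)
        show "finite {b. b \<in> F i j \<and> R i (cadjoint (R j) b) \<noteq> 0}" using F(1)[of i j] by simp
        show "{b. b \<in> F i j \<and> R i (cadjoint (R j) b) \<noteq> 0} \<subseteq> B i j" using F(2)[of i j] by blast
      qed (rule test)
      also have "(\<alpha> i j)\<^sup>2 * d i * d j = (\<alpha> i j * sqrt (d i * d j))\<^sup>2"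
        using d by (simp add: power_mult_distrib)
      also have "\<dots> powr (p / 2) = (\<alpha> i j * sqrt (d i * d j)) powr p"
        using \<alpha> d by (intro square_powr_half) simp
      finally show ?thesis .
    qed
    have "cmod (\<Sum>k\<in>K. \<Sum>e\<in>E. complex_of_real (s k powr (p - 1) * t e)
      * H k e) \<le> Bd"
      unfolding Bd_def X_def H_def
      by (rule block_interpolation[OF K(1) False E gram x y s(1) t p p' \<alpha> d tsum C D])
    also have "(\<Sum>k\<in>K. \<Sum>e\<in>E. complex_of_real (s k powr (p - 1) * t e)
        * H k e)
      = (\<Sum>k\<in>K. complex_of_real (s k powr (p - 1)) * (\<Sum>i\<in>UNIV. \<Sum>j\<in>UNIV.
          cinner (g k i) (G i j (\<Sum>b\<in>F i j. cinner b (g k j) *\<^sub>C b))))"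
    proof (rule sum.cong)
      fix k
      have "(\<Sum>e\<in>E. complex_of_real (s k powr (p - 1) * t e)
          * H k e)
        = complex_of_real (s k powr (p - 1)) * (\<Sum>e\<in>E. complex_of_real (t e)
          * H k e)"
        by (simp add: sum_distrib_left mult.assoc)
      also have "(\<Sum>e\<in>E. complex_of_real (t e) * H k e)
        = (\<Sum>i\<in>UNIV. \<Sum>j\<in>UNIV. \<Sum>e | e \<in> E \<and> fst e = (i, j).
            complex_of_real (t e) * H k e)"
        by (rule sum_matrix_positions[OF E])
      also have "\<dots> = (\<Sum>i\<in>UNIV. \<Sum>j\<in>UNIV. cinner (g k i) (G i j (\<Sum>b\<in>F i j. cinner b (g k j) *\<^sub>C b)))"
      proof (intro sum.cong refl)
        fix i j
        have "(\<Sum>e | e \<in> E \<and> fst e = (i, j).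
            complex_of_real (t e) * H k e)
          = (\<Sum>b | b \<in> F i j \<and> G i j b \<noteq> 0. cinner (g k i) (G i j b) * cinner b (g k j))"
          unfolding Eij by (subst sum.reindex) (auto simp: inj_on_def t_def x_def H_def intro!: sum.cong)
        also have "\<dots> = (\<Sum>b\<in>F i j. cinner (g k i) (G i j b) * cinner b (g k j))"
          using F(1) by (intro sum.mono_neutral_left) auto
        also have "\<dots> = cinner (g k i) (G i j (\<Sum>b\<in>F i j. cinner b (g k j) *\<^sub>C b))"
          by (simp add: lG cinner.sum_right mult.commute)
        finally show "(\<Sum>e | e \<in> E \<and> fst e = (i, j).
            complex_of_real (t e) * H k e)
          = cinner (g k i) (G i j (\<Sum>b\<in>F i j. cinner b (g k j) *\<^sub>C b))" .
      qed
      finally show "(\<Sum>e\<in>E. complex_of_real (s k powr (p - 1) * t e)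
          * H k e)
        = complex_of_real (s k powr (p - 1)) * (\<Sum>i\<in>UNIV. \<Sum>j\<in>UNIV.
          cinner (g k i) (G i j (\<Sum>b\<in>F i j. cinner b (g k j) *\<^sub>C b)))" .
    qed simp
    finally show ?thesis .
  qed
  have ex: "\<exists>F. finite F \<and> F \<subseteq> B i j \<and> (\<forall>k\<in>K. dist (\<Sum>b\<in>F. cinner b (g k j) *\<^sub>C b) (g k j) < 1 / real (Suc m))" for i j m
    by (rule onb_finite_approx[of "\<lambda>i. B i j" K "1 / real (Suc m)" i "\<lambda>k. g k j"])
      (use K(1) modulus_basisD(1)[OF B] in auto)
  \<comment> \<open>One choice of finite sets per accuracy 1/(m + 1), common to all
    \<open>k\<close>, so that the bound in \<open>main\<close> passes to the limit m ->
    infinity.\<close>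
  define F where "F m i j = (SOME F. finite F \<and> F \<subseteq> B i j
      \<and> (\<forall>k\<in>K. dist (\<Sum>b\<in>F. cinner b (g k j) *\<^sub>C b) (g k j) < 1 / real (Suc m)))" for m i j
  have "finite (F m i j) \<and> F m i j \<subseteq> B i j
      \<and> (\<forall>k\<in>K. dist (\<Sum>b\<in>F m i j. cinner b (g k j) *\<^sub>C b) (g k j) < 1 / real (Suc m))" for m i j
    unfolding F_def by (rule someI_ex[OF ex])
  then have F: "\<And>m i j. finite (F m i j)" "\<And>m i j. F m i j \<subseteq> B i j"
      "\<And>m i j k. k \<in> K \<Longrightarrow> dist (\<Sum>b\<in>F m i j. cinner b (g k j) *\<^sub>C b) (g k j) < 1 / real (Suc m)"
    by simp_all
  have lim: "(\<lambda>m. \<Sum>b\<in>F m i j. cinner b (g k j) *\<^sub>C b) \<longlonglongrightarrow> g k j" if k: "k \<in> K" for i j k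
  proof (rule metric_LIMSEQ_I)
    fix \<epsilon> :: real assume "\<epsilon> > 0"
    then obtain N where N: "1 / real (Suc N) < \<epsilon>" using nat_approx_posE by blast
    show "\<exists>N. \<forall>m\<ge>N. dist (\<Sum>b\<in>F m i j. cinner b (g k j) *\<^sub>C b) (g k j) < \<epsilon>"
    proof (intro exI[of _ N] allI impI)
      fix m assume "N \<le> m"
      then have "1 / real (Suc m) \<le> 1 / real (Suc N)" by (intro divide_left_mono) auto
      then show "dist (\<Sum>b\<in>F m i j. cinner b (g k j) *\<^sub>C b) (g k j) < \<epsilon>"
        using F(3)[OF k, where m = m and i = i and j = j] N by linarith
    qed
  qed
  have "(\<lambda>m. cmod (\<Sum>k\<in>K. complex_of_real (s k powr (p - 1)) * (\<Sum>i\<in>UNIV. \<Sum>j\<in>UNIV.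
      cinner (g k i) (G i j (\<Sum>b\<in>F m i j. cinner b (g k j) *\<^sub>C b)))))
    \<longlonglongrightarrow> cmod (\<Sum>k\<in>K. complex_of_real (s k powr (p - 1)) * (\<Sum>i\<in>UNIV. \<Sum>j\<in>UNIV. cinner (g k i) (G i j (g k j))))"
    by (intro tendsto_norm tendsto_sum tendsto_mult tendsto_const cinner.tendsto
        bounded_linear.tendsto[OF bounded_clinear_linear[OF compact_operator_bounded[OF G]]] lim)
  then have "cmod (\<Sum>k\<in>K. complex_of_real (s k powr (p - 1)) * (\<Sum>i\<in>UNIV. \<Sum>j\<in>UNIV. cinner (g k i) (G i j (g k j)))) \<le> Bd"
    by (rule LIMSEQ_le_const2) (use main[OF F(1,2)] in auto)
  \<comment> \<open>The Gram block matrix multiplies \<open>g k\<close> by \<open>s k\<close>,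
    because \<open>k\<close> is an eigenvector of the sum of the R j* R j; its form at the unit
    vector \<open>g k\<close> is therefore \<open>s k\<close>.\<close>
  moreover have "(\<Sum>i\<in>UNIV. \<Sum>j\<in>UNIV. cinner (g k i) (G i j (g k j))) = complex_of_real (s k)" if k: "k \<in> K" for k
  proof -
    have "(\<Sum>j\<in>UNIV. cadjoint (R j) (g k j)) = complex_of_real (1 / sqrt (s k)) *\<^sub>C (\<Sum>j\<in>UNIV. cadjoint (R j) (R j k))"
      by (simp only: g_def bounded_clinear_simps(3)[OF bR'] complex_vector.scale_sum_right)
    also have "\<dots> = complex_of_real (1 / sqrt (s k) * s k) *\<^sub>C k" by (simp only: s(2)[OF k] scaleC_scaleC of_real_mult)
    also have "1 / sqrt (s k) * s k = sqrt (s k)" using s(1)[OF k] by (simp add: real_div_sqrt)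
    finally have sum: "(\<Sum>j\<in>UNIV. cadjoint (R j) (g k j)) = complex_of_real (sqrt (s k)) *\<^sub>C k" .
    have "(\<Sum>i\<in>UNIV. \<Sum>j\<in>UNIV. cinner (g k i) (G i j (g k j)))
        = (\<Sum>i\<in>UNIV. cinner (g k i) (R i (\<Sum>j\<in>UNIV. cadjoint (R j) (g k j))))"
      by (simp add: G_def cinner.sum_right bounded_clinear_simps[OF bR])
    also have "\<dots> = (\<Sum>i\<in>UNIV. complex_of_real (s k) * cinner (g k i) (g k i))"
    proof (intro sum.cong refl)
      fix i
      have "R i k = complex_of_real (sqrt (s k)) *\<^sub>C g k i" using s(1)[OF k] by (simp add: g_def)
      then have "R i (complex_of_real (sqrt (s k)) *\<^sub>C k) = complex_of_real (sqrt (s k) * sqrt (s k)) *\<^sub>C g k i"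
        by (simp only: bounded_clinear_simps(3)[OF bR] scaleC_scaleC of_real_mult)
      then show "cinner (g k i) (R i (\<Sum>j\<in>UNIV. cadjoint (R j) (g k j))) = complex_of_real (s k) * cinner (g k i) (g k i)"
        using s(1)[OF k] by (simp add: sum)
    qed
    also have "\<dots> = complex_of_real (s k)" using gram[OF k k] by (simp flip: sum_distrib_left)
    finally show ?thesis .
  qed
  ultimately have "cmod (\<Sum>k\<in>K. complex_of_real (s k powr (p - 1)) * complex_of_real (s k)) \<le> Bd" by simp
  moreover have "(\<Sum>k\<in>K. complex_of_real (s k powr (p - 1)) * complex_of_real (s k)) = complex_of_real X"
  proof -
    have "s k powr (p - 1) * s k = s k powr p" if "k \<in> K" for k
      using s(1)[OF that] powr_add[of "s k" "p - 1" 1] by simp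
    then show ?thesis by (simp add: X_def flip: of_real_mult)
  qed
  ultimately have "X \<le> Bd" using X by simp
  then show ?thesis unfolding X_def[symmetric] Bd_def by (rule powr_self_bound[OF X C(1) D(1) p])
qed

text \<open>The quadratic form of \<open>S\<close>, the sum of the R j* R j, is the sum of the |R j
  x|^2, so \<open>bessel_family_test\<close> carries the bound from eigenvectors over to arbitrary
  Bessel families.\<close>

lemma positive_sum_test:
  fixes R :: "'n::finite \<Rightarrow> 'a::chilbert_space \<Rightarrow> 'a" and \<alpha> :: "'n \<Rightarrow> 'n \<Rightarrow> real" and d :: "'n \<Rightarrow> real"
  assumes R: "\<And>j. compact_operator (R j)"
    and p: "p \<ge> 2" and p': "p' = p / (p - 1)"
    and \<alpha>: "\<And>i j. \<alpha> i j \<ge> 0" and d: "\<And>i. d i \<ge> 0"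
    and test: "\<And>i j (n::nat) e. orthonormal_on {..<n} e \<Longrightarrow>
      (\<Sum>k<n. cmod (cinner (cadjoint (R j) (R j (e k))) (cadjoint (R i) (R i (e k)))) powr (p / 2))
        \<le> ((\<alpha> i j)\<^sup>2 * d i * d j) powr (p / 2)"
    and C: "C > 0" "\<And>u. (\<And>i. u i \<ge> 0) \<Longrightarrow> (\<Sum>i\<in>UNIV. \<Sum>j\<in>UNIV. \<alpha> i j powr p' * (u i * u j)) \<le> C * (\<Sum>i\<in>UNIV. (u i)\<^sup>2)"
    and D: "D > 0" "(\<Sum>i\<in>UNIV. d i powr p) \<le> D"
    and x: "bessel_family I x"
  shows "(\<Sum>k\<in>I. (\<Sum>j\<in>UNIV. (norm (R j (x k)))\<^sup>2) powr p) \<le> C powr (p - 1) * D"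
proof -
  note bR = compact_operator_bounded[OF R]
  define S where "S x = (\<Sum>j\<in>UNIV. (cadjoint (R j) \<circ> R j) x)" for x
  have S: "compact_operator S"
    unfolding S_def by (intro compact_operator_sum compact_operator_compose_left R bounded_clinear_cadjoint bR) simp
  have Sq: "cinner x (S x) = complex_of_real (\<Sum>j\<in>UNIV. (norm (R j x))\<^sup>2)" for x
    by (simp add: S_def cinner.sum_right cinner_cadjoint_right[OF bR] cinner_self)
  have pos: "positive_operator S"
  proof (rule positive_operatorI[OF compact_operator_bounded[OF S]])
    show "\<exists>r\<ge>0. cinner x (S x) = complex_of_real r" for x
      unfolding Sq by (intro exI[of _ "\<Sum>j\<in>UNIV. (norm (R j x))\<^sup>2"] conjI sum_nonneg) auto
  qed
  obtain B where B: "modulus_basis S B" using modulus_basis_exists[OF S] by blast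
  have Sb: "S b = complex_of_real (norm (S b)) *\<^sub>C b" if "b \<in> B" for b
    using modulus_basis_eigen[OF S B that] unfolding cadjoint_positive[OF pos]
    by (intro positive_sqrt_eigen[OF pos]) simp_all
  have "(\<Sum>k\<in>I. cmod (cinner (x k) (S (x k))) powr p) \<le> C powr (p - 1) * D"
  proof (rule bessel_family_test[OF S B _ _ x x])
    fix F assume F: "finite F" "F \<subseteq> B"
    define K where "K = {b \<in> F. norm (S b) > 0}"
    have K: "finite K" "K \<subseteq> B" using F by (auto simp: K_def)
    have "(\<Sum>b\<in>F. norm (S b) powr p) = (\<Sum>b\<in>K. norm (S b) powr p)"
      using F(1) by (intro sum.mono_neutral_right) (auto simp: K_def)
    also have "\<dots> \<le> C powr (p - 1) * D"
    proof (rule positive_sum_eigenvalues_le[OF R p p' \<alpha> d test C D K(1)])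
      show "orthonormal_on K (\<lambda>b. b)" by (rule onb_orthonormal_subset[OF modulus_basisD(1)[OF B] K(2)])
      show "norm (S b) > 0" if "b \<in> K" for b using that by (simp add: K_def)
      show "(\<Sum>j\<in>UNIV. cadjoint (R j) (R j b)) = complex_of_real (norm (S b)) *\<^sub>C b" if "b \<in> K" for b
        using Sb[of b] K(2) that by (auto simp: S_def)
    qed
    finally show "(\<Sum>b\<in>F. norm (S b) powr p) \<le> C powr (p - 1) * D" .
  qed (use p in simp)
  moreover have "cmod (cinner (x k) (S (x k))) = (\<Sum>j\<in>UNIV. (norm (R j (x k)))\<^sup>2)" for k
    unfolding Sq norm_of_real by (intro abs_of_nonneg sum_nonneg) simp
  ultimately show ?thesis by simp
qed

section \<open>Almost orthogonality in Schatten classes\<close>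

text \<open>\<open>R\<close> is the square root of the modulus. The identity T* U = |T| follows by
  taking adjoints in U* U |T| = |T|; it expresses moduli through T* and a contraction, so that the
  hypotheses on products of the operators can be applied to products of moduli.\<close>

lemma polar_factorization:
  assumes T: "compact_operator T"
  obtains U R where "bounded_clinear U" "\<And>x. norm (U x) \<le> norm x" "compact_operator R" "cadjoint R = R"
    "\<And>x. T x = U (R (R x))" "\<And>x. cadjoint T (U x) = R (R x)" "\<And>x. cadjoint T x = R (R (cadjoint U x))"
    "\<And>x. norm (R (R x)) = norm (T x)"
proof -
  note P = op_abs[OF T]
  obtain U where U: "bounded_clinear U" "\<And>x. norm (U x) \<le> norm x" "\<And>x. T x = U (op_abs T x)"
      "\<And>x. cadjoint U (U (op_abs T x)) = op_abs T x"
    using polar_decomposition[OF T] by blast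
  obtain R where R: "positive_operator R" "R \<circ> R = op_abs T"
    using compact_positive_sqrt[OF P(1,3)] by blast
  have cR: "compact_operator R" using compact_sqrt[OF R(1)] R(2) P(3) by simp
  have RR: "R (R x) = op_abs T x" for x using R(2) by (metis comp_apply)
  have "T = U \<circ> op_abs T" by (rule ext) (simp add: U(3))
  then have "cadjoint T = cadjoint (U \<circ> op_abs T)" by (rule arg_cong)
  then have aT: "cadjoint T = op_abs T \<circ> cadjoint U"
    unfolding cadjoint_compose[OF U(1) positive_operator_bounded[OF P(1)]] cadjoint_positive[OF P(1)] .
  have "cadjoint T (U x) = op_abs T x" for x
  proof (rule cinner_eqI)
    fix z
    have "cinner z (cadjoint T (U x)) = cinner (op_abs T z) (cadjoint U (U x))"
      unfolding aT comp_apply by (rule positive_operator_selfadjoint[OF P(1), symmetric])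
    also have "\<dots> = cinner (cadjoint U (U (op_abs T z))) x"
      by (simp add: cinner_cadjoint_right[OF U(1)] cinner_cadjoint_left[OF U(1)])
    also have "\<dots> = cinner z (op_abs T x)"
      unfolding U(4) by (rule positive_operator_selfadjoint[OF P(1)])
    finally show "cinner z (cadjoint T (U x)) = cinner z (op_abs T x)" .
  qed
  then show ?thesis
    using that[of U R] U cR cadjoint_positive[OF R(1)] by (simp add: RR aT norm_op_abs[OF T])
qed

section \<open>Schatten class bounds for adjoints and products\<close>

lemma schatten_class_compact: "T \<in> schatten_class q \<Longrightarrow> compact_operator T"
  by (simp add: schatten_class_def)

text \<open>For the adjoint, T* = |T| U*, the contraction U* maps Bessel families to Bessel
  families, and |T| has the same norms as \<open>T\<close>.\<close>

lemma schatten_class_bessel_norm: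
  assumes T: "T \<in> schatten_class p" and p: "p \<ge> 2" and x: "bessel_family I x"
  shows "(\<Sum>i\<in>I. norm (T (x i)) powr p) \<le> schatten_norm p T powr p"
    and "(\<Sum>i\<in>I. norm (cadjoint T (x i)) powr p) \<le> schatten_norm p T powr p"
proof -
  note cT = schatten_class_compact[OF T]
  obtain B where B: "modulus_basis T B" using modulus_basis_exists[OF cT] by blast
  have p0: "p > 0" using p by simp
  have *: "(\<Sum>i\<in>I. norm (T (z i)) powr p) \<le> schatten_norm p T powr p" if "bessel_family I z" for z
    by (rule bessel_family_norm_sum[OF cT B p schatten_class_sum_le[OF T B p0] that])
  show "(\<Sum>i\<in>I. norm (T (x i)) powr p) \<le> schatten_norm p T powr p" by (rule *[OF x])
  obtain U R where U: "bounded_clinear U" "\<And>x. norm (U x) \<le> norm x"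
    and aT: "\<And>x. cadjoint T x = R (R (cadjoint U x))" and nR: "\<And>x. norm (R (R x)) = norm (T x)"
    using polar_factorization[OF cT] by metis
  have "norm (cadjoint U v) \<le> norm v" for v using cadjoint_bound(2)[OF U(1), of 1 v] U(2) by simp
  then have "bessel_family I (\<lambda>i. cadjoint U (x i))"
    by (rule bessel_family_image[OF x bounded_clinear_cadjoint[OF U(1)]])
  from *[OF this] show "(\<Sum>i\<in>I. norm (cadjoint T (x i)) powr p) \<le> schatten_norm p T powr p"
    by (simp add: aT nR)
qed

lemma orthonormal_normalized_images:
  assumes T: "compact_operator T" and B: "modulus_basis T B" and F: "F \<subseteq> B" "\<And>b. b \<in> F \<Longrightarrow> T b \<noteq> 0"
  shows "orthonormal_on F (\<lambda>b. complex_of_real (inverse (norm (T b))) *\<^sub>C T b)"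
  unfolding orthonormal_on_def
proof (intro ballI)
  fix b c assume bc: "b \<in> F" "c \<in> F"
  then have "b \<in> B" "c \<in> B" using F(1) by auto
  then show "cinner (complex_of_real (inverse (norm (T b))) *\<^sub>C T b) (complex_of_real (inverse (norm (T c))) *\<^sub>C T c)
      = (if b = c then 1 else 0)"
    using modulus_basis_cinner[OF T B, of b c] F(2)[OF bc(1)] by (auto simp: power2_eq_square field_simps)
qed

lemma cinner_normalized: "cinner (complex_of_real (inverse (norm x)) *\<^sub>C x) x = complex_of_real (norm (x::'a::chilbert_space))"
  by (cases "x = 0") (simp_all add: cinner_self power2_eq_square)

lemma sum_sqrt_product_le:
  fixes f g :: "'i \<Rightarrow> real"
  assumes "\<And>i. i \<in> I \<Longrightarrow> h i \<le> sqrt (f i) * sqrt (g i)" "\<And>i. i \<in> I \<Longrightarrow> f i \<ge> 0" "\<And>i. i \<in> I \<Longrightarrow> g i \<ge> 0"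
  shows "(\<Sum>i\<in>I. h i) \<le> sqrt (\<Sum>i\<in>I. f i) * sqrt (\<Sum>i\<in>I. g i)"
proof -
  have "(\<Sum>i\<in>I. h i) \<le> (\<Sum>i\<in>I. sqrt (f i) * sqrt (g i))" by (intro sum_mono assms(1))
  also have "\<dots> \<le> sqrt ((\<Sum>i\<in>I. (sqrt (f i))\<^sup>2) * (\<Sum>i\<in>I. (sqrt (g i))\<^sup>2))"
    by (rule real_le_rsqrt) (rule Cauchy_Schwarz_ineq_sum)
  also have "\<dots> = sqrt (\<Sum>i\<in>I. f i) * sqrt (\<Sum>i\<in>I. g i)"
    using assms(2,3) by (simp add: real_sqrt_mult)
  finally show ?thesis .
qed

text \<open>A Hoelder estimate that serves for membership: \<open>schatten_norm\<close> is 0 for an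
  operator outside the class, so the assumed norm bounds on products become meaningful only through
  it. On a singular basis |Z b| = <S* (u b), T b>, and Cauchy-Schwarz splits the sum.\<close>

lemma schatten_class_product:
  fixes S T :: "'a::chilbert_space \<Rightarrow> 'a"
  assumes S: "compact_operator S" and T: "compact_operator T" and p: "p \<ge> 2"
    and bS: "\<And>I x. bessel_family I (x :: 'a \<Rightarrow> 'a) \<Longrightarrow> (\<Sum>i\<in>I. norm (cadjoint S (x i)) powr p) \<le> D1"
    and bT: "\<And>I x. bessel_family I (x :: 'a \<Rightarrow> 'a) \<Longrightarrow> (\<Sum>i\<in>I. norm (T (x i)) powr p) \<le> D2"
  shows "S \<circ> T \<in> schatten_class (p / 2)"
proof -
  define Z where "Z = S \<circ> T"
  have Z: "compact_operator Z"
    unfolding Z_def by (rule compact_operator_compose_right[OF S compact_operator_bounded[OF T]])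
  obtain B where B: "modulus_basis Z B" using modulus_basis_exists[OF Z] by blast
  have "(\<Sum>b\<in>F. norm (Z b) powr (p / 2)) \<le> sqrt D1 * sqrt D2" if F: "finite F" "F \<subseteq> B" for F
  proof -
    define F' where "F' = {b \<in> F. Z b \<noteq> 0}"
    have F': "finite F'" "F' \<subseteq> B" using F by (auto simp: F'_def)
    define u where "u b = complex_of_real (inverse (norm (Z b))) *\<^sub>C Z b" for b
    have "orthonormal_on F' u"
      unfolding u_def by (rule orthonormal_normalized_images[OF Z B F'(2)]) (simp add: F'_def)
    then have bu: "bessel_family F' u" by (rule bessel_family_orthonormal[OF _ F'(1)])
    have bb: "bessel_family F' (\<lambda>b. b)"
      by (rule bessel_family_orthonormal[OF onb_orthonormal_subset[OF modulus_basisD(1)[OF B] F'(2)] F'(1)])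
    have "(\<Sum>b\<in>F. norm (Z b) powr (p / 2)) = (\<Sum>b\<in>F'. norm (Z b) powr (p / 2))"
      using F(1) by (intro sum.mono_neutral_right) (auto simp: F'_def)
    also have "\<dots> \<le> sqrt (\<Sum>b\<in>F'. norm (cadjoint S (u b)) powr p) * sqrt (\<Sum>b\<in>F'. norm (T b) powr p)"
    proof (rule sum_sqrt_product_le)
      fix b
      have "norm (Z b) = cmod (cinner (u b) (Z b))" unfolding u_def cinner_normalized by simp
      also have "cinner (u b) (Z b) = cinner (cadjoint S (u b)) (T b)"
        by (simp add: Z_def cinner_cadjoint_left[OF compact_operator_bounded[OF S]])
      also have "cmod \<dots> \<le> norm (cadjoint S (u b)) * norm (T b)" by (rule norm_cinner_le)
      finally have "norm (Z b) powr (p / 2) \<le> (norm (cadjoint S (u b)) * norm (T b)) powr (p / 2)"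
        using p by (intro powr_mono2) auto
      then show "norm (Z b) powr (p / 2) \<le> sqrt (norm (cadjoint S (u b)) powr p) * sqrt (norm (T b) powr p)"
        by (simp add: powr_mult powr_powr flip: powr_half_sqrt)
    qed auto
    also have "\<dots> \<le> sqrt D1 * sqrt D2"
    proof (intro mult_mono real_sqrt_le_mono bS[OF bu] bT[OF bb])
      have "0 \<le> (\<Sum>b\<in>F'. norm (cadjoint S (u b)) powr p)" by (intro sum_nonneg) simp
      also have "\<dots> \<le> D1" by (rule bS[OF bu])
      finally show "0 \<le> sqrt D1" by simp
    qed (simp add: sum_nonneg)
    finally show ?thesis .
  qed
  then show ?thesis
    using schatten_classI(1)[OF Z B, of "p / 2" "sqrt D1 * sqrt D2"] p by (simp add: Z_def)
qed

lemma schatten_class_bessel_test: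
  assumes Z: "Z \<in> schatten_class q" and q: "q \<ge> 1" and x: "bessel_family I x" and y: "bessel_family I y"
    and D: "schatten_norm q Z \<le> D"
  shows "(\<Sum>i\<in>I. cmod (cinner (x i) (Z (y i))) powr q) \<le> D powr q"
proof -
  note cZ = schatten_class_compact[OF Z]
  obtain B where B: "modulus_basis Z B" using modulus_basis_exists[OF cZ] by blast
  have q0: "q > 0" using q by simp
  have "(\<Sum>i\<in>I. cmod (cinner (x i) (Z (y i))) powr q) \<le> schatten_norm q Z powr q"
    by (rule bessel_family_test[OF cZ B q schatten_class_sum_le[OF Z B q0] x y])
  also have "\<dots> \<le> D powr q"
    using D q by (intro powr_mono2) (auto simp: schatten_norm_def)
  finally show ?thesis .
qed

section \<open>The quadratic form of the coefficient matrix\<close>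

lemma matrix_l2_norm_bounded_linear:
  "bounded_linear (\<lambda>v :: complex ^ 'n::finite. (\<chi> i j. complex_of_real (a i j)) *v v)"
  by (intro linear_conv_bounded_linear[THEN iffD1] linearI)
    (simp_all add: vec_eq_iff matrix_vector_mult_def distrib_left sum.distrib scaleR_sum_right)

lemma matrix_l2_norm_nonneg: "0 \<le> matrix_l2_norm a"
  unfolding matrix_l2_norm_def by (rule onorm_pos_le[OF matrix_l2_norm_bounded_linear])

lemma matrix_l2_norm_quadratic:
  fixes a :: "'n::finite \<Rightarrow> 'n \<Rightarrow> real"
  shows "(\<Sum>i\<in>UNIV. \<Sum>j\<in>UNIV. a i j * (u i * u j)) \<le> matrix_l2_norm a * (\<Sum>i\<in>UNIV. (u i)\<^sup>2)"
proof -
  define A :: "complex ^ 'n ^ 'n" where "A = (\<chi> i j. complex_of_real (a i j))"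
  define v :: "complex ^ 'n" where "v = (\<chi> i. complex_of_real (u i))"
  have Av: "(A *v v) $ i = complex_of_real (\<Sum>j\<in>UNIV. a i j * u j)" for i
    by (simp add: A_def v_def matrix_vector_mult_def)
  have "(\<Sum>i\<in>UNIV. \<Sum>j\<in>UNIV. a i j * (u i * u j)) = (\<Sum>i\<in>UNIV. u i * (\<Sum>j\<in>UNIV. a i j * u j))"
    by (simp add: sum_distrib_left mult_ac)
  also have "\<dots> = inner v (A *v v)"
    unfolding inner_vec_def Av by (simp add: v_def inner_complex_def)
  also have "\<dots> \<le> norm v * norm (A *v v)" by (rule norm_cauchy_schwarz)
  also have "\<dots> \<le> norm v * (matrix_l2_norm a * norm v)"
    unfolding matrix_l2_norm_def A_def by (intro mult_left_mono onorm[OF matrix_l2_norm_bounded_linear]) simp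
  also have "\<dots> = matrix_l2_norm a * (norm v)\<^sup>2" by (simp add: power2_eq_square)
  also have "(norm v)\<^sup>2 = (\<Sum>i\<in>UNIV. (u i)\<^sup>2)"
    by (simp add: v_def norm_vec_def L2_set_def sum_nonneg)
  finally show ?thesis .
qed

theorem theorem1p1:
  fixes T :: "'n::finite \<Rightarrow> 'a::chilbert_space \<Rightarrow> 'a"
    and \<alpha> :: "'n \<Rightarrow> 'n \<Rightarrow> real"
    and p p' :: real
  assumes "separable_space (euclidean :: 'a topology)"
    and "CARD('n) \<ge> 2"
    and "p \<ge> 2"
    and "p' = p / (p - 1)"
    and "\<And>i. T i \<in> schatten_class p"
    and "\<And>i j. \<alpha> i j = \<alpha> j i"
    and "\<And>i j. \<alpha> i j \<in> {0..1}"
    and "\<And>i j. schatten_norm (p / 2) (T i \<circ> cadjoint (T j))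
           \<le> (\<alpha> i j)\<^sup>2 * schatten_norm p (T i) * schatten_norm p (T j)"
    and "\<And>i j. schatten_norm (p / 2) (cadjoint (T i) \<circ> T j)
           \<le> (\<alpha> i j)\<^sup>2 * schatten_norm p (T i) * schatten_norm p (T j)"
  shows "(\<lambda>x. \<Sum>j\<in>UNIV. T j x) \<in> schatten_class p \<and>
    schatten_norm p (\<lambda>x. \<Sum>j\<in>UNIV. T j x)
      \<le> matrix_l2_norm (\<lambda>i j. \<alpha> i j powr p') powr (1 / p')
          * (\<Sum>j\<in>UNIV. schatten_norm p (T j) powr p) powr (1 / p)"
proof -
  note p = assms(3) and p' = assms(4) and T = assms(5) and sym = assms(6)
  have \<alpha>: "\<alpha> i j \<ge> 0" for i j using assms(7)[of i j] by simp
  define d where "d j = schatten_norm p (T j)" for j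
  have d: "d j \<ge> 0" for j by (simp add: d_def schatten_norm_def)
  define C0 where "C0 = matrix_l2_norm (\<lambda>i j. \<alpha> i j powr p')"
  define D0 where "D0 = (\<Sum>j\<in>UNIV. d j powr p)"
  have C0: "C0 \<ge> 0" unfolding C0_def by (rule matrix_l2_norm_nonneg)
  have D0: "D0 \<ge> 0" unfolding D0_def by (intro sum_nonneg) simp
  have p0: "p > 0" and p2: "p / 2 \<ge> 1" using p by auto
  note cT = schatten_class_compact[OF T]
  note bT = compact_operator_bounded[OF cT]
  \<comment> \<open>Compactness passes to the adjoint through the factorization T* = R R U*.\<close>
  have caT: "compact_operator (cadjoint (T j))" for j
  proof -
    obtain U R where "bounded_clinear U" "compact_operator R" "\<And>x. cadjoint (T j) x = R (R (cadjoint U x))"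
      using polar_factorization[OF cT[of j]] by metis
    moreover have "compact_operator (R \<circ> (R \<circ> cadjoint U))"
      by (intro compact_operator_compose_right bounded_clinear_compose bounded_clinear_cadjoint
          compact_operator_bounded calculation)
    moreover have "R \<circ> (R \<circ> cadjoint U) = cadjoint (T j)" by (rule ext) (simp add: calculation(3))
    ultimately show ?thesis by simp
  qed
  have Z1: "T j \<circ> cadjoint (T i) \<in> schatten_class (p / 2)" for i j
    by (rule schatten_class_product[OF cT caT p schatten_class_bessel_norm(2)[OF T p] schatten_class_bessel_norm(2)[OF T p]])
  have Z2: "cadjoint (T j) \<circ> T i \<in> schatten_class (p / 2)" for i j
    by (rule schatten_class_product[OF caT cT p _ schatten_class_bessel_norm(1)[OF T p]])
      (unfold cadjoint_cadjoint[OF bT], rule schatten_class_bessel_norm(1)[OF T p])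
  have n1: "schatten_norm (p / 2) (T j \<circ> cadjoint (T i)) \<le> (\<alpha> i j)\<^sup>2 * d i * d j" for i j
    using assms(8)[of j i] by (simp add: d_def sym[of j i] mult_ac)
  have n2: "schatten_norm (p / 2) (cadjoint (T j) \<circ> T i) \<le> (\<alpha> i j)\<^sup>2 * d i * d j" for i j
    using assms(9)[of j i] by (simp add: d_def sym[of j i] mult_ac)
  have "\<exists>U R. bounded_clinear U \<and> (\<forall>x. norm (U x) \<le> norm x) \<and> compact_operator R \<and> cadjoint R = R \<and>
    (\<forall>x. T j x = U (R (R x))) \<and> (\<forall>x. cadjoint (T j) (U x) = R (R x))" for j
    using polar_factorization[OF cT[of j]] by metis
  then obtain U R where U: "\<And>j. bounded_clinear (U j)" "\<And>j x. norm (U j x) \<le> norm x"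
    and R: "\<And>j. compact_operator (R j)" "\<And>j. cadjoint (R j) = R j"
    and TU: "\<And>j x. T j x = U j (R j (R j x))" and TU': "\<And>j x. cadjoint (T j) (U j x) = R j (R j x)"
    by metis
  have U': "bounded_clinear (cadjoint (U j))" for j by (rule bounded_clinear_cadjoint[OF U(1)])
  have U'n: "norm (cadjoint (U j) v) \<le> norm v" for j v
    using cadjoint_bound(2)[OF U(1), of j 1 v] U(2) by simp
  \<comment> \<open>With P j = R j R j, the product R' j* R' j = U j P j U j* is the modulus of the
    adjoint of \<open>T j\<close>, and R' j* R j is \<open>T j\<close> itself.\<close>
  define R' where "R' j = R j \<circ> cadjoint (U j)" for j
  have R': "compact_operator (R' j)" for j
    unfolding R'_def by (rule compact_operator_compose_right[OF R(1) U'])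
  have aR': "cadjoint (R' j) = U j \<circ> R j" for j
    unfolding R'_def cadjoint_compose[OF compact_operator_bounded[OF R(1)] U'] cadjoint_cadjoint[OF U(1)] R(2) ..
  \<comment> \<open>Since R j R j = T j* U j, the product P j P i is tested through T j T i* on
    Bessel families: this consumes the first norm hypothesis, and \<open>test'\<close> the
    second.\<close>
  have test: "(\<Sum>k<n. cmod (cinner (cadjoint (R j) (R j (e k))) (cadjoint (R i) (R i (e k)))) powr (p / 2))
      \<le> ((\<alpha> i j)\<^sup>2 * d i * d j) powr (p / 2)"
    if e: "orthonormal_on {..<n} e" for i j and n :: nat and e
  proof -
    have be: "bessel_family {..<n} e" by (rule bessel_family_orthonormal[OF e]) simp
    have "cinner (cadjoint (R j) (R j (e k))) (cadjoint (R i) (R i (e k)))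
        = cinner (U j (e k)) ((T j \<circ> cadjoint (T i)) (U i (e k)))" for k
      by (simp add: R(2) TU'[symmetric] cinner_cadjoint_left[OF bT])
    then show ?thesis
      using schatten_class_bessel_test[OF Z1 p2 bessel_family_image[OF be U] bessel_family_image[OF be U] n1]
      by simp
  qed
  have test': "(\<Sum>k<n. cmod (cinner (cadjoint (R' j) (R' j (e k))) (cadjoint (R' i) (R' i (e k)))) powr (p / 2))
      \<le> ((\<alpha> i j)\<^sup>2 * d i * d j) powr (p / 2)"
    if e: "orthonormal_on {..<n} e" for i j and n :: nat and e
  proof -
    have be: "bessel_family {..<n} e" by (rule bessel_family_orthonormal[OF e]) simp
    have "cinner (cadjoint (R' j) (R' j (e k))) (cadjoint (R' i) (R' i (e k)))
        = cinner (cadjoint (U j) (e k)) ((cadjoint (T j) \<circ> T i) (cadjoint (U i) (e k)))" for k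
      unfolding aR' by (simp add: R'_def TU[symmetric] cinner_cadjoint_right[OF bT])
    then show ?thesis
      using schatten_class_bessel_test[OF Z2 p2 bessel_family_image[OF be U' U'n] bessel_family_image[OF be U' U'n] n2]
      by simp
  qed
  define Z where "Z x = (\<Sum>j\<in>UNIV. T j x)" for x
  have Z: "compact_operator Z" unfolding Z_def by (intro compact_operator_sum cT) simp
  obtain B where B: "modulus_basis Z B" using modulus_basis_exists[OF Z] by blast
  \<comment> \<open>Interpolation needs positive constants while \<open>C0\<close> and
    \<open>D0\<close> may vanish; hence strict upper bounds here, removed by a limit in
    \<open>bound0\<close>.\<close>
  have bound: "(\<Sum>b\<in>F. norm (Z b) powr p) \<le> C powr (p - 1) * D"
    if F: "finite F" "F \<subseteq> B" and C: "C > C0" and D: "D > D0" for F C D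
  proof -
    have C1: "C > 0" and D1: "D > 0" using C D C0 D0 by auto
    have D2: "(\<Sum>i\<in>UNIV. d i powr p) \<le> D" using D by (simp add: D0_def)
    have C2: "(\<Sum>i\<in>UNIV. \<Sum>j\<in>UNIV. \<alpha> i j powr p' * (u i * u j)) \<le> C * (\<Sum>i\<in>UNIV. (u i)\<^sup>2)" for u
    proof -
      have "C0 * (\<Sum>i\<in>UNIV. (u i)\<^sup>2) \<le> C * (\<Sum>i\<in>UNIV. (u i)\<^sup>2)"
        using C by (intro mult_right_mono sum_nonneg) auto
      then show ?thesis
        using matrix_l2_norm_quadratic[of "\<lambda>i j. \<alpha> i j powr p'" u] by (simp add: C0_def)
    qed
    define F' where "F' = {b \<in> F. Z b \<noteq> 0}"
    have F': "finite F'" "F' \<subseteq> B" using F by (auto simp: F'_def)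
    define f where "f b = complex_of_real (inverse (norm (Z b))) *\<^sub>C Z b" for b
    have "orthonormal_on F' f"
      unfolding f_def by (rule orthonormal_normalized_images[OF Z B F'(2)]) (simp add: F'_def)
    then have bf: "bessel_family F' f" by (rule bessel_family_orthonormal[OF _ F'(1)])
    have bb: "bessel_family F' (\<lambda>b. b)"
      by (rule bessel_family_orthonormal[OF onb_orthonormal_subset[OF modulus_basisD(1)[OF B] F'(2)] F'(1)])
    define x where "x b = (\<Sum>j\<in>UNIV. (norm (R' j (f b)))\<^sup>2)" for b
    define y where "y b = (\<Sum>j\<in>UNIV. (norm (R j b))\<^sup>2)" for b
    have xy0: "x b \<ge> 0" "y b \<ge> 0" for b by (auto simp: x_def y_def intro: sum_nonneg)
    have "(\<Sum>b\<in>F. norm (Z b) powr p) = (\<Sum>b\<in>F'. norm (Z b) powr p)"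
      using F(1) by (intro sum.mono_neutral_right) (auto simp: F'_def)
    \<comment> \<open>|Z b| is the sum over \<open>j\<close> of <R' j (f b), R j b>, with
      \<open>f b\<close> the normalised image of \<open>b\<close>. Cauchy-Schwarz over
      \<open>j\<close> and then over \<open>b\<close> separates the two factors, which obey the same
      bound.\<close>
    also have "\<dots> \<le> sqrt (\<Sum>b\<in>F'. x b powr p) * sqrt (\<Sum>b\<in>F'. y b powr p)"
    proof (rule sum_sqrt_product_le)
      fix b
      have "norm (Z b) = cmod (cinner (f b) (Z b))" unfolding f_def cinner_normalized by simp
      also have "cinner (f b) (Z b) = (\<Sum>j\<in>UNIV. cinner (R' j (f b)) (R j b))"
        unfolding Z_def cinner.sum_right TU
        by (intro sum.cong refl)
          (simp add: R'_def cinner_cadjoint_left[OF U(1), symmetric]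
            cinner_cadjoint_left[OF compact_operator_bounded[OF R(1)], symmetric] R(2))
      also have "cmod \<dots> \<le> (\<Sum>j\<in>UNIV. norm (R' j (f b)) * norm (R j b))"
        by (rule order_trans[OF norm_sum]) (intro sum_mono norm_cinner_le)
      also have "\<dots> \<le> sqrt (x b) * sqrt (y b)"
        unfolding x_def y_def by (rule sum_sqrt_product_le) auto
      finally have "norm (Z b) powr p \<le> (sqrt (x b) * sqrt (y b)) powr p"
        using p0 by (intro powr_mono2) auto
      also have "\<dots> = sqrt (x b powr p) * sqrt (y b powr p)"
        using xy0 by (simp add: powr_mult powr_powr mult.commute flip: powr_half_sqrt)
      finally show "norm (Z b) powr p \<le> sqrt (x b powr p) * sqrt (y b powr p)" .
    qed auto
    also have "\<dots> \<le> sqrt (C powr (p - 1) * D) * sqrt (C powr (p - 1) * D)"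
    proof (intro mult_mono real_sqrt_le_mono)
      show "(\<Sum>b\<in>F'. x b powr p) \<le> C powr (p - 1) * D"
        unfolding x_def by (rule positive_sum_test[OF R' p p' \<alpha> d test' C1 C2 D1 D2 bf])
      show "(\<Sum>b\<in>F'. y b powr p) \<le> C powr (p - 1) * D"
        unfolding y_def by (rule positive_sum_test[OF R(1) p p' \<alpha> d test C1 C2 D1 D2 bb])
    qed (use D1 in \<open>auto intro: sum_nonneg\<close>)
    also have "\<dots> = C powr (p - 1) * D" using D1 by simp
    finally show ?thesis .
  qed
  have bound0: "(\<Sum>b\<in>F. norm (Z b) powr p) \<le> C0 powr (p - 1) * D0" if F: "finite F" "F \<subseteq> B" for F
  proof -
    have lim: "((\<lambda>\<epsilon>. (C0 + \<epsilon>) powr (p - 1) * (D0 + \<epsilon>)) \<longlongrightarrow> (C0 + 0) powr (p - 1) * (D0 + 0)) (at_right 0)"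
      using p C0 by (intro tendsto_intros tendsto_powr') (auto simp: eventually_at_right_field intro!: exI[of _ 1])
    have "eventually (\<lambda>\<epsilon>. (\<Sum>b\<in>F. norm (Z b) powr p) \<le> (C0 + \<epsilon>) powr (p - 1) * (D0 + \<epsilon>)) (at_right 0)"
      using bound[OF F] by (auto simp: eventually_at_right_field intro!: exI[of _ 1])
    from tendsto_lowerbound[OF lim this] show ?thesis by simp
  qed
  have "schatten_norm p Z \<le> (C0 powr (p - 1) * D0) powr (1 / p)"
    by (rule schatten_classI(2)[OF Z B p0 bound0])
  \<comment> \<open>Here (p - 1)/p = 1/p'.\<close>
  also have "\<dots> = C0 powr (1 / p') * D0 powr (1 / p)"
    using D0 p by (simp add: powr_mult powr_powr p')
  finally have "schatten_norm p Z \<le> C0 powr (1 / p') * D0 powr (1 / p)" .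
  moreover have "Z \<in> schatten_class p" by (rule schatten_classI(1)[OF Z B p0 bound0])
  moreover have "Z = (\<lambda>x. \<Sum>j\<in>UNIV. T j x)" by (rule ext) (simp add: Z_def)
  ultimately show ?thesis by (simp add: C0_def D0_def d_def)
qed

end
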